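(* Let $w_0$ be the longest element of the Weyl group $W$. As operators on $\mathcal{K}$, $$\Delta_v\cdot\mathcal{D}_{w_0}=\sum_{w\in W}\mathcal{T}_w,$$ where $\Delta_v$ stands for multiplication by the rational function $\Delta_v$.
   Context: Root data. $\Phi$ is an irreducible reduced root system of rank $r$ with Weyl group $W$, positive and negative roots $\Phi=\Phi^+\cup\Phi^-$, simple roots $\alpha_1,\dots,\alpha_r$ and simple reflections $\sigma_i=\sigma_{\alpha_i}$. $\Lambda$ is a lattice (free abelian group of finite rank) containing $\Phi$, on which $W$ acts compatibly with its action on $\Phi$; $Q:\Lambda\to\mathbb{Z}$ is a $W$-invariant quadratic form with $B(\alpha,\beta)=Q(\alpha+\beta)-Q(\alpha)-Q(\beta)$; $Q(\alpha)\neq0$ for $\alpha\in\Phi$, and $\sigma_i\lambda=\lambda-\frac{B(\lambda,\alpha_i)}{Q(\alpha_i)}\alpha_i$ with $\frac{B(\lambda,\alpha_i)}{Q(\alpha_i)}\in\mathbb{Z}$ for all $\lambda\in\Lambda$. Fix an integer $n\ge1$. Put $m(\alpha)=n/\gcd(n,Q(\alpha))$ for $\alpha\in\Phi$, and $\Lambda_0=\{\lambda\in\Lambda: B(\alpha,\lambda)\equiv0 \bmod n\text{ for all simple roots }\alpha\}$ (then $m(\alpha)\alpha\in\Lambda_0$). $\mathcal{K}$ is the fraction field of the group algebra $\mathbb{C}[\Lambda]$ (with basis $x^\lambda$). The permutation action $(w,f)\mapsto w.f$ of $W$ on $\mathcal{K}$ is by field automorphisms with $w.x^\lambda=x^{w\lambda}$.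 Each character $\xi$ of $\Lambda/\Lambda_0$ acts on $\mathcal{K}$ by the field automorphism $x^\lambda\mapsto\xi(\bar\lambda)x^\lambda$; put $\mathcal{K}_{\bar\lambda}=\{f:\xi(f)=\xi(\bar\lambda)f\ \forall\xi\}$, so $\mathcal{K}=\bigoplus_{\bar\lambda\in\Lambda/\Lambda_0}\mathcal{K}_{\bar\lambda}$, and $\mathcal{K}_0=\mathcal{K}_{\bar0}$. Parameters: nonzero complex numbers $v,g_0,\dots,g_{n-1}$ with $g_0=-1$ and $g_ig_{n-i}=v^{-1}$ for $1\le i\le n-1$; $g_j$ for any integer $j$ depends only on $j\bmod n$. For a positive integer $m$, $r_m(j)\in\{0,\dots,m-1\}$ is the remainder of $j$ on division by $m$. Metaplectic action. For $f\in\mathcal{K}_{\bar\lambda}$ (any lift $\lambda$), $$\sigma_i(f)=\frac{\sigma_i.f}{1-vx^{m(\alpha_i)\alpha_i}}\Bigl[x^{-r_{m(\alpha_i)}\left(-\frac{B(\lambda,\alpha_i)}{Q(\alpha_i)}\right)\alpha_i}(1-v)-v\,g_{Q(\alpha_i)-B(\lambda,\alpha_i)}\,x^{(1-m(\alpha_i))\alpha_i}(1-x^{m(\alpha_i)\alpha_i})\Bigr],$$ extended additively to $\mathcal{K}$. It is known that this extends to a ($\mathbb{C}$-linear, generally not multiplicative) action $(w,f)\mapsto w(f)$ of $W$ on $\mathcal{K}$. Demazure and Demazure-Lusztig operators, with $\sigma_i(f)$ the metaplectic action: $$\mathcal{D}_i(f)=\frac{f-x^{m(\alpha_i)\alpha_i}\sigma_i(f)}{1-x^{m(\alpha_i)\alpha_i}},\qquad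 \mathcal{T}_i(f)=(1-v\,x^{m(\alpha_i)\alpha_i})\,\mathcal{D}_i(f)-f.$$ For $w\in W$ with reduced expression $w=\sigma_{i_1}\cdots\sigma_{i_l}$, $\mathcal{D}_w=\mathcal{D}_{i_1}\cdots\mathcal{D}_{i_l}$ and $\mathcal{T}_w=\mathcal{T}_{i_1}\cdots\mathcal{T}_{i_l}$ (independent of the reduced expression). $\Delta_v=\prod_{\alpha\in\Phi^+}(1-v\,x^{m(\alpha)\alpha})$. *)

theory Defs
  imports
    Complex_Main
    "HOL-Library.Poly_Mapping"
    "HOL-Computational_Algebra.Polynomial"
    "HOL-Computational_Algebra.Fraction_Field"
begin

section \<open>Lattices\<close>

context ab_group_add
begin

definition zscale :: "int \<Rightarrow> 'a \<Rightarrow> 'a" where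
  "zscale k x = (if 0 \<le> k then (\<Sum>i<nat k. x) else - (\<Sum>i<nat (- k). x))"

end

class zlattice = ab_group_add +
  assumes ex_finite_zbasis:
    "\<exists>B. finite B \<and>
       (\<forall>x. \<exists>!c. (\<forall>b. b \<notin> B \<longrightarrow> c b = 0) \<and> x = (\<Sum>b\<in>B. zscale (c b) b))"

lemma zscale_zero [simp]: "zscale 0 (x::'a::ab_group_add) = 0"
  by (simp add: zscale_def)

lemma zscale_succ: "zscale (k + 1) (x::'a::ab_group_add) = zscale k x + x"
proof (cases "0 \<le> k")
  case True
  then have "nat (k + 1) = Suc (nat k)" by simp
  with True show ?thesis by (simp add: zscale_def)
next
  case False
  then have "nat (- k) = Suc (nat (- (k + 1)))" by simp
  then have "zscale k x = - (\<Sum>i<nat (- (k + 1)). x) - x"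
    using False by (simp add: zscale_def)
  moreover have "zscale (k + 1) x = - (\<Sum>i<nat (- (k + 1)). x)"
    using False by (cases "k = -1") (auto simp: zscale_def)
  ultimately show ?thesis by simp
qed

lemma zscale_add_left: "zscale (j + k) (x::'a::ab_group_add) = zscale j x + zscale k x"
proof (induction k rule: int_induct[where k = 0])
  case base
  show ?case by simp
next
  case (step1 i)
  have "zscale (j + (i + 1)) x = zscale (j + i) x + x"
    using zscale_succ[of "j + i" x] by (simp add: add.assoc)
  with step1 show ?case by (simp add: zscale_succ add.assoc)
next
  case (step2 i)
  have "zscale (j + i) x = zscale (j + (i - 1)) x + x"
    using zscale_succ[of "j + (i - 1)" x] by (simp add: algebra_simps)
  moreover have "zscale i x = zscale (i - 1) x + x"
    using zscale_succ[of "i - 1" x] by simp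
  ultimately have "zscale (j + (i - 1)) x + x = (zscale j x + zscale (i - 1) x) + x"
    using step2 by (simp add: add.assoc)
  then show ?case by simp
qed

lemma zlattice_embedding:
  obtains \<phi> :: "'l::zlattice \<Rightarrow> int poly"
  where "\<And>x y. \<phi> (x + y) = \<phi> x + \<phi> y" and "inj \<phi>"
proof -
  obtain B :: "'l set" where B: "finite B" and
    *: "\<forall>x. \<exists>!c. (\<forall>b. b \<notin> B \<longrightarrow> c b = 0) \<and> x = (\<Sum>b\<in>B. zscale (c b) b)"
    using ex_finite_zbasis by (elim exE conjE)
  note ex = *[rule_format]
  define co where
    "co x = (THE c. (\<forall>b. b \<notin> B \<longrightarrow> c b = 0) \<and> x = (\<Sum>b\<in>B. zscale (c b) b))" for x
  have co: "(\<forall>b. b \<notin> B \<longrightarrow> co x b = 0) \<and> x = (\<Sum>b\<in>B. zscale (co x b) b)" for x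
    unfolding co_def by (rule theI'[OF ex])
  have co_add: "co (x + y) = (\<lambda>b. co x b + co y b)" for x y
  proof -
    have "x + y = (\<Sum>b\<in>B. zscale (co x b) b) + (\<Sum>b\<in>B. zscale (co y b) b)"
      using co[of x] co[of y] by simp
    also have "\<dots> = (\<Sum>b\<in>B. zscale (co x b + co y b) b)"
      by (simp add: zscale_add_left sum.distrib)
    finally have "(\<forall>b. b \<notin> B \<longrightarrow> co x b + co y b = 0) \<and>
        x + y = (\<Sum>b\<in>B. zscale (co x b + co y b) b)"
      using co[of x] co[of y] by simp
    then show ?thesis
      unfolding co_def[of "x + y"] by (rule the1_equality[OF ex])
  qed
  obtain e :: "'l \<Rightarrow> nat" where e: "inj_on e B"
    using finite_imp_inj_to_nat_seg[OF B] by blast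
  define \<phi> where "\<phi> x = (\<Sum>b\<in>B. monom (co x b) (e b))" for x
  have add: "\<phi> (x + y) = \<phi> x + \<phi> y" for x y
    by (simp add: \<phi>_def co_add flip: add_monom sum.distrib)
  have coeff: "coeff (\<phi> x) (e b) = co x b" if "b \<in> B" for x b
  proof -
    have "coeff (\<phi> x) (e b) = (\<Sum>b'\<in>B. if b' = b then co x b' else 0)"
      unfolding \<phi>_def coeff_sum
      by (rule sum.cong) (use e that in \<open>auto simp: inj_on_def\<close>)
    with that B show ?thesis by simp
  qed
  have "inj \<phi>"
  proof (rule injI)
    fix x y
    assume "\<phi> x = \<phi> y"
    then have "co x b = co y b" if "b \<in> B" for b
      using coeff[OF that] by metis
    then have "(\<Sum>b\<in>B. zscale (co x b) b) = (\<Sum>b\<in>B. zscale (co y b) b)"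
      by simp
    with co[of x] co[of y] show "x = y" by simp
  qed
  with add that show ?thesis by blast
qed

section \<open>The group algebra and its fraction field\<close>

text \<open>
  The type \<open>'l \<Rightarrow>\<^sub>0 complex\<close> already carries the convolution product, but the library makes it an
  integral domain only for linearly ordered \<open>'l\<close>; the copy below is one for every lattice.
\<close>

typedef (overloaded) 'l group_algebra = "UNIV :: ('l::zlattice \<Rightarrow>\<^sub>0 complex) set"
  morphisms coeffs group_algebra_of ..

setup_lifting type_definition_group_algebra

lemma poly_mapping_no_zero_divisors:
  fixes p q :: "'l::zlattice \<Rightarrow>\<^sub>0 complex"
  assumes "p \<noteq> 0" and "q \<noteq> 0"
  shows "p * q \<noteq> 0"
proof -
  obtain \<phi> :: "'l \<Rightarrow> int poly"
    where \<phi>: "\<And>x y. \<phi> (x + y) = \<phi> x + \<phi> y" "inj \<phi>"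
    by (rule zlattice_embedding) blast
  have max: "\<exists>a\<in>Poly_Mapping.keys p. \<forall>b\<in>Poly_Mapping.keys p. \<phi> b \<le> \<phi> a" if "p \<noteq> 0" for p :: "'l \<Rightarrow>\<^sub>0 complex"
  proof -
    have *: "finite (\<phi> ` Poly_Mapping.keys p)" "\<phi> ` Poly_Mapping.keys p \<noteq> {}"
      using that by auto
    from Max_in[OF *] Max_ge[OF *(1)] show ?thesis by (metis imageE imageI)
  qed
  obtain a where a: "a \<in> Poly_Mapping.keys p" "\<And>b. b \<in> Poly_Mapping.keys p \<Longrightarrow> \<phi> b \<le> \<phi> a"
    using max[OF assms(1)] by blast
  obtain a' where a': "a' \<in> Poly_Mapping.keys q" "\<And>b. b \<in> Poly_Mapping.keys q \<Longrightarrow> \<phi> b \<le> \<phi> a'"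
    using max[OF assms(2)] by blast
  have only: "b = a \<and> b' = a'" if "b \<in> Poly_Mapping.keys p" "b' \<in> Poly_Mapping.keys q" "a + a' = b + b'" for b b'
  proof -
    have "\<phi> a + \<phi> a' = \<phi> b + \<phi> b'" using \<phi>(1) that(3) by metis
    with a(2)[OF that(1)] a'(2)[OF that(2)] have "\<phi> b = \<phi> a" "\<phi> b' = \<phi> a'" by linarith+
    with \<phi>(2) show ?thesis by (simp add: inj_eq)
  qed
  have "Poly_Mapping.lookup (p * q) (a + a') =
      prod_fun (Poly_Mapping.lookup p) (Poly_Mapping.lookup q) (a + a')"
    by transfer simp
  also have "\<dots> = (\<Sum>(b, b'). Poly_Mapping.lookup p b * Poly_Mapping.lookup q b' when a + a' = b + b')"
    by (rule prod_fun_unfold_prod) simp_all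
  also have "\<dots> = (\<Sum>x. Poly_Mapping.lookup p a * Poly_Mapping.lookup q a' when x = (a, a'))"
    by (rule Sum_any.cong) (use only in \<open>auto simp: when_def in_keys_iff split: prod.splits\<close>)
  also have "\<dots> = Poly_Mapping.lookup p a * Poly_Mapping.lookup q a'"
    by simp
  finally show ?thesis using a(1) a'(1) by (auto simp: in_keys_iff)
qed

instantiation group_algebra :: (zlattice) idom
begin

lift_definition zero_group_algebra :: "'a group_algebra" is 0 .
lift_definition one_group_algebra :: "'a group_algebra" is 1 .
lift_definition plus_group_algebra :: "'a group_algebra \<Rightarrow> 'a group_algebra \<Rightarrow> 'a group_algebra" is "(+)" .
lift_definition minus_group_algebra :: "'a group_algebra \<Rightarrow> 'a group_algebra \<Rightarrow> 'a group_algebra" is "(-)" .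
lift_definition uminus_group_algebra :: "'a group_algebra \<Rightarrow> 'a group_algebra" is uminus .
lift_definition times_group_algebra :: "'a group_algebra \<Rightarrow> 'a group_algebra \<Rightarrow> 'a group_algebra" is "(*)" .

instance
  by intro_classes
    (transfer, simp add: algebra_simps poly_mapping_no_zero_divisors)+

end

text \<open>\<open>ga_term c \<nu>\<close> is \<open>c x\<^sup>\<nu>\<close>.\<close>

lift_definition ga_term :: "complex \<Rightarrow> 'l::zlattice \<Rightarrow> 'l group_algebra"
  is "\<lambda>c \<nu>. Poly_Mapping.single \<nu> c" .

text \<open>The linear map of the group algebra sending \<open>x\<^sup>\<nu>\<close> to \<open>c(\<nu>) x\<^bsup>h(\<nu>)\<^esup>\<close>.\<close>

definition ga_map :: "('l::zlattice \<Rightarrow> complex) \<Rightarrow> ('l \<Rightarrow> 'l) \<Rightarrow> 'l group_algebra \<Rightarrow> 'l group_algebra"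
  where "ga_map c h p = (\<Sum>\<nu>\<in>Poly_Mapping.keys (coeffs p). ga_term (c \<nu> * Poly_Mapping.lookup (coeffs p) \<nu>) (h \<nu>))"

text \<open>The map of fraction fields induced by an injective ring endomorphism.\<close>

definition fract_map :: "('a::idom \<Rightarrow> 'a) \<Rightarrow> 'a fract \<Rightarrow> 'a fract" where
  "fract_map \<theta> f = (THE y. \<forall>a b. b \<noteq> 0 \<and> f = Fract a b \<longrightarrow> y = Fract (\<theta> a) (\<theta> b))"

type_synonym 'l ratfun = "'l group_algebra fract"

definition const :: "complex \<Rightarrow> 'l::zlattice ratfun" where
  "const c = Fract (ga_term c 0) 1"

definition X :: "'l::zlattice \<Rightarrow> 'l ratfun" where
  "X \<nu> = Fract (ga_term 1 \<nu>) 1"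

definition perm_act :: "('l::zlattice \<Rightarrow> 'l) \<Rightarrow> 'l ratfun \<Rightarrow> 'l ratfun" where
  "perm_act w = fract_map (ga_map (\<lambda>_. 1) w)"

definition char_act :: "('l::zlattice \<Rightarrow> complex) \<Rightarrow> 'l ratfun \<Rightarrow> 'l ratfun" where
  "char_act \<xi> = fract_map (ga_map \<xi> id)"

text \<open>
  The remaining lemmas of this section show that \<^const>\<open>perm_act\<close> and \<^const>\<open>char_act\<close> are
  \<open>\<complex>\<close>-linear ring homomorphisms with the intended values on the \<open>x\<^sup>\<nu>\<close>.
\<close>

lemma coeffs_sum: "coeffs (\<Sum>i\<in>A. f i) = (\<Sum>i\<in>A. coeffs (f i))"
  by (induction A rule: infinite_finite_induct)
    (simp_all add: zero_group_algebra.rep_eq plus_group_algebra.rep_eq)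

lemma ga_term_add: "ga_term (c + d) \<nu> = ga_term c \<nu> + ga_term d \<nu>"
  by transfer (rule single_add)

lemma ga_term_zero [simp]: "ga_term 0 \<nu> = 0"
  by transfer simp

lemma ga_term_mult: "ga_term c \<nu> * ga_term d \<mu> = ga_term (c * d) (\<nu> + \<mu>)"
  by transfer (simp add: mult_single)

lemma ga_term_one: "ga_term 1 0 = 1"
  by transfer simp

lemma ga_map_superset:
  assumes "finite A" and "Poly_Mapping.keys (coeffs p) \<subseteq> A"
  shows "ga_map c h p = (\<Sum>\<nu>\<in>A. ga_term (c \<nu> * Poly_Mapping.lookup (coeffs p) \<nu>) (h \<nu>))"
  unfolding ga_map_def
  by (rule sum.mono_neutral_left) (use assms in \<open>auto simp: in_keys_iff\<close>)

lemma ga_map_add: "ga_map c h (p + q) = ga_map c h p + ga_map c h q"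
proof -
  let ?A = "Poly_Mapping.keys (coeffs p) \<union> Poly_Mapping.keys (coeffs q)"
  have "Poly_Mapping.keys (coeffs (p + q)) \<subseteq> ?A"
    unfolding plus_group_algebra.rep_eq by (rule keys_add)
  then have "ga_map c h (p + q) =
      (\<Sum>\<nu>\<in>?A. ga_term (c \<nu> * Poly_Mapping.lookup (coeffs (p + q)) \<nu>) (h \<nu>))"
    by (intro ga_map_superset) auto
  also have "\<dots> = (\<Sum>\<nu>\<in>?A. ga_term (c \<nu> * Poly_Mapping.lookup (coeffs p) \<nu>) (h \<nu>)) +
      (\<Sum>\<nu>\<in>?A. ga_term (c \<nu> * Poly_Mapping.lookup (coeffs q) \<nu>) (h \<nu>))"
    by (simp add: plus_group_algebra.rep_eq lookup_add distrib_left ga_term_add sum.distrib)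
  also have "\<dots> = ga_map c h p + ga_map c h q"
    by (intro arg_cong2[where f = "(+)"] ga_map_superset[symmetric]) auto
  finally show ?thesis .
qed

lemma ga_map_zero [simp]: "ga_map c h 0 = 0"
  by (simp add: ga_map_def zero_group_algebra.rep_eq)

lemma ga_map_term: "ga_map c h (ga_term d \<nu>) = ga_term (c \<nu> * d) (h \<nu>)"
  by (cases "d = 0")
    (simp, simp add: ga_map_def ga_term.rep_eq)

lemma ga_induct [case_names zero add]:
  fixes p :: "'l::zlattice group_algebra"
  assumes zero: "P 0" and add: "\<And>p d \<nu>. P p \<Longrightarrow> P (p + ga_term d \<nu>)"
  shows "P p"
proof -
  have P_sum: "P (\<Sum>\<nu>\<in>A. ga_term (k \<nu>) \<nu>)" if "finite A" for A k
    using that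
  proof (induction A)
    case empty
    show ?case by (simp add: zero)
  next
    case (insert y A)
    from add[OF insert.IH, of "k y" y] insert.hyps show ?case by (simp add: add.commute)
  qed
  have "p = (\<Sum>\<nu>\<in>Poly_Mapping.keys (coeffs p). ga_term (Poly_Mapping.lookup (coeffs p) \<nu>) \<nu>)"
  proof -
    have "coeffs (\<Sum>\<nu>\<in>Poly_Mapping.keys (coeffs p). ga_term (Poly_Mapping.lookup (coeffs p) \<nu>) \<nu>) = coeffs p"
    proof (rule poly_mapping_eqI)
      fix \<mu>
      show "Poly_Mapping.lookup (coeffs (\<Sum>\<nu>\<in>Poly_Mapping.keys (coeffs p). ga_term (Poly_Mapping.lookup (coeffs p) \<nu>) \<nu>)) \<mu> =
          Poly_Mapping.lookup (coeffs p) \<mu>"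
        by (simp add: coeffs_sum lookup_sum ga_term.rep_eq lookup_single when_def in_keys_iff)
    qed
    then show ?thesis by (simp add: coeffs_inject)
  qed
  with P_sum[of "Poly_Mapping.keys (coeffs p)" "Poly_Mapping.lookup (coeffs p)"] show ?thesis by simp
qed

lemma ga_map_mult:
  assumes h: "\<And>\<nu> \<mu>. h (\<nu> + \<mu>) = h \<nu> + h \<mu>" and c: "\<And>\<nu> \<mu>. c (\<nu> + \<mu>) = c \<nu> * c \<mu>"
  shows "ga_map c h (p * q) = ga_map c h p * ga_map c h q"
proof (induction p rule: ga_induct)
  case (add p d \<nu>)
  have "ga_map c h (ga_term d \<nu> * q) = ga_map c h (ga_term d \<nu>) * ga_map c h q"
    by (induction q rule: ga_induct)
      (simp_all add: distrib_left ga_map_add ga_term_mult ga_map_term h c ac_simps)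
  with add show ?case by (simp add: distrib_right ga_map_add)
qed simp

lemma ga_map_eq_0_iff:
  assumes h: "inj h" and c: "\<And>\<nu>. c \<nu> \<noteq> 0"
  shows "ga_map c h p = 0 \<longleftrightarrow> p = 0"
proof
  assume *: "ga_map c h p = 0"
  have "Poly_Mapping.lookup (coeffs p) \<mu> = 0" for \<mu>
  proof -
    have "c \<mu> * Poly_Mapping.lookup (coeffs p) \<mu> = Poly_Mapping.lookup (coeffs (ga_map c h p)) (h \<mu>)"
      using h by (simp add: ga_map_def coeffs_sum lookup_sum ga_term.rep_eq lookup_single
          when_def inj_eq in_keys_iff)
    with * c[of \<mu>] show ?thesis by (simp add: zero_group_algebra.rep_eq)
  qed
  then have "coeffs p = coeffs 0"
    by (intro poly_mapping_eqI) (simp add: zero_group_algebra.rep_eq)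
  then show "p = 0" by (simp add: coeffs_inject)
qed simp

lemma fract_map_Fract:
  assumes mult: "\<And>a b. \<theta> (a * b) = \<theta> a * \<theta> b" and nz: "\<And>a. \<theta> a = 0 \<longleftrightarrow> a = 0"
    and "b \<noteq> 0"
  shows "fract_map \<theta> (Fract a b) = Fract (\<theta> a) (\<theta> b)"
  unfolding fract_map_def
proof (rule the_equality)
  have "Fract (\<theta> a) (\<theta> b) = Fract (\<theta> a') (\<theta> b')"
    if b': "b' \<noteq> 0" and eq: "Fract a b = Fract a' b'" for a' b'
  proof -
    have "a * b' = a' * b" using eq b' \<open>b \<noteq> 0\<close> by (simp add: eq_fract)
    then have "\<theta> a * \<theta> b' = \<theta> a' * \<theta> b" by (metis mult)
    with b' \<open>b \<noteq> 0\<close> show ?thesis by (simp add: eq_fract nz)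
  qed
  then show "\<forall>a' b'. b' \<noteq> 0 \<and> Fract a b = Fract a' b' \<longrightarrow>
      Fract (\<theta> a) (\<theta> b) = Fract (\<theta> a') (\<theta> b')"
    by blast
qed (use \<open>b \<noteq> 0\<close> in blast)

lemma fract_map_hom:
  assumes add: "\<And>a b. \<theta> (a + b) = \<theta> a + \<theta> b"
    and mult: "\<And>a b. \<theta> (a * b) = \<theta> a * \<theta> b" and nz: "\<And>a. \<theta> a = 0 \<longleftrightarrow> a = 0"
  shows "fract_map \<theta> (f + g) = fract_map \<theta> f + fract_map \<theta> g"
    and "fract_map \<theta> (f * g) = fract_map \<theta> f * fract_map \<theta> g"
proof -
  obtain a b where f: "f = Fract a b" "b \<noteq> 0" by (cases f)
  obtain a' b' where g: "g = Fract a' b'" "b' \<noteq> 0" by (cases g)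
  from f(2) g(2) nz have nz': "\<theta> b \<noteq> 0" "\<theta> b' \<noteq> 0" "b * b' \<noteq> 0" by auto
  show "fract_map \<theta> (f + g) = fract_map \<theta> f + fract_map \<theta> g"
    using f(2) g(2) nz' unfolding f(1) g(1)
    by (simp add: fract_map_Fract[of \<theta>, OF mult nz] add mult)
  show "fract_map \<theta> (f * g) = fract_map \<theta> f * fract_map \<theta> g"
    using f(2) g(2) nz' unfolding f(1) g(1)
    by (simp add: fract_map_Fract[of \<theta>, OF mult nz] mult)
qed

lemma additive_zero:
  fixes h :: "'l::ab_group_add \<Rightarrow> 'l"
  assumes "\<And>\<nu> \<mu>. h (\<nu> + \<mu>) = h \<nu> + h \<mu>"
  shows "h 0 = 0"
  using assms[of 0 0] by simp

lemma perm_act_hom: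
  fixes w :: "'l::zlattice \<Rightarrow> 'l"
  assumes w: "\<And>\<nu> \<mu>. w (\<nu> + \<mu>) = w \<nu> + w \<mu>" and "inj w"
  shows "perm_act w (X \<nu>) = X (w \<nu>)" and "perm_act w (const c) = const c"
    and "perm_act w (f + g) = perm_act w f + perm_act w g"
    and "perm_act w (f * g) = perm_act w f * perm_act w g"
proof -
  let ?\<theta> = "ga_map (\<lambda>_. 1) w"
  have mult: "?\<theta> (a * b) = ?\<theta> a * ?\<theta> b" for a b by (rule ga_map_mult) (simp_all add: w)
  have nz: "?\<theta> a = 0 \<longleftrightarrow> a = 0" for a by (rule ga_map_eq_0_iff) (use \<open>inj w\<close> in simp_all)
  have w0: "w 0 = 0" by (rule additive_zero) (rule w)
  have one: "?\<theta> 1 = 1" using ga_map_term[of "\<lambda>_. 1" w 1 0] w0 by (simp add: ga_term_one)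
  show "perm_act w (X \<nu>) = X (w \<nu>)" "perm_act w (const c) = const c"
    by (simp_all add: perm_act_def X_def const_def fract_map_Fract[of ?\<theta>, OF mult nz]
        ga_map_term one w0)
  show "perm_act w (f + g) = perm_act w f + perm_act w g"
    "perm_act w (f * g) = perm_act w f * perm_act w g"
    unfolding perm_act_def by (rule fract_map_hom; simp add: ga_map_add mult nz)+
qed

lemma char_act_hom:
  fixes \<xi> :: "'l::zlattice \<Rightarrow> complex"
  assumes \<xi>: "\<And>\<nu> \<mu>. \<xi> (\<nu> + \<mu>) = \<xi> \<nu> * \<xi> \<mu>" and "\<xi> 0 = 1"
  shows "char_act \<xi> (X \<nu>) = const (\<xi> \<nu>) * X \<nu>" and "char_act \<xi> (const c) = const c"
    and "char_act \<xi> (f + g) = char_act \<xi> f + char_act \<xi> g"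
    and "char_act \<xi> (f * g) = char_act \<xi> f * char_act \<xi> g"
proof -
  let ?\<theta> = "ga_map \<xi> id"
  have "\<xi> \<nu> \<noteq> 0" for \<nu> using \<xi>[of \<nu> "- \<nu>"] \<open>\<xi> 0 = 1\<close> by auto
  then have nz: "?\<theta> a = 0 \<longleftrightarrow> a = 0" for a by (intro ga_map_eq_0_iff) simp_all
  have mult: "?\<theta> (a * b) = ?\<theta> a * ?\<theta> b" for a b by (rule ga_map_mult) (simp_all add: \<xi>)
  have one: "?\<theta> 1 = 1" using ga_map_term[of \<xi> id 1 0] \<open>\<xi> 0 = 1\<close> by (simp add: ga_term_one)
  show "char_act \<xi> (X \<nu>) = const (\<xi> \<nu>) * X \<nu>" "char_act \<xi> (const c) = const c"
    by (simp_all add: char_act_def X_def const_def fract_map_Fract[of ?\<theta>, OF mult nz]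
        ga_map_term ga_term_mult one \<open>\<xi> 0 = 1\<close>)
  show "char_act \<xi> (f + g) = char_act \<xi> f + char_act \<xi> g"
    "char_act \<xi> (f * g) = char_act \<xi> f * char_act \<xi> g"
    unfolding char_act_def by (rule fract_map_hom; simp add: ga_map_add mult nz)+
qed

section \<open>Root systems in a lattice\<close>

text \<open>
  \<open>coroot \<beta> \<nu>\<close> is the pairing of \<open>\<nu>\<close> with the coroot of \<open>\<beta>\<close>. It is a functional on the whole
  lattice, so that the reflections act on the lattice and not only on the roots.
\<close>

definition reflection :: "('l::zlattice \<Rightarrow> 'l \<Rightarrow> int) \<Rightarrow> 'l \<Rightarrow> 'l \<Rightarrow> 'l" where
  "reflection coroot \<beta> \<nu> = \<nu> - zscale (coroot \<beta> \<nu>) \<beta>"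

definition root_system :: "'l::zlattice set \<Rightarrow> ('l \<Rightarrow> 'l \<Rightarrow> int) \<Rightarrow> bool" where
  "root_system \<Phi> coroot \<longleftrightarrow>
     finite \<Phi> \<and> 0 \<notin> \<Phi> \<and>
     (\<forall>\<beta>\<in>\<Phi>. (\<forall>\<nu> \<mu>. coroot \<beta> (\<nu> + \<mu>) = coroot \<beta> \<nu> + coroot \<beta> \<mu>) \<and>
            coroot \<beta> \<beta> = 2 \<and>
            reflection coroot \<beta> ` \<Phi> = \<Phi>)"

definition reduced :: "'l::zlattice set \<Rightarrow> bool" where
  "reduced \<Phi> \<longleftrightarrow>
     (\<forall>\<beta>\<in>\<Phi>. \<forall>\<gamma>\<in>\<Phi>. (\<exists>j k. j \<noteq> 0 \<and> k \<noteq> 0 \<and> zscale j \<beta> = zscale k \<gamma>) \<longrightarrow> \<gamma> = \<beta> \<or> \<gamma> = - \<beta>)"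

definition irreducible_roots :: "'l::zlattice set \<Rightarrow> ('l \<Rightarrow> 'l \<Rightarrow> int) \<Rightarrow> bool" where
  "irreducible_roots \<Phi> coroot \<longleftrightarrow>
     \<Phi> \<noteq> {} \<and>
     \<not> (\<exists>\<Phi>1 \<Phi>2. \<Phi>1 \<noteq> {} \<and> \<Phi>2 \<noteq> {} \<and> \<Phi>1 \<inter> \<Phi>2 = {} \<and> \<Phi>1 \<union> \<Phi>2 = \<Phi> \<and>
          (\<forall>\<beta>\<in>\<Phi>1. \<forall>\<gamma>\<in>\<Phi>2. coroot \<beta> \<gamma> = 0 \<and> coroot \<gamma> \<beta> = 0))"

text \<open>\<open>r\<close> is the rank, since a base is a basis of the span of the roots.\<close>

definition simple_roots :: "'l::zlattice set \<Rightarrow> nat \<Rightarrow> (nat \<Rightarrow> 'l) \<Rightarrow> bool" where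
  "simple_roots \<Phi> r \<alpha> \<longleftrightarrow>
     (\<forall>i\<in>{1..r}. \<alpha> i \<in> \<Phi>) \<and>
     (\<forall>c. (\<Sum>i=1..r. zscale (c i) (\<alpha> i)) = 0 \<longrightarrow> (\<forall>i\<in>{1..r}. c i = 0)) \<and>
     (\<forall>\<beta>\<in>\<Phi>. \<exists>c. \<beta> = (\<Sum>i=1..r. zscale (c i) (\<alpha> i)) \<and>
        ((\<forall>i\<in>{1..r}. 0 \<le> c i) \<or> (\<forall>i\<in>{1..r}. c i \<le> 0)))"

definition polar :: "('l::zlattice \<Rightarrow> int) \<Rightarrow> 'l \<Rightarrow> 'l \<Rightarrow> int" where
  "polar Q \<nu> \<mu> = Q (\<nu> + \<mu>) - Q \<nu> - Q \<mu>"

definition quadratic_form :: "('l::zlattice \<Rightarrow> int) \<Rightarrow> bool" where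
  "quadratic_form Q \<longleftrightarrow>
     (\<forall>k \<nu>. Q (zscale k \<nu>) = k\<^sup>2 * Q \<nu>) \<and>
     (\<forall>\<nu> \<nu>' \<mu>. polar Q (\<nu> + \<nu>') \<mu> = polar Q \<nu> \<mu> + polar Q \<nu>' \<mu>)"

section \<open>Metaplectic operators\<close>

text \<open>
  The parameters \<open>g\<^sub>0, \<dots>, g\<^bsub>n-1\<^esub>\<close> are given as an \<open>n\<close>-periodic function on the integers.
\<close>

locale metaplectic_data =
  fixes \<Phi> :: "'l::zlattice set"
    and coroot :: "'l \<Rightarrow> 'l \<Rightarrow> int"
    and r :: nat
    and \<alpha> :: "nat \<Rightarrow> 'l"
    and Q :: "'l \<Rightarrow> int"
    and n :: nat
    and v :: complex
    and g :: "int \<Rightarrow> complex"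
begin

definition positive_roots :: "'l set" where
  "positive_roots =
     {\<beta> \<in> \<Phi>. \<exists>c. \<beta> = (\<Sum>i=1..r. zscale (c i) (\<alpha> i)) \<and> (\<forall>i\<in>{1..r}. 0 \<le> c i)}"

text \<open>
  The Weyl group, realized by its action on the lattice. Reflections are involutions, so the
  monoid they generate is the group they generate.
\<close>

inductive_set W :: "('l \<Rightarrow> 'l) set" where
  id: "id \<in> W"
| reflection: "w \<in> W \<Longrightarrow> \<beta> \<in> \<Phi> \<Longrightarrow> reflection coroot \<beta> \<circ> w \<in> W"

definition s :: "nat \<Rightarrow> 'l \<Rightarrow> 'l" where
  "s i = reflection coroot (\<alpha> i)"

definition word_prod :: "nat list \<Rightarrow> 'l \<Rightarrow> 'l" where
  "word_prod js = foldr (\<lambda>i w. s i \<circ> w) js id"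

definition is_word :: "nat list \<Rightarrow> ('l \<Rightarrow> 'l) \<Rightarrow> bool" where
  "is_word js w \<longleftrightarrow> set js \<subseteq> {1..r} \<and> word_prod js = w"

definition len :: "('l \<Rightarrow> 'l) \<Rightarrow> nat" where
  "len w = (LEAST k. \<exists>js. is_word js w \<and> length js = k)"

definition reduced_word :: "nat list \<Rightarrow> ('l \<Rightarrow> 'l) \<Rightarrow> bool" where
  "reduced_word js w \<longleftrightarrow> is_word js w \<and> length js = len w"

definition longest :: "('l \<Rightarrow> 'l) \<Rightarrow> bool" where
  "longest w \<longleftrightarrow> w \<in> W \<and> (\<forall>u\<in>W. len u \<le> len w)"

abbreviation B :: "'l \<Rightarrow> 'l \<Rightarrow> int" where
  "B \<equiv> polar Q"

definition m :: "'l \<Rightarrow> int" where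
  "m \<beta> = int n div gcd (int n) (Q \<beta>)"

definition Lambda0 :: "'l set" where
  "Lambda0 = {\<nu>. \<forall>i\<in>{1..r}. int n dvd B (\<alpha> i) \<nu>}"

text \<open>Characters of the quotient by \<^const>\<open>Lambda0\<close>, as functions on the lattice.\<close>

definition chars :: "('l \<Rightarrow> complex) set" where
  "chars = {\<xi>. (\<forall>\<nu> \<mu>. \<xi> (\<nu> + \<mu>) = \<xi> \<nu> * \<xi> \<mu>) \<and> (\<forall>\<nu>\<in>Lambda0. \<xi> \<nu> = 1)}"

definition K :: "'l \<Rightarrow> 'l ratfun set" where
  "K \<nu> = {f. \<forall>\<xi>\<in>chars. char_act \<xi> f = const (\<xi> \<nu>) * f}"

text \<open>
  The divisions \<open>div Q (\<alpha> i)\<close> are exact under the assumptions of the next locale.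
\<close>

definition sigma_homogeneous :: "nat \<Rightarrow> 'l \<Rightarrow> 'l ratfun \<Rightarrow> 'l ratfun" where
  "sigma_homogeneous i \<nu> f =
     perm_act (s i) f / (1 - const v * X (zscale (m (\<alpha> i)) (\<alpha> i))) *
     (X (zscale (- ((- (B \<nu> (\<alpha> i) div Q (\<alpha> i))) mod m (\<alpha> i))) (\<alpha> i)) * (1 - const v)
      - const v * const (g (Q (\<alpha> i) - B \<nu> (\<alpha> i))) *
        X (zscale (1 - m (\<alpha> i)) (\<alpha> i)) * (1 - X (zscale (m (\<alpha> i)) (\<alpha> i))))"

text \<open>
  The additive extension from the homogeneous components. It is unique because every rational
  function is a sum of homogeneous ones.
\<close>

definition sigma :: "nat \<Rightarrow> 'l ratfun \<Rightarrow> 'l ratfun" where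
  "sigma i = (THE F. (\<forall>f h. F (f + h) = F f + F h) \<and>
                     (\<forall>\<nu>. \<forall>f\<in>K \<nu>. F f = sigma_homogeneous i \<nu> f))"

definition demazure :: "nat \<Rightarrow> 'l ratfun \<Rightarrow> 'l ratfun" where
  "demazure i f =
     (f - X (zscale (m (\<alpha> i)) (\<alpha> i)) * sigma i f) / (1 - X (zscale (m (\<alpha> i)) (\<alpha> i)))"

definition demazure_lusztig :: "nat \<Rightarrow> 'l ratfun \<Rightarrow> 'l ratfun" where
  "demazure_lusztig i f =
     (1 - const v * X (zscale (m (\<alpha> i)) (\<alpha> i))) * demazure i f - f"

text \<open>
  The composite of a family of operators along a reduced word of \<open>w\<close>; for the two families
  above the choice of the word does not matter.
\<close>

definition along :: "(nat \<Rightarrow> 'l ratfun \<Rightarrow> 'l ratfun) \<Rightarrow> ('l \<Rightarrow> 'l) \<Rightarrow> 'l ratfun \<Rightarrow> 'l ratfun" where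
  "along F w = foldr (\<lambda>i G. F i \<circ> G) (SOME js. reduced_word js w) id"

definition Demazure :: "('l \<Rightarrow> 'l) \<Rightarrow> 'l ratfun \<Rightarrow> 'l ratfun" where
  "Demazure = along demazure"

definition Demazure_Lusztig :: "('l \<Rightarrow> 'l) \<Rightarrow> 'l ratfun \<Rightarrow> 'l ratfun" where
  "Demazure_Lusztig = along demazure_lusztig"

definition Delta :: "'l ratfun" where
  "Delta = (\<Prod>\<beta>\<in>positive_roots. 1 - const v * X (zscale (m \<beta>) \<beta>))"

end

locale metaplectic = metaplectic_data +
  assumes root_system: "root_system \<Phi> coroot"
    and reduced: "reduced \<Phi>"
    and irreducible: "irreducible_roots \<Phi> coroot"
    and simple_roots: "simple_roots \<Phi> r \<alpha>"
    and quadratic_form: "quadratic_form Q"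
    and invariant: "w \<in> W \<Longrightarrow> Q (w \<nu>) = Q \<nu>"
    and Q_nonzero: "\<beta> \<in> \<Phi> \<Longrightarrow> Q \<beta> \<noteq> 0"
    and Q_dvd: "i \<in> {1..r} \<Longrightarrow> Q (\<alpha> i) dvd B \<nu> (\<alpha> i)"
    and s_eq: "i \<in> {1..r} \<Longrightarrow> s i \<nu> = \<nu> - zscale (B \<nu> (\<alpha> i) div Q (\<alpha> i)) (\<alpha> i)"
    and n_pos: "1 \<le> n"
    and v_nonzero: "v \<noteq> 0"
    and g_nonzero: "g j \<noteq> 0"
    and g_periodic: "g (j mod int n) = g j"
    and g_0: "g 0 = - 1"
    and g_mult: "1 \<le> j \<Longrightarrow> j \<le> int n - 1 \<Longrightarrow> g j * g (int n - j) = inverse v"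

end

theory Submission
  imports Defs "HOL-Library.FuncSet" "HOL-Library.Sublist"
begin

text \<open>
  The operators \<open>\<D>\<^sub>i\<close> and \<open>\<T>\<^sub>i\<close> have the form \<open>c\<^sub>i + z\<^sub>i \<sigma>\<^sub>i\<close> with \<open>c\<^sub>i\<close>, \<open>z\<^sub>i\<close> of degree \<open>0\<close>, and \<open>\<sigma>\<^sub>i\<close> is semilinear
  over the permutation action on the functions of degree \<open>0\<close>. Hence their composites expand in the \<open>\<sigma>\<^sub>w\<close>
  with the same coefficients as for the permutation action and the rescaled roots \<open>m(\<alpha>) \<alpha>\<close>, and it
  suffices to compare coefficients. At \<open>v = 0\<close> the operator \<open>\<T>\<^sub>i\<close> is \<open>\<D>\<^sub>i - 1\<close>, and \<open>\<D>\<close> of the longest element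
  is the sum of all \<open>\<T>\<^sub>w\<close>. For every \<open>v\<close> the sum of the \<open>\<T>\<^sub>w\<close>, divided by \<open>\<Delta>\<^sub>v\<close>, is invariant under left
  multiplication by the \<open>\<sigma>\<^sub>i\<close>, so it is determined by its coefficient at the longest element.

  That the metaplectic \<open>\<sigma>\<^sub>i\<close> define an action of \<open>W\<close> is seen on monomials: if \<open>\<mu> - \<rho>\<close> is small
  against the rescaled coroots, then suitable multiples of the \<open>x\<^bsup>w(\<mu> - \<rho>) + \<rho>\<^esup>\<close> transform under the \<open>\<T>\<^sub>i\<close>
  like the standard basis of the Hecke algebra, whatever the parameters \<open>g\<^sub>j\<close> are.
\<close>

text \<open>Braid relations are never checked in rank two. For the T_w, two reduced words of
  \<open>w\<close> in the left operators agree on \<open>delta 0 id\<close> because both give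
  \<open>delta 0 w\<close>; operators acting from the right commute with the left ones and propagate
  the agreement. The finite right operators only move the group element, so an affine one is added
  to reach the nonconstant monomials that separate the coefficients of distinct group elements. It
  is built from a dominant root of minimal rescaled length: away from this root and its negative, a
  simple reflection then changes the monomial involved by at most one rescaled simple root, which is
  what commutation with the left operators requires. For the metaplectic action, sigma_i is
  recovered from T_i = c_i + z_i sigma_i by solving for it inside the Hecke module. There its
  relations hold because the permutation action, on all functions together, represents the module
  faithfully. They pass to rational functions because every homogeneous one is a degree 0 multiple
  of a monomial attached to a small weight.\<close>

lemma zscale_minus_left: "zscale (- k) (x::'a::ab_group_add) = - zscale k x"
  using zscale_add_left[of k "- k" x] by (simp add: eq_neg_iff_add_eq_0 add.commute)

lemma zscale_diff_left: "zscale (j - k) (x::'a::ab_group_add) = zscale j x - zscale k x"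
  using zscale_add_left[of j "- k" x] by (simp add: zscale_minus_left)

lemma zscale_1 [simp]: "zscale 1 (x::'a::ab_group_add) = x"
  using zscale_succ[of 0 x] by simp

lemma zscale_2: "zscale 2 (x::'a::ab_group_add) = x + x"
  using zscale_succ[of 1 x] by simp

lemma additive_minus:
  fixes h :: "'a::ab_group_add \<Rightarrow> 'b::ab_group_add"
  assumes "\<And>x y. h (x + y) = h x + h y"
  shows "h 0 = 0" "h (- x) = - h x" "h (x - y) = h x - h y"
proof -
  show 0: "h 0 = 0" using assms[of 0 0] by simp
  show m: "h (- x) = - h x" for x using assms[of x "- x"] 0 by (simp add: eq_neg_iff_add_eq_0 add.commute)
  show "h (x - y) = h x - h y" using assms[of x "- y"] m by simp
qed

lemma additive_sum:
  fixes h :: "'a::ab_group_add \<Rightarrow> 'b::ab_group_add"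
  assumes "\<And>x y. h (x + y) = h x + h y"
  shows "h (sum f A) = (\<Sum>a\<in>A. h (f a))"
  by (induction A rule: infinite_finite_induct) (simp_all add: assms additive_minus[OF assms])

lemma additive_zscale:
  fixes h :: "'a::ab_group_add \<Rightarrow> 'b::ab_group_add"
  assumes "\<And>x y. h (x + y) = h x + h y"
  shows "h (zscale k x) = zscale k (h x)"
  unfolding zscale_def by (simp add: additive_sum[OF assms] additive_minus[OF assms])

lemma zscale_int: "zscale k (j::int) = k * j"
  by (simp add: zscale_def)

lemma zscale_add_right: "zscale k ((x::'a::ab_group_add) + y) = zscale k x + zscale k y"
  by (simp add: zscale_def sum.distrib)

lemmas zscale_minus_right = additive_minus(2)[of "zscale k", OF zscale_add_right] for k
lemmas zscale_diff_right = additive_minus(3)[of "zscale k", OF zscale_add_right] for k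
lemmas zscale_sum_right = additive_sum[of "zscale k", OF zscale_add_right] for k

lemma zscale_zero_right [simp]: "zscale k (0::'a::ab_group_add) = 0"
  by (simp add: zscale_def)

lemma zscale_zscale: "zscale j (zscale k (x::'a::ab_group_add)) = zscale (j * k) x"
  using additive_zscale[of "\<lambda>k. zscale k x" j k, OF zscale_add_left] by (simp add: zscale_int)

text \<open>A lattice is torsion free: it embeds additively into \<open>int poly\<close>, where an
  integer multiple is a product in an integral domain.\<close>

lemma zscale_eq_0_iff [simp]: "zscale k (x::'l::zlattice) = 0 \<longleftrightarrow> k = 0 \<or> x = 0"
proof
  assume *: "zscale k x = 0"
  obtain \<phi> :: "'l \<Rightarrow> int poly" where \<phi>: "\<And>x y. \<phi> (x + y) = \<phi> x + \<phi> y" "inj \<phi>"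
    by (rule zlattice_embedding) blast
  have z: "zscale k (p::int poly) = of_int k * p" for p
  proof -
    have "zscale k p = zscale k (1 * p)" by simp
    also have "\<dots> = zscale k 1 * p"
      by (rule additive_zscale[symmetric, of "\<lambda>q. q * p"]) (simp add: distrib_right)
    also have "zscale k (1::int poly) = of_int k"
      using additive_zscale[of "of_int :: int \<Rightarrow> int poly" k 1] by (simp add: zscale_int)
    finally show ?thesis .
  qed
  have "of_int k * \<phi> x = 0"
    using additive_zscale[of \<phi>, OF \<phi>(1), of k x] * additive_minus(1)[of \<phi>, OF \<phi>(1)] z by metis
  then have "k = 0 \<or> \<phi> x = \<phi> 0" using additive_minus(1)[of \<phi>, OF \<phi>(1)] by auto
  with \<phi>(2) show "k = 0 \<or> x = 0" by (auto simp: inj_eq)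
qed auto

lemma zscale_cancel_left: "zscale k (x::'l::zlattice) = zscale k y \<longleftrightarrow> k = 0 \<or> x = y"
  using zscale_eq_0_iff[of k "x - y"] by (simp add: zscale_diff_right)

lemma zscale_cancel_right: "zscale j (x::'l::zlattice) = zscale k x \<longleftrightarrow> j = k \<or> x = 0"
  using zscale_eq_0_iff[of "j - k" x] by (simp add: zscale_diff_left)

context metaplectic
begin

subsection \<open>Reflections and the Weyl group\<close>

lemma finite_roots: "finite \<Phi>" and zero_not_root: "0 \<notin> \<Phi>"
  using root_system by (auto simp: root_system_def)

lemma coroot_add: "\<beta> \<in> \<Phi> \<Longrightarrow> coroot \<beta> (x + y) = coroot \<beta> x + coroot \<beta> y"
  and coroot_self: "\<beta> \<in> \<Phi> \<Longrightarrow> coroot \<beta> \<beta> = 2"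
  and reflection_roots: "\<beta> \<in> \<Phi> \<Longrightarrow> reflection coroot \<beta> ` \<Phi> = \<Phi>"
  using root_system by (auto simp: root_system_def)

lemma coroot_linear:
  assumes "\<beta> \<in> \<Phi>"
  shows "coroot \<beta> 0 = 0" "coroot \<beta> (- x) = - coroot \<beta> x" "coroot \<beta> (x - y) = coroot \<beta> x - coroot \<beta> y"
    "coroot \<beta> (zscale k x) = k * coroot \<beta> x" "coroot \<beta> (sum f A) = (\<Sum>a\<in>A. coroot \<beta> (f a))"
  using additive_minus[of "coroot \<beta>", OF coroot_add[OF assms]]
    additive_zscale[of "coroot \<beta>", OF coroot_add[OF assms]]
    additive_sum[of "coroot \<beta>", OF coroot_add[OF assms]] by (auto simp: zscale_int)

lemmas coroot_simps = coroot_add coroot_linear coroot_self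

abbreviation refl :: "'a \<Rightarrow> 'a \<Rightarrow> 'a" where "refl \<equiv> reflection coroot"

lemma refl_add: "\<beta> \<in> \<Phi> \<Longrightarrow> refl \<beta> (x + y) = refl \<beta> x + refl \<beta> y"
  by (simp add: reflection_def coroot_simps zscale_add_left)

lemma refl_refl [simp]: "\<beta> \<in> \<Phi> \<Longrightarrow> refl \<beta> (refl \<beta> x) = x"
  by (simp add: reflection_def coroot_simps zscale_diff_left zscale_minus_left)

lemma refl_self: "\<beta> \<in> \<Phi> \<Longrightarrow> refl \<beta> \<beta> = - \<beta>"
  by (simp add: reflection_def coroot_simps zscale_2)

lemma refl_root: "\<beta> \<in> \<Phi> \<Longrightarrow> \<gamma> \<in> \<Phi> \<Longrightarrow> refl \<beta> \<gamma> \<in> \<Phi>"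
  using reflection_roots by blast

lemma minus_root: "\<beta> \<in> \<Phi> \<Longrightarrow> - \<beta> \<in> \<Phi>"
  using refl_root[of \<beta> \<beta>] by (simp add: refl_self)

lemma minus_root_iff [simp]: "- \<beta> \<in> \<Phi> \<longleftrightarrow> \<beta> \<in> \<Phi>"
  using minus_root[of \<beta>] minus_root[of "- \<beta>"] by auto

lemma W_add: "w \<in> W \<Longrightarrow> w (x + y) = w x + w y"
  by (induction arbitrary: x y rule: W.induct) (simp_all add: refl_add)

lemma W_linear:
  assumes "w \<in> W"
  shows "w 0 = 0" "w (- x) = - w x" "w (x - y) = w x - w y"
    "w (zscale k x) = zscale k (w x)" "w (sum f A) = (\<Sum>a\<in>A. w (f a))"
  using additive_minus[of w, OF W_add[OF assms]]
    additive_zscale[of w, OF W_add[OF assms]]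
    additive_sum[of w, OF W_add[OF assms]] by auto

lemmas W_simps = W_add W_linear

lemma W_comp: "w \<in> W \<Longrightarrow> u \<in> W \<Longrightarrow> w \<circ> u \<in> W"
  by (induction rule: W.induct) (auto simp: comp_assoc intro: W.intros)

lemma refl_in_W: "\<beta> \<in> \<Phi> \<Longrightarrow> refl \<beta> \<in> W"
  using W.reflection[OF W.id, of \<beta>] by simp

lemma W_inverse: "w \<in> W \<Longrightarrow> \<exists>u\<in>W. u \<circ> w = id \<and> w \<circ> u = id"
proof (induction rule: W.induct)
  case id
  show ?case by (intro bexI[of _ id] W.id) simp_all
next
  case (reflection w \<beta>)
  then obtain u where u: "u \<in> W" "u \<circ> w = id" "w \<circ> u = id" by blast
  show ?case
  proof (intro bexI conjI)
    show "u \<circ> refl \<beta> \<in> W" using u reflection by (simp add: W_comp refl_in_W)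
    show "(u \<circ> refl \<beta>) \<circ> (refl \<beta> \<circ> w) = id" using u reflection by (simp add: fun_eq_iff)
    show "(refl \<beta> \<circ> w) \<circ> (u \<circ> refl \<beta>) = id" using u reflection by (simp add: fun_eq_iff)
  qed
qed

lemma W_bij: "w \<in> W \<Longrightarrow> bij w"
  using W_inverse by (metis o_bij)

lemma W_inj: "w \<in> W \<Longrightarrow> inj w"
  using W_bij bij_is_inj by blast

lemma inv_in_W: "w \<in> W \<Longrightarrow> inv w \<in> W"
  using W_inverse by (metis inv_unique_comp)

lemma inv_W [simp]: "w \<in> W \<Longrightarrow> inv w (w x) = x" "w \<in> W \<Longrightarrow> w (inv w x) = x"
  using W_bij by (auto simp: bij_is_inj bij_is_surj surj_f_inv_f)

lemma W_root: "w \<in> W \<Longrightarrow> \<beta> \<in> \<Phi> \<Longrightarrow> w \<beta> \<in> \<Phi>"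
  by (induction rule: W.induct) (auto simp: refl_root)

lemma W_root_iff [simp]: "w \<in> W \<Longrightarrow> w \<beta> \<in> \<Phi> \<longleftrightarrow> \<beta> \<in> \<Phi>"
  using W_root[of w \<beta>] W_root[OF inv_in_W, of w "w \<beta>"] by auto

lemma W_roots: "w \<in> W \<Longrightarrow> w ` \<Phi> = \<Phi>"
proof
  assume w: "w \<in> W"
  then show "w ` \<Phi> \<subseteq> \<Phi>" by auto
  show "\<Phi> \<subseteq> w ` \<Phi>"
  proof
    fix \<beta> assume "\<beta> \<in> \<Phi>"
    then have "inv w \<beta> \<in> \<Phi>" "\<beta> = w (inv w \<beta>)" using w by (simp_all add: inv_in_W)
    then show "\<beta> \<in> w ` \<Phi>" by blast
  qed
qed

subsection \<open>Invariant forms\<close>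

lemma B_sym: "B x y = B y x"
  by (simp add: polar_def add.commute)

lemma B_add_left: "B (x + x') y = B x y + B x' y"
  using quadratic_form by (simp add: quadratic_form_def)

lemma B_add_right: "B y (x + x') = B y x + B y x'"
  using B_add_left by (simp add: B_sym)

lemmas B_linear_left = additive_minus[of "\<lambda>x. B x y", OF B_add_left]
   additive_zscale[of "\<lambda>x. B x y", OF B_add_left, unfolded zscale_int]
   additive_sum[of "\<lambda>x. B x y", OF B_add_left] for y
lemmas B_linear_right = additive_minus[of "B y", OF B_add_right]
   additive_zscale[of "B y", OF B_add_right, unfolded zscale_int]
   additive_sum[of "B y", OF B_add_right] for y

lemmas B_simps = B_add_left B_add_right B_linear_left B_linear_right

lemma Q_zscale: "Q (zscale k x) = k\<^sup>2 * Q x"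
  using quadratic_form by (simp add: quadratic_form_def)

lemma B_W: "w \<in> W \<Longrightarrow> B (w x) (w y) = B x y"
  using invariant[of w] by (simp add: polar_def flip: W_add)

text \<open>A reflection preserves \<^term>\<open>Q\<close>, so for each \<open>x\<close> either \<open>coroot \<beta> x\<close> is zero or it has the
  value claimed here; both alternatives define subgroups, and \<open>\<beta>\<close> is not in the first one.\<close>

lemma coroot_B:
  assumes "\<beta> \<in> \<Phi>"
  shows "coroot \<beta> x * Q \<beta> = B x \<beta>"
proof -
  have or: "coroot \<beta> x = 0 \<or> coroot \<beta> x * Q \<beta> = B x \<beta>" for x
  proof -
    let ?k = "coroot \<beta> x"
    have "Q (x - zscale ?k \<beta>) = Q x"
      using invariant[OF refl_in_W[OF assms], of x] by (simp add: reflection_def)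
    moreover have "Q (x - zscale ?k \<beta>) = Q x + ?k\<^sup>2 * Q \<beta> - ?k * B x \<beta>"
    proof -
      have "Q (x - zscale ?k \<beta>) = Q x + Q (zscale (- ?k) \<beta>) + B x (zscale (- ?k) \<beta>)"
        by (simp add: polar_def zscale_minus_left)
      then show ?thesis by (simp add: Q_zscale B_simps)
    qed
    ultimately have "?k * (?k * Q \<beta> - B x \<beta>) = 0" by (simp add: power2_eq_square algebra_simps)
    then show ?thesis by auto
  qed
  have \<beta>: "coroot \<beta> \<beta> * Q \<beta> = B \<beta> \<beta>" using or[of \<beta>] coroot_self[OF assms] by auto
  show ?thesis
  proof (rule ccontr)
    assume x: "coroot \<beta> x * Q \<beta> \<noteq> B x \<beta>"
    then have "coroot \<beta> x = 0" using or by blast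
    then have "coroot \<beta> (x + \<beta>) \<noteq> 0" using assms by (simp add: coroot_simps)
    then have "coroot \<beta> (x + \<beta>) * Q \<beta> = B (x + \<beta>) \<beta>" using or by blast
    with x \<beta> show False by (simp add: coroot_simps assms B_simps distrib_right)
  qed
qed

text \<open>\<open>coroot_B\<close> expresses the coroot through the invariant forms, so it inherits
  their invariance once the nonzero factor \<open>Q \<beta>\<close> is cancelled.\<close>

lemma coroot_W:
  assumes "w \<in> W" "\<beta> \<in> \<Phi>"
  shows "coroot (w \<beta>) (w x) = coroot \<beta> x"
proof -
  have "coroot (w \<beta>) (w x) * Q \<beta> = coroot \<beta> x * Q \<beta>"
    using coroot_B[of "w \<beta>" "w x"] coroot_B[of \<beta> x] assms by (simp add: B_W invariant)
  then show ?thesis using Q_nonzero[OF assms(2)] by simp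
qed

lemma coroot_minus: "\<beta> \<in> \<Phi> \<Longrightarrow> coroot (- \<beta>) x = - coroot \<beta> x"
  using coroot_W[of "refl \<beta>" \<beta> "refl \<beta> x"]
  by (simp add: refl_in_W refl_self) (simp add: reflection_def coroot_simps)

lemma coroot_W': "w \<in> W \<Longrightarrow> \<beta> \<in> \<Phi> \<Longrightarrow> coroot (inv w \<beta>) x = coroot \<beta> (w x)"
  using coroot_W[of w "inv w \<beta>" x] by (simp add: inv_in_W)

lemma coroot_eq_0_sym: "\<beta> \<in> \<Phi> \<Longrightarrow> \<gamma> \<in> \<Phi> \<Longrightarrow> coroot \<beta> \<gamma> = 0 \<longleftrightarrow> coroot \<gamma> \<beta> = 0"
  using coroot_B[of \<beta> \<gamma>] coroot_B[of \<gamma> \<beta>] Q_nonzero[of \<beta>] Q_nonzero[of \<gamma>]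
  by (metis B_sym mult_eq_0_iff)

lemma refl_W: "w \<in> W \<Longrightarrow> \<beta> \<in> \<Phi> \<Longrightarrow> refl (w \<beta>) (w x) = w (refl \<beta> x)"
  by (simp add: reflection_def coroot_W W_simps)

text \<open>No sign condition is imposed on \<open>Q\<close>, so lengths are measured by this
  W-invariant form, which is positive semidefinite and positive on roots. It may have a radical in
  the lattice.\<close>

definition ip :: "'a \<Rightarrow> 'a \<Rightarrow> int" where
  "ip x y = (\<Sum>\<beta>\<in>\<Phi>. coroot \<beta> x * coroot \<beta> y)"

lemma ip_sym: "ip x y = ip y x"
  by (simp add: ip_def mult.commute)

lemma ip_add_right: "ip x (y + z) = ip x y + ip x z"
  by (simp add: ip_def coroot_simps distrib_left sum.distrib)

lemmas ip_linear_right = additive_minus[of "ip x", OF ip_add_right]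
   additive_zscale[of "ip x", OF ip_add_right, unfolded zscale_int]
   additive_sum[of "ip x", OF ip_add_right] for x

lemma ip_add_left: "ip (y + z) x = ip y x + ip z x"
  using ip_add_right by (simp add: ip_sym)

lemmas ip_linear_left = additive_minus[of "\<lambda>y. ip y x", OF ip_add_left]
   additive_zscale[of "\<lambda>y. ip y x", OF ip_add_left, unfolded zscale_int]
   additive_sum[of "\<lambda>y. ip y x", OF ip_add_left] for x

lemmas ip_simps = ip_add_right ip_add_left ip_linear_left ip_linear_right

lemma ip_W: "w \<in> W \<Longrightarrow> ip (w x) (w y) = ip x y"
proof -
  assume w: "w \<in> W"
  have "ip (w x) (w y) = (\<Sum>\<beta>\<in>w ` \<Phi>. coroot \<beta> (w x) * coroot \<beta> (w y))"
    using w by (simp add: ip_def W_roots)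
  also have "\<dots> = (\<Sum>\<beta>\<in>\<Phi>. coroot (w \<beta>) (w x) * coroot (w \<beta>) (w y))"
    by (rule sum.reindex_cong[where l = w]) (use W_inj[OF w] in \<open>auto simp: inj_on_def\<close>)
  also have "\<dots> = ip x y" using w by (simp add: ip_def coroot_W)
  finally show ?thesis .
qed

lemma ip_nonneg: "ip x x \<ge> 0"
  by (simp add: ip_def sum_nonneg)

lemma ip_root_pos: "\<beta> \<in> \<Phi> \<Longrightarrow> ip \<beta> \<beta> > 0"
proof -
  assume \<beta>: "\<beta> \<in> \<Phi>"
  have "coroot \<beta> \<beta> * coroot \<beta> \<beta> \<le> ip \<beta> \<beta>"
    unfolding ip_def by (rule member_le_sum) (use \<beta> finite_roots in auto)
  then show ?thesis using \<beta> by (simp add: coroot_self)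
qed

lemma ip_coroot: "\<beta> \<in> \<Phi> \<Longrightarrow> 2 * ip x \<beta> = coroot \<beta> x * ip \<beta> \<beta>"
proof -
  assume \<beta>: "\<beta> \<in> \<Phi>"
  have "ip (refl \<beta> x) (refl \<beta> \<beta>) = ip x \<beta>" by (rule ip_W[OF refl_in_W[OF \<beta>]])
  then have "ip (x - zscale (coroot \<beta> x) \<beta>) (- \<beta>) = ip x \<beta>"
    by (simp add: refl_self \<beta>) (simp add: reflection_def)
  then show ?thesis by (simp add: ip_simps)
qed

lemma ip_coroot_pos: "\<beta> \<in> \<Phi> \<Longrightarrow> coroot \<beta> x > 0 \<longleftrightarrow> ip x \<beta> > 0"
  using ip_coroot[of \<beta> x] ip_root_pos[of \<beta>]
  by (metis mult_pos_pos zero_less_mult_pos2 zero_less_numeral zero_less_mult_pos)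

declare One_nat_def [simp del] atLeastAtMost_iff [simp del]

subsection \<open>Positive roots\<close>

definition comb :: "(nat \<Rightarrow> int) \<Rightarrow> 'a" where
  "comb c = (\<Sum>i=1..r. zscale (c i) (\<alpha> i))"

definition cone :: "'a set" where
  "cone = {x. \<exists>c. x = comb c \<and> (\<forall>i\<in>{1..r}. 0 \<le> c i)}"

lemma simple_root [simp]: "i \<in> {1..r} \<Longrightarrow> \<alpha> i \<in> \<Phi>"
  using simple_roots by (simp add: simple_roots_def)

lemma comb_add: "comb (\<lambda>i. c i + d i) = comb c + comb d"
  and comb_diff: "comb (\<lambda>i. c i - d i) = comb c - comb d"
  and comb_minus: "comb (\<lambda>i. - c i) = - comb c"
  and comb_zscale: "comb (\<lambda>i. k * c i) = zscale k (comb c)"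
  by (simp_all add: comb_def zscale_add_left zscale_diff_left zscale_minus_left sum.distrib
      sum_subtractf sum_negf zscale_sum_right zscale_zscale)

lemma comb_eq_0: "comb c = 0 \<Longrightarrow> i \<in> {1..r} \<Longrightarrow> c i = 0"
  using simple_roots by (simp add: simple_roots_def comb_def)

lemma comb_eq: "comb c = comb d \<Longrightarrow> i \<in> {1..r} \<Longrightarrow> c i = d i"
  using comb_eq_0[of "\<lambda>i. c i - d i" i] by (simp add: comb_diff)

lemma comb_cong: "(\<And>i. i \<in> {1..r} \<Longrightarrow> c i = d i) \<Longrightarrow> comb c = comb d"
  by (simp add: comb_def)

lemma comb_single: "i \<in> {1..r} \<Longrightarrow> comb (\<lambda>j. if j = i then k else 0) = zscale k (\<alpha> i)"
  by (simp add: comb_def if_distrib[of "\<lambda>k. zscale k _"] cong: if_cong)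

lemma positive_iff: "\<beta> \<in> positive_roots \<longleftrightarrow> \<beta> \<in> \<Phi> \<and> \<beta> \<in> cone"
  by (auto simp: positive_roots_def cone_def comb_def)

lemma positive_root [simp]: "\<beta> \<in> positive_roots \<Longrightarrow> \<beta> \<in> \<Phi>"
  by (simp add: positive_iff)

lemma cone_zero [simp]: "0 \<in> cone"
  unfolding cone_def by (auto intro!: exI[of _ "\<lambda>_. 0"] simp: comb_def)

lemma cone_add: "x \<in> cone \<Longrightarrow> y \<in> cone \<Longrightarrow> x + y \<in> cone"
  unfolding cone_def mem_Collect_eq by (elim exE, intro exI[of _ "\<lambda>i. _ i + _ i"]) (auto simp: comb_add)

lemma cone_zscale: "x \<in> cone \<Longrightarrow> 0 \<le> k \<Longrightarrow> zscale k x \<in> cone"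
  unfolding cone_def mem_Collect_eq by (elim exE, intro exI[of _ "\<lambda>i. k * _ i"]) (auto simp: comb_zscale)

lemma cone_sum: "(\<And>a. a \<in> A \<Longrightarrow> f a \<in> cone) \<Longrightarrow> sum f A \<in> cone"
  by (induction A rule: infinite_finite_induct) (auto intro: cone_add)

lemma cone_pointed: "x \<in> cone \<Longrightarrow> - x \<in> cone \<Longrightarrow> x = 0"
proof -
  assume "x \<in> cone" "- x \<in> cone"
  then obtain c d where c: "x = comb c" "\<forall>i\<in>{1..r}. 0 \<le> c i" and d: "- x = comb d" "\<forall>i\<in>{1..r}. 0 \<le> d i"
    unfolding cone_def by blast
  have "comb (\<lambda>i. c i + d i) = 0" using c d by (simp add: comb_add flip: d(1))
  then have "\<forall>i\<in>{1..r}. c i + d i = 0" using comb_eq_0 by blast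
  with c d have "\<forall>i\<in>{1..r}. c i = 0" by force
  then have "comb c = comb (\<lambda>_. 0)" by (intro comb_cong) auto
  also have "\<dots> = 0" by (simp add: comb_def)
  finally show ?thesis using c by simp
qed

lemma cone_zscale_iff: "0 < k \<Longrightarrow> zscale k \<beta> \<in> cone \<Longrightarrow> \<beta> \<in> \<Phi> \<Longrightarrow> \<beta> \<in> cone"
proof -
  assume k: "0 < k" and kb: "zscale k \<beta> \<in> cone" and b: "\<beta> \<in> \<Phi>"
  obtain c where c: "\<beta> = comb c" "(\<forall>i\<in>{1..r}. 0 \<le> c i) \<or> (\<forall>i\<in>{1..r}. c i \<le> 0)"
    using simple_roots b unfolding simple_roots_def comb_def by blast
  show "\<beta> \<in> cone"
  proof (cases "\<forall>i\<in>{1..r}. 0 \<le> c i")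
    case True
    with c show ?thesis unfolding cone_def by blast
  next
    case False
    with c have "\<forall>i\<in>{1..r}. 0 \<le> - c i" by auto
    then have m: "- \<beta> \<in> cone"
      unfolding cone_def mem_Collect_eq c(1) by (intro exI[of _ "\<lambda>i. - c i"]) (simp add: comb_minus)
    then have "- zscale k \<beta> \<in> cone" using cone_zscale[OF m, of k] k by (simp add: zscale_minus_right)
    with kb have "zscale k \<beta> = 0" by (rule cone_pointed)
    then show ?thesis using k by simp
  qed
qed

lemma minus_positive_iff: "\<beta> \<in> \<Phi> \<Longrightarrow> - \<beta> \<in> positive_roots \<longleftrightarrow> \<beta> \<notin> positive_roots"
proof
  assume b: "\<beta> \<in> \<Phi>" and "- \<beta> \<in> positive_roots"
  then show "\<beta> \<notin> positive_roots" using cone_pointed[of \<beta>] zero_not_root by (auto simp: positive_iff)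
next
  assume b: "\<beta> \<in> \<Phi>" and n: "\<beta> \<notin> positive_roots"
  obtain c where c: "\<beta> = comb c" "(\<forall>i\<in>{1..r}. 0 \<le> c i) \<or> (\<forall>i\<in>{1..r}. c i \<le> 0)"
    using simple_roots b unfolding simple_roots_def comb_def by blast
  with n b have "\<not> (\<forall>i\<in>{1..r}. 0 \<le> c i)" by (auto simp: positive_iff cone_def)
  with c have "\<forall>i\<in>{1..r}. 0 \<le> - c i" by auto
  then have "- \<beta> \<in> cone"
    unfolding cone_def mem_Collect_eq c(1) by (intro exI[of _ "\<lambda>i. - c i"]) (simp add: comb_minus)
  then show "- \<beta> \<in> positive_roots" using b by (simp add: positive_iff)
qed

lemma finite_positive [simp]: "finite positive_roots"
  by (rule finite_subset[OF _ finite_roots]) auto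

lemma simple_positive [simp]: "i \<in> {1..r} \<Longrightarrow> \<alpha> i \<in> positive_roots"
  unfolding positive_iff cone_def
  by (auto intro!: exI[of _ "\<lambda>j. if j = i then 1 else 0"] simp: comb_single)

lemma s_refl: "i \<in> {1..r} \<Longrightarrow> s i = refl (\<alpha> i)"
  by (simp add: s_def)

lemma s_in_W [simp]: "i \<in> {1..r} \<Longrightarrow> s i \<in> W"
  by (simp add: s_refl refl_in_W)

lemma s_s [simp]: "i \<in> {1..r} \<Longrightarrow> s i (s i x) = x"
  by (simp add: s_refl)

lemma s_comp_s: "i \<in> {1..r} \<Longrightarrow> s i \<circ> (s i \<circ> w) = w"
  by (simp add: fun_eq_iff)

lemma s_simple: "i \<in> {1..r} \<Longrightarrow> s i (\<alpha> i) = - \<alpha> i"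
  by (simp add: s_refl refl_self)

lemma s_eq_coroot: "s i x = x - zscale (coroot (\<alpha> i) x) (\<alpha> i)"
  by (simp add: s_def reflection_def)

text \<open>By reducedness, a positive root other than \<open>\<alpha> i\<close> has a positive
  coefficient at another simple root. The reflection leaves that coefficient alone, and one positive
  coefficient decides the sign of a root.\<close>

lemma s_positive:
  assumes i: "i \<in> {1..r}" and b: "\<beta> \<in> positive_roots" "\<beta> \<noteq> \<alpha> i"
  shows "s i \<beta> \<in> positive_roots"
proof -
  obtain c where c: "\<beta> = comb c" "\<forall>i\<in>{1..r}. 0 \<le> c i" using b by (auto simp: positive_iff cone_def)
  have r: "s i \<beta> \<in> \<Phi>" using b i by simp
  let ?k = "coroot (\<alpha> i) \<beta>"
  have eq: "s i \<beta> = comb (\<lambda>j. c j - (if j = i then ?k else 0))"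
    using i by (simp add: comb_diff comb_single s_eq_coroot c)
  have "\<exists>j\<in>{1..r}. j \<noteq> i \<and> c j \<noteq> 0"
  proof (rule ccontr)
    assume "\<not> ?thesis"
    then have "comb c = comb (\<lambda>j. if j = i then c i else 0)" by (intro comb_cong) auto
    then have eq: "\<beta> = zscale (c i) (\<alpha> i)" using c i by (simp add: comb_single)
    have "\<beta> \<noteq> 0" using positive_root[OF b(1)] zero_not_root by metis
    then have "c i \<noteq> 0" using eq by auto
    moreover have "zscale 1 \<beta> = zscale (c i) (\<alpha> i)" using eq by simp
    ultimately have "\<alpha> i = \<beta> \<or> \<alpha> i = - \<beta>"
      using reduced[unfolded reduced_def, rule_format, OF positive_root[OF b(1)] simple_root[OF i]]
        one_neq_zero by blast
    then show False
      using b i minus_positive_iff[OF positive_root[OF b(1)]] simple_positive[OF i] by auto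
  qed
  then obtain j where j: "j \<in> {1..r}" "j \<noteq> i" "c j \<noteq> 0" by blast
  show ?thesis
  proof (rule ccontr)
    assume "\<not> ?thesis"
    then have "- s i \<beta> \<in> positive_roots" using minus_positive_iff[OF r] by blast
    then obtain d where d: "- s i \<beta> = comb d" "\<forall>i\<in>{1..r}. 0 \<le> d i"
      unfolding positive_iff cone_def by blast
    have "comb d = comb (\<lambda>l. - (c l - (if l = i then ?k else 0)))" 
      unfolding comb_minus eq[symmetric] d(1) ..
    from comb_eq[OF this j(1)] have "d j = - c j" using j(2) by simp
    then show False using j c(2) d(2) by force
  qed
qed

lemma s_pos_iff:
  assumes "i \<in> {1..r}" "\<beta> \<in> \<Phi>" "\<beta> \<noteq> \<alpha> i" "\<beta> \<noteq> - \<alpha> i"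
  shows "s i \<beta> \<in> positive_roots \<longleftrightarrow> \<beta> \<in> positive_roots"
proof
  show "\<beta> \<in> positive_roots \<Longrightarrow> s i \<beta> \<in> positive_roots" using s_positive assms by blast
  assume "s i \<beta> \<in> positive_roots"
  moreover have "s i \<beta> \<noteq> \<alpha> i" using assms by (metis s_simple s_s)

  ultimately have "s i (s i \<beta>) \<in> positive_roots"
    by (rule s_positive[OF assms(1)])
  then show "\<beta> \<in> positive_roots" using assms by simp
qed

subsection \<open>Words in the simple reflections\<close>

lemma word_prod_simps [simp]: "word_prod [] = id" "word_prod (i # js) = s i \<circ> word_prod js"
  by (simp_all add: word_prod_def)

lemma word_prod_append: "word_prod (as @ bs) = word_prod as \<circ> word_prod bs"
  by (induction as) (simp_all add: comp_assoc)

lemma word_in_W: "set js \<subseteq> {1..r} \<Longrightarrow> word_prod js \<in> W"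
  by (induction js) (simp_all add: W.id W_comp)

lemma word_rev: "set js \<subseteq> {1..r} \<Longrightarrow> word_prod (rev js) (word_prod js x) = x"
  by (induction js arbitrary: x) (simp_all add: word_prod_append)

text \<open>Induction on the height. As \<open>ip \<beta> \<beta>\<close> is positive, some simple
  root with positive coefficient pairs positively with \<beta>; unless \<beta> equals it, its
  reflection lowers the height and keeps the root positive.\<close>

lemma root_conj_simple_pos:
  assumes "\<beta> = comb c" "\<forall>i\<in>{1..r}. 0 \<le> c i" "\<beta> \<in> \<Phi>"
  shows "\<exists>js i. set js \<subseteq> {1..r} \<and> i \<in> {1..r} \<and> \<beta> = word_prod js (\<alpha> i)"
  using assms
proof (induction "nat (\<Sum>i=1..r. c i)" arbitrary: c \<beta> rule: less_induct)
  case less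
  have pb: "\<beta> \<in> positive_roots" using less.prems unfolding positive_iff cone_def by blast
  have "0 < ip \<beta> \<beta>" using ip_root_pos less.prems(3) by blast
  also have "ip \<beta> \<beta> = (\<Sum>i=1..r. c i * ip \<beta> (\<alpha> i))"
    by (subst (2) less.prems(1)) (simp add: comb_def ip_simps)
  finally obtain i where i: "i \<in> {1..r}" "c i * ip \<beta> (\<alpha> i) > 0" 
    by (meson linorder_not_le sum_nonpos)
  moreover have "0 \<le> c i" using less.prems(2) i(1) by blast
  ultimately have k: "coroot (\<alpha> i) \<beta> > 0" "c i > 0"
    using ip_coroot_pos[of "\<alpha> i" \<beta>] by (auto simp: zero_less_mult_iff)
  show ?case
  proof (cases "\<beta> = \<alpha> i")
    case True
    then show ?thesis using i by (intro exI[of _ "[]"] exI[of _ i]) auto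
  next
    case False
    let ?k = "coroot (\<alpha> i) \<beta>"
    have sp: "s i \<beta> \<in> positive_roots" using s_positive[OF i(1) pb False] .
    let ?d = "\<lambda>j. c j - (if j = i then ?k else 0)"
    have eq: "s i \<beta> = comb ?d"
      unfolding comb_diff comb_single[OF i(1)] s_eq_coroot using less.prems(1) by simp
    obtain e where e: "s i \<beta> = comb e" "\<forall>i\<in>{1..r}. 0 \<le> e i" using sp unfolding positive_iff cone_def by blast
    have "comb ?d = comb e" using e eq by simp
    then have nn: "\<forall>j\<in>{1..r}. 0 \<le> ?d j" using e comb_eq[of ?d e] by metis
    have "(\<Sum>j=1..r. ?d j) = (\<Sum>j=1..r. c j) - ?k" using i by (simp add: sum_subtractf)
    moreover have "(\<Sum>j=1..r. ?d j) \<ge> 0" using nn by (intro sum_nonneg) auto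
    ultimately have "nat (\<Sum>j=1..r. ?d j) < nat (\<Sum>j=1..r. c j)" using k by linarith
    from less.hyps[OF this eq nn positive_root[OF sp]] obtain js j where
      js: "set js \<subseteq> {1..r}" "j \<in> {1..r}" "s i \<beta> = word_prod js (\<alpha> j)" by blast
    then have "\<beta> = word_prod (i # js) (\<alpha> j)" using i by (simp flip: js(3))
    then show ?thesis using js i by (intro exI[of _ "i # js"] exI[of _ j]) auto
  qed
qed

lemma root_conj_simple:
  assumes "\<beta> \<in> \<Phi>"
  shows "\<exists>js i. set js \<subseteq> {1..r} \<and> i \<in> {1..r} \<and> \<beta> = word_prod js (\<alpha> i)"
proof (cases "\<beta> \<in> positive_roots")
  case True
  then obtain c where "\<beta> = comb c" "\<forall>i\<in>{1..r}. 0 \<le> c i" unfolding positive_iff cone_def by blast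
  then show ?thesis using root_conj_simple_pos assms by blast
next
  case False
  then have "- \<beta> \<in> positive_roots" using assms by (simp add: minus_positive_iff)
  then obtain c where "- \<beta> = comb c" "\<forall>i\<in>{1..r}. 0 \<le> c i" "- \<beta> \<in> \<Phi>"
    unfolding positive_iff cone_def by blast
  then obtain js i where js: "set js \<subseteq> {1..r}" "i \<in> {1..r}" "- \<beta> = word_prod js (\<alpha> i)"
    using root_conj_simple_pos by blast
  have "word_prod (js @ [i]) (\<alpha> i) = - word_prod js (\<alpha> i)"
    using js by (simp add: word_prod_append s_simple W_linear word_in_W)
  also have "\<dots> = \<beta>" by (simp flip: js(3))
  finally show ?thesis using js by (intro exI[of _ "js @ [i]"] exI[of _ i]) auto
qed

text \<open>The reflection in \<open>word_prod as (\<alpha> i)\<close> is the conjugate of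
  \<open>s i\<close> by that word, a palindrome in simple reflections.\<close>

lemma W_word: "w \<in> W \<Longrightarrow> \<exists>js. is_word js w"
proof (induction rule: W.induct)
  case id
  show ?case by (intro exI[of _ "[]"]) (simp add: is_word_def id_def)
next
  case (reflection w \<beta>)
  obtain as i where as: "set as \<subseteq> {1..r}" "i \<in> {1..r}" "\<beta> = word_prod as (\<alpha> i)"
    using root_conj_simple[OF reflection.hyps(2)] by blast
  obtain js where js: "is_word js w" using reflection.IH by blast
  have "refl \<beta> x = word_prod (as @ i # rev as) x" for x
  proof -
    have "word_prod as (word_prod (rev as) x) = x" using word_rev[of "rev as" x] as by simp
    then show ?thesis
      using refl_W[OF word_in_W[OF as(1)], of "\<alpha> i" "word_prod (rev as) x"] as
      by (simp add: word_prod_append s_refl)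
  qed
  then have "refl \<beta> \<circ> w = word_prod ((as @ i # rev as) @ js)"
    using js unfolding word_prod_append[of "as @ i # rev as"] by (auto simp: is_word_def)
  then show ?case using as js by (intro exI[of _ "(as @ i # rev as) @ js"]) (simp add: is_word_def)
qed

section \<open>Length as the number of inversions, and the exchange property\<close>

definition ell :: "('a \<Rightarrow> 'a) \<Rightarrow> nat" where
  "ell w = card {\<beta> \<in> positive_roots. w \<beta> \<notin> positive_roots}"

text \<open>The condition for left multiplication by \<open>s i\<close> to lengthen
  \<open>w\<close>, phrased by roots so that it does not refer to words.\<close>

definition up :: "nat \<Rightarrow> ('a \<Rightarrow> 'a) \<Rightarrow> bool" where
  "up i w \<longleftrightarrow> inv w (\<alpha> i) \<in> positive_roots"

lemma inv_comp_s: "i \<in> {1..r} \<Longrightarrow> w \<in> W \<Longrightarrow> inv (s i \<circ> w) x = inv w (s i x)"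
  by (rule inv_f_eq) (simp_all add: W_inj W_comp)

lemma up_s: "i \<in> {1..r} \<Longrightarrow> w \<in> W \<Longrightarrow> up i (s i \<circ> w) \<longleftrightarrow> \<not> up i w"
  unfolding up_def
  by (simp add: inv_comp_s s_simple W_linear inv_in_W minus_positive_iff)

lemma not_up: "i \<in> {1..r} \<Longrightarrow> w \<in> W \<Longrightarrow> \<not> up i w \<longleftrightarrow> - inv w (\<alpha> i) \<in> positive_roots"
  unfolding up_def by (simp add: inv_in_W minus_positive_iff)

lemma ell_s_up:
  assumes "i \<in> {1..r}" "w \<in> W" "up i w"
  shows "ell (s i \<circ> w) = Suc (ell w)"
proof -
  let ?g = "inv w (\<alpha> i)"
  have g: "?g \<in> positive_roots" "w ?g = \<alpha> i" using assms by (auto simp: up_def)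
  \<comment> \<open>\<open>s i\<close> changes the sign of no root except \<open>\<alpha> i\<close>
    and its negative, so the only new inversion is the root that \<open>w\<close> sends to
    \<open>\<alpha> i\<close>.\<close>
  have "{\<beta> \<in> positive_roots. (s i \<circ> w) \<beta> \<notin> positive_roots}
      = insert ?g {\<beta> \<in> positive_roots. w \<beta> \<notin> positive_roots}" (is "?A = insert _ ?B")
  proof (intro set_eqI)
    fix \<beta>
    show "\<beta> \<in> ?A \<longleftrightarrow> \<beta> \<in> insert ?g ?B"
    proof (cases "\<beta> \<in> positive_roots")
      case b: True
      consider "w \<beta> = \<alpha> i" | "w \<beta> = - \<alpha> i" | "w \<beta> \<noteq> \<alpha> i" "w \<beta> \<noteq> - \<alpha> i" by blast
      then show ?thesis
      proof cases
        case 1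
        then have "\<beta> = ?g" using assms by (metis inv_W(1))
        then show ?thesis using g assms by (auto simp: s_simple minus_positive_iff)
      next
        case 2
        then have "\<beta> = - ?g" using assms by (metis inv_W(1) inv_in_W W_linear(2))
        then have False using g b minus_positive_iff by force
        then show ?thesis ..
      next
        case 3
        then have "\<beta> \<noteq> ?g" using g by auto
        then show ?thesis using 3 b s_pos_iff[of i "w \<beta>"] assms by auto
      qed
    next
      case False
      then show ?thesis using g by auto
    qed
  qed
  moreover have "?g \<notin> ?B" using g assms by simp
  ultimately show ?thesis by (simp add: ell_def)
qed

lemma ell_s_down:
  assumes "i \<in> {1..r}" "w \<in> W" "\<not> up i w"
  shows "ell w = Suc (ell (s i \<circ> w))"
  using ell_s_up[of i "s i \<circ> w"] up_s[of i w] assms by (simp add: W_comp s_comp_s)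

lemma ell_id [simp]: "ell id = 0"
  by (simp add: ell_def)

lemma ell_word_le: "set js \<subseteq> {1..r} \<Longrightarrow> ell (word_prod js) \<le> length js"
proof (induction js)
  case (Cons i js)
  then have i: "i \<in> {1..r}" and w: "word_prod js \<in> W" and IH: "ell (word_prod js) \<le> length js"
    by (simp_all add: word_in_W)
  have "ell (s i \<circ> word_prod js) \<le> Suc (ell (word_prod js))"
    using ell_s_up[OF i w] ell_s_down[OF i w] by (cases "up i (word_prod js)") simp_all
  then show ?case using IH by (simp add: comp_def)
next
  case Nil
  then show ?case using ell_id by (simp add: id_def)
qed

text \<open>\<beta> is moved through the word letter by letter. Since it ends up negative, it must
  at some letter equal the simple root of that letter, and there the reflection cancels the
  letter.\<close>

lemma exchange:
  assumes "set js \<subseteq> {1..r}" "\<beta> \<in> positive_roots" "inv (word_prod js) \<beta> \<notin> positive_roots"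
  shows "\<exists>as j bs. js = as @ j # bs \<and> refl \<beta> \<circ> word_prod js = word_prod (as @ bs)"
  using assms
proof (induction js arbitrary: \<beta>)
  case (Cons j js)
  show ?case
  proof (cases "\<beta> = \<alpha> j")
    case True
    have "s j = refl \<beta>" using True s_refl[of j] Cons.prems(1) by simp
    then have "refl \<beta> \<circ> word_prod (j # js) = word_prod ([] @ js)"
      using Cons.prems(1) s_comp_s[of j] unfolding word_prod_simps by simp
    then show ?thesis by blast
  next
    case False
    have w: "word_prod js \<in> W" using Cons by (simp add: word_in_W)
    have p: "s j \<beta> \<in> positive_roots" using False Cons s_positive by simp
    moreover have "inv (word_prod js) (s j \<beta>) \<notin> positive_roots"
      using Cons.prems w inv_comp_s[of j "word_prod js" \<beta>] by (simp add: comp_def)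
    ultimately obtain as k bs where IH: "js = as @ k # bs" "refl (s j \<beta>) \<circ> word_prod js = word_prod (as @ bs)"
      using Cons.IH[OF _ p] Cons.prems(1) by (auto simp: comp_def)
    have "refl \<beta> (s j x) = s j (refl (s j \<beta>) x)" for x
      using refl_W[of "s j" "s j \<beta>" x] Cons by simp
    then have "refl \<beta> \<circ> word_prod (j # js) = s j \<circ> (refl (s j \<beta>) \<circ> word_prod js)"
      by (simp add: fun_eq_iff)
    then have "refl \<beta> \<circ> word_prod (j # js) = word_prod ((j # as) @ bs)"
      by (simp add: IH(2))
    moreover have "j # js = (j # as) @ k # bs" by (simp add: IH(1))
    ultimately show ?thesis by blast
  qed
next
  case Nil
  then show ?case by (simp add: inv_id)
qed

text \<open>At the first letter (from the right) where the length drops, the exchange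
  property shortens the word by two letters.\<close>

lemma shorten_word:
  assumes "set js \<subseteq> {1..r}" "ell (word_prod js) < length js"
  shows "\<exists>bs. set bs \<subseteq> {1..r} \<and> word_prod bs = word_prod js \<and> length bs < length js"
  using assms
proof (induction js)
  case (Cons i js)
  have w: "word_prod js \<in> W" using Cons by (simp add: word_in_W)
  have i: "i \<in> {1..r}" using Cons by simp
  show ?case
  proof (cases "up i (word_prod js)")
    case True
    then have "ell (word_prod js) < length js" using Cons.prems ell_s_up[OF i w] by (simp add: comp_def)
    with Cons obtain bs where "set bs \<subseteq> {1..r}" "word_prod bs = word_prod js" "length bs < length js" by auto
    then show ?thesis using i by (intro exI[of _ "i # bs"]) simp
  next
    case False
    then obtain as j bs where "js = as @ j # bs" "refl (\<alpha> i) \<circ> word_prod js = word_prod (as @ bs)"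
      using exchange[of js "\<alpha> i"] Cons i unfolding up_def by auto
    then show ?thesis using Cons by (intro exI[of _ "as @ bs"]) (auto simp: s_refl)
  qed
qed simp

lemma word_of_length_ell:
  assumes "w \<in> W"
  shows "\<exists>js. is_word js w \<and> length js = ell w"
proof -
  obtain js where js: "is_word js w" "\<And>bs. is_word bs w \<Longrightarrow> length js \<le> length bs"
    using W_word[OF assms] ex_has_least_nat[of "\<lambda>js. is_word js w" _ length] by blast
  then have "\<not> ell w < length js" using shorten_word[of js] unfolding is_word_def by force
  moreover have "ell w \<le> length js" using js(1) ell_word_le unfolding is_word_def by blast
  ultimately have "length js = ell w" by linarith
  with js(1) show ?thesis by blast
qed

lemma len_eq_ell: 
  assumes "w \<in> W"
  shows "len w = ell w"
  unfolding len_def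
proof (rule Least_equality)
  show "\<exists>js. is_word js w \<and> length js = ell w" by (rule word_of_length_ell[OF assms])
  fix y assume "\<exists>js. is_word js w \<and> length js = y"
  then obtain js where "set js \<subseteq> {1..r}" "word_prod js = w" "length js = y" unfolding is_word_def by blast
  with ell_word_le[of js] show "ell w \<le> y" by simp
qed

lemma reduced_word_iff: "reduced_word js w \<longleftrightarrow> set js \<subseteq> {1..r} \<and> word_prod js = w \<and> length js = ell w"
  unfolding reduced_word_def is_word_def using len_eq_ell[OF word_in_W, of js] by metis

lemma ex_reduced_word: "w \<in> W \<Longrightarrow> \<exists>js. reduced_word js w"
  using word_of_length_ell[of w] unfolding reduced_word_iff is_word_def by metis

lemma reduced_word_Cons:
  "reduced_word (i # js) w \<longleftrightarrow>
    i \<in> {1..r} \<and> reduced_word js (word_prod js) \<and> up i (word_prod js) \<and> w = s i \<circ> word_prod js"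
proof
  assume *: "reduced_word (i # js) w"
  then have js: "set js \<subseteq> {1..r}" "i \<in> {1..r}" "w = s i \<circ> word_prod js" "ell w = Suc (length js)"
    unfolding reduced_word_iff by auto
  note w = word_in_W[OF js(1)]
  have "up i (word_prod js) \<and> ell w = Suc (ell (word_prod js))"
  proof (cases "up i (word_prod js)")
    case True
    then show ?thesis using ell_s_up[OF js(2) w] js(3) by simp
  next
    case False
    then have "ell (word_prod js) = Suc (ell w)" using ell_s_down[OF js(2) w] js(3) by simp
    then show ?thesis using ell_word_le[OF js(1)] js(4) by simp
  qed
  then show "i \<in> {1..r} \<and> reduced_word js (word_prod js) \<and> up i (word_prod js) \<and> w = s i \<circ> word_prod js"
    using js unfolding reduced_word_iff by simp
next
  assume *: "i \<in> {1..r} \<and> reduced_word js (word_prod js) \<and> up i (word_prod js) \<and> w = s i \<circ> word_prod js"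
  then have js: "set js \<subseteq> {1..r}" "length js = ell (word_prod js)" unfolding reduced_word_iff by auto
  have "ell w = Suc (ell (word_prod js))" using * ell_s_up[OF _ word_in_W[OF js(1)]] by simp
  then show "reduced_word (i # js) w" using * js unfolding reduced_word_iff by simp
qed

lemma W_eq_id: "w \<in> W \<Longrightarrow> ell w = 0 \<Longrightarrow> w = id"
  using ex_reduced_word[of w] unfolding reduced_word_iff by (metis length_0_conv word_prod_simps(1))

text \<open>The quotient of the two elements fixes every root, so it has no inversions, length 0 and
  the empty word. It is therefore trivial on the whole lattice and not only on the roots.\<close>

lemma W_eqI:
  assumes "w \<in> W" "u \<in> W" "\<And>\<beta>. \<beta> \<in> \<Phi> \<Longrightarrow> w \<beta> = u \<beta>"
  shows "w = u"
proof -
  have "inv u \<circ> w = id"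
    by (rule W_eq_id) (use assms in \<open>auto simp: W_comp inv_in_W ell_def\<close>)
  then have "u \<circ> (inv u \<circ> w) = u" by simp
  then show ?thesis using assms by (auto simp: fun_eq_iff)
qed

lemma finite_W [simp]: "finite W"
proof -
  have "inj_on (\<lambda>w. restrict w \<Phi>) W"
    by (rule inj_onI, rule W_eqI) (simp_all, metis restrict_apply')
  moreover have "(\<lambda>w. restrict w \<Phi>) ` W \<subseteq> (\<Phi> \<rightarrow>\<^sub>E \<Phi>)" by auto
  ultimately show ?thesis using finite_roots
    by (meson finite_PiE finite_imageD finite_subset)
qed

lemma reduced_word_induct [consumes 1, case_names Nil Cons]:
  assumes "reduced_word js w"
    and "P [] id"
    and "\<And>i js w. i \<in> {1..r} \<Longrightarrow> reduced_word js w \<Longrightarrow> w \<in> W \<Longrightarrow> up i w \<Longrightarrow> P js w \<Longrightarrow> P (i # js) (s i \<circ> w)"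
  shows "P js w"
  using assms(1)
proof (induction js arbitrary: w)
  case Nil
  then show ?case using assms(2) unfolding reduced_word_iff word_prod_simps by blast
next
  case (Cons i js)
  then have *: "i \<in> {1..r}" "reduced_word js (word_prod js)" "up i (word_prod js)" "w = s i \<circ> word_prod js"
    unfolding reduced_word_Cons by blast+
  moreover have "word_prod js \<in> W" using *(2) word_in_W unfolding reduced_word_iff by blast
  ultimately show ?case using assms(3) Cons.IH by blast
qed

lemma W_induct [consumes 1, case_names id step]:
  assumes "w \<in> W" "P id" "\<And>i w. i \<in> {1..r} \<Longrightarrow> w \<in> W \<Longrightarrow> up i w \<Longrightarrow> P w \<Longrightarrow> P (s i \<circ> w)"
  shows "P w"
proof -
  obtain js where "reduced_word js w" using ex_reduced_word[OF assms(1)] by blast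
  then show ?thesis by (rule reduced_word_induct) (fact assms(2), rule assms(3))
qed

text \<open>An element that keeps all simple roots positive maps the cone into itself and so has no
  inversions.\<close>

lemma W_right_descent:
  assumes "w \<in> W" "w \<noteq> id"
  shows "\<exists>j\<in>{1..r}. w (\<alpha> j) \<notin> positive_roots"
proof (rule ccontr)
  assume *: "\<not> ?thesis"
  have "w \<beta> \<in> cone" if b: "\<beta> \<in> cone" for \<beta>
  proof -
    obtain c where "\<beta> = comb c" "\<forall>i\<in>{1..r}. 0 \<le> c i" using b unfolding cone_def by blast
    then show ?thesis using * assms(1)
      by (auto simp: comb_def W_simps positive_iff intro!: cone_sum cone_zscale)
  qed
  then have "{\<beta> \<in> positive_roots. w \<beta> \<notin> positive_roots} = {}"
    using assms(1) by (auto simp: positive_iff)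
  then have "ell w = 0" unfolding ell_def by simp
  then show False using W_eq_id assms by blast
qed

lemma ell_s_right:
  assumes "j \<in> {1..r}" "w \<in> W"
  shows "w (\<alpha> j) \<in> positive_roots \<Longrightarrow> ell (w \<circ> s j) = Suc (ell w)"
    and "w (\<alpha> j) \<notin> positive_roots \<Longrightarrow> ell w = Suc (ell (w \<circ> s j))"
proof -
  have *: "ell (w \<circ> s j) = Suc (ell w)" if w: "w \<in> W" "w (\<alpha> j) \<in> positive_roots" for w
  proof -
    have "bij_betw (s j) ({\<beta> \<in> positive_roots. (w \<circ> s j) \<beta> \<notin> positive_roots} - {\<alpha> j})
      {\<beta> \<in> positive_roots. w \<beta> \<notin> positive_roots}"
    proof (rule bij_betwI[where g = "s j"])
      show "s j \<in> {\<beta> \<in> positive_roots. (w \<circ> s j) \<beta> \<notin> positive_roots} - {\<alpha> j} \<rightarrow>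
        {\<beta> \<in> positive_roots. w \<beta> \<notin> positive_roots}"
        using assms s_positive by auto
      show "s j \<in> {\<beta> \<in> positive_roots. w \<beta> \<notin> positive_roots} \<rightarrow>
        {\<beta> \<in> positive_roots. (w \<circ> s j) \<beta> \<notin> positive_roots} - {\<alpha> j}"
      proof
        fix \<beta> assume b: "\<beta> \<in> {\<beta> \<in> positive_roots. w \<beta> \<notin> positive_roots}"
        then have "\<beta> \<noteq> \<alpha> j" using w by auto
        moreover have "\<beta> = - \<alpha> j" if "s j \<beta> = \<alpha> j" using that assms s_s[of j \<beta>] by (simp add: s_simple)
        ultimately show "s j \<beta> \<in> {\<beta> \<in> positive_roots. (w \<circ> s j) \<beta> \<notin> positive_roots} - {\<alpha> j}"
          using b assms s_positive[of j \<beta>] minus_positive_iff[of "\<alpha> j"] by auto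
      qed
    qed (use assms in auto)
    then have "card ({\<beta> \<in> positive_roots. (w \<circ> s j) \<beta> \<notin> positive_roots} - {\<alpha> j}) = ell w"
      unfolding ell_def by (rule bij_betw_same_card)
    moreover have "\<alpha> j \<in> {\<beta> \<in> positive_roots. (w \<circ> s j) \<beta> \<notin> positive_roots}"
      using w assms by (simp add: s_simple W_linear minus_positive_iff)
    moreover have "finite {\<beta> \<in> positive_roots. (w \<circ> s j) \<beta> \<notin> positive_roots}" by simp
    ultimately show ?thesis using card.remove unfolding ell_def[of "w \<circ> s j"] by metis
  qed
  show "w (\<alpha> j) \<in> positive_roots \<Longrightarrow> ell (w \<circ> s j) = Suc (ell w)" using * assms by blast
  assume "w (\<alpha> j) \<notin> positive_roots"
  then have "(w \<circ> s j) (\<alpha> j) \<in> positive_roots"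
    using assms by (simp add: s_simple W_linear minus_positive_iff)
  then have "ell ((w \<circ> s j) \<circ> s j) = Suc (ell (w \<circ> s j))" 
    using assms by (intro *) (auto intro: W_comp simp del: o_apply)
  moreover have "(w \<circ> s j) \<circ> s j = w" using assms by (simp add: fun_eq_iff)
  ultimately show "ell w = Suc (ell (w \<circ> s j))" by simp
qed

lemma W_right_induct [consumes 1, case_names id step]:
  assumes "w \<in> W" "P id" "\<And>j w. j \<in> {1..r} \<Longrightarrow> w \<in> W \<Longrightarrow> w (\<alpha> j) \<in> positive_roots \<Longrightarrow> P w \<Longrightarrow> P (w \<circ> s j)"
  shows "P w"
  using assms(1)
proof (induction "ell w" arbitrary: w rule: less_induct)
  case less
  show ?case
  proof (cases "w = id")
    case False
    then obtain j where j: "j \<in> {1..r}" "w (\<alpha> j) \<notin> positive_roots" using W_right_descent[OF less.prems] by blast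
    let ?u = "w \<circ> s j"
    have "ell w = Suc (ell ?u)" by (rule ell_s_right(2)[OF j(1) less.prems j(2)])
    then have "P ?u" using less.prems j(1) by (intro less.hyps) (simp_all add: W_comp)
    moreover have "?u (\<alpha> j) \<in> positive_roots" using j less.prems by (simp add: s_simple W_linear minus_positive_iff)
    moreover have "?u \<in> W" using j(1) less.prems by (simp add: W_comp)
    ultimately have "P (?u \<circ> s j)" by (intro assms(3)[OF j(1), of ?u])
    moreover have "?u \<circ> s j = w" using j by (simp add: fun_eq_iff)
    ultimately show ?thesis by simp
  qed (use assms in auto)
qed

text \<open>The functional \<open>sum of the positive coroots\<close> is minimal on an orbit at the dominant element.\<close>

lemma exists_dominant:
  shows "\<exists>w\<in>W. \<forall>i\<in>{1..r}. coroot (\<alpha> i) (w x) \<ge> 0"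
proof -
  define h where "h y = (\<Sum>\<beta>\<in>positive_roots. coroot \<beta> y)" for y
  have h_s: "h (s i y) = h y - 2 * coroot (\<alpha> i) y" if i: "i \<in> {1..r}" for i y
  proof -
    have h_remove: "h y = coroot (\<alpha> i) y + (\<Sum>\<beta>\<in>positive_roots - {\<alpha> i}. coroot \<beta> y)" for y
      unfolding h_def using i by (intro sum.remove) auto
    have "(\<Sum>\<beta>\<in>positive_roots - {\<alpha> i}. coroot \<beta> (s i y)) = (\<Sum>\<beta>\<in>positive_roots - {\<alpha> i}. coroot \<beta> y)"
    proof (rule sum.reindex_bij_witness[where i = "s i" and j = "s i"])
      show "s i \<beta> \<in> positive_roots - {\<alpha> i}" if "\<beta> \<in> positive_roots - {\<alpha> i}" for \<beta>
      proof -
        have "\<beta> = - \<alpha> i" if "s i \<beta> = \<alpha> i" using that i s_s[of i \<beta>] by (simp add: s_simple)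
        then show ?thesis using that i s_positive[of i \<beta>] minus_positive_iff[of "\<alpha> i"] by auto
      qed
      then show "s i \<beta> \<in> positive_roots - {\<alpha> i}" if "\<beta> \<in> positive_roots - {\<alpha> i}" for \<beta> using that by blast
      show "coroot (s i \<beta>) y = coroot \<beta> (s i y)" if "\<beta> \<in> positive_roots - {\<alpha> i}" for \<beta>
        using coroot_W[of "s i" \<beta> "s i y"] that i by simp
    qed (use i in auto)
    moreover have "coroot (\<alpha> i) (s i y) = - coroot (\<alpha> i) y"
      using i by (simp add: s_eq_coroot coroot_simps)
    ultimately show ?thesis unfolding h_remove by simp
  qed
  have ne: "finite ((\<lambda>w. h (w x)) ` W)" "(\<lambda>w. h (w x)) ` W \<noteq> {}" using W.id by auto
  obtain w where w: "w \<in> W" "h (w x) = Max ((\<lambda>w. h (w x)) ` W)" using Max_in[OF ne] by auto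
  \<comment> \<open>At a point of the orbit where \<open>h\<close> is largest, the amount
    \<open>2 * coroot (\<alpha> i) (w x)\<close> by which \<open>s i\<close> lowers \<open>h\<close>
    cannot be negative.\<close>
  have "coroot (\<alpha> i) (w x) \<ge> 0" if i: "i \<in> {1..r}" for i
  proof -
    have "h ((s i \<circ> w) x) \<le> h (w x)"
      unfolding w(2) using ne(1) w(1) i by (intro Max_ge) (auto intro!: W_comp simp del: o_apply)
    then show ?thesis using h_s[OF i, of "w x"] by simp
  qed
  with w show ?thesis by blast
qed

lemma dominant_positive:
  assumes "\<forall>i\<in>{1..r}. coroot (\<alpha> i) x \<ge> 0" "\<beta> \<in> positive_roots"
  shows "coroot \<beta> x \<ge> 0"
proof -
  obtain c where c: "\<beta> = comb c" "\<forall>i\<in>{1..r}. 0 \<le> c i" using assms by (auto simp: positive_iff cone_def)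
  have "ip x \<beta> = (\<Sum>i=1..r. c i * ip x (\<alpha> i))" by (simp add: c comb_def ip_simps)
  also have "\<dots> \<ge> 0"
  proof (rule sum_nonneg)
    fix i assume i: "i \<in> {1..r}"
    then have "2 * ip x (\<alpha> i) \<ge> 0" using ip_coroot[of "\<alpha> i" x] assms(1) ip_root_pos[of "\<alpha> i"] by simp
    then show "0 \<le> c i * ip x (\<alpha> i)" using c i by simp
  qed
  finally show ?thesis using ip_coroot[of \<beta> x] ip_root_pos[of \<beta>] assms(2)
    by (metis (no_types, lifting) mult_nonneg_nonneg positive_root zero_le_mult_iff zero_le_numeral linorder_not_le)
qed

lemma longest_down:
  assumes "longest w" "i \<in> {1..r}"
  shows "\<not> up i w"
proof
  assume "up i w"
  then have "len (s i \<circ> w) > len w"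
    using assms ell_s_up[of i w] by (simp add: longest_def len_eq_ell W_comp)
  then show False using assms by (auto simp: longest_def W_comp not_less[symmetric])
qed

end

subsection \<open>Rational functions\<close>

lemma X_add: "X (\<nu> + \<mu>) = X \<nu> * X \<mu>"
  by (simp add: X_def ga_term_mult)

lemma X_0 [simp]: "X 0 = 1"
  by (simp add: X_def ga_term_one flip: One_fract_def)

lemma const_add: "const (a + b) = const a + const b"
  and const_mult: "const (a * b) = const a * const b"
  and const_1 [simp]: "const 1 = 1" and const_0 [simp]: "const 0 = 0"
  by (simp_all add: const_def ga_term_add ga_term_mult ga_term_one
      flip: One_fract_def Zero_fract_def)

lemma ga_term_eq_iff: "ga_term a \<nu> = ga_term b \<mu> \<longleftrightarrow> a = 0 \<and> b = 0 \<or> a = b \<and> \<nu> = \<mu>"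
  by transfer (metis lookup_single_eq lookup_single_not_eq single_zero)

lemma const_X: "const a * X \<nu> = Fract (ga_term a \<nu>) 1"
  by (simp add: const_def X_def ga_term_mult)

lemma const_X_eq_iff: "const a * X \<nu> = const b * X \<mu> \<longleftrightarrow> a = 0 \<and> b = 0 \<or> a = b \<and> \<nu> = \<mu>"
  by (simp add: const_X eq_fract ga_term_eq_iff)

lemma const_X_eq_1: "const a * X \<nu> = 1 \<longleftrightarrow> a = 1 \<and> \<nu> = 0"
  using const_X_eq_iff[of a \<nu> 1 0] by auto

lemma X_neq_0 [simp]: "X \<nu> \<noteq> 0"
  using const_X_eq_iff[of 1 \<nu> 0 0] by simp

lemma X_eq_iff [simp]: "X \<nu> = X \<mu> \<longleftrightarrow> \<nu> = \<mu>"
  using const_X_eq_iff[of 1 \<nu> 1 \<mu>] by simp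

lemma X_eq_1_iff [simp]: "X \<nu> = 1 \<longleftrightarrow> \<nu> = 0"
  using X_eq_iff[of \<nu> 0] by (simp del: X_eq_iff)

lemma const_eq_iff [simp]: "const a = const b \<longleftrightarrow> a = b"
  using const_X_eq_iff[of a 0 b 0] by auto

lemma const_eq_0_iff [simp]: "const a = 0 \<longleftrightarrow> a = 0"
  using const_eq_iff[of a 0] by (simp del: const_eq_iff)

lemma const_minus: "const (- a) = - const a"
  using additive_minus(2)[of const, OF const_add] .

lemma const_diff: "const (a - b) = const a - const b"
  using additive_minus(3)[of const, OF const_add] .

lemma const_power: "const (a ^ k) = const a ^ k"
  by (induction k) (simp_all add: const_mult)

lemma X_minus: "X (- \<nu>) = inverse (X \<nu>)"
  using X_add[of \<nu> "- \<nu>"] by (simp add: field_simps)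

lemma X_diff: "X (\<nu> - \<mu>) = X \<nu> / X \<mu>"
  using X_add[of \<nu> "- \<mu>"] by (simp add: X_minus field_simps)

lemma ratfun_induct [case_names const X add mult divide]:
  fixes f :: "'l::zlattice ratfun"
  assumes "\<And>c. P (const c)" "\<And>\<nu>. P (X \<nu>)" "\<And>f g. P f \<Longrightarrow> P g \<Longrightarrow> P (f + g)"
    "\<And>f g. P f \<Longrightarrow> P g \<Longrightarrow> P (f * g)" "\<And>f g. P f \<Longrightarrow> P g \<Longrightarrow> g \<noteq> 0 \<Longrightarrow> P (f / g)"
  shows "P f"
proof -
  have *: "P (Fract p 1)" for p :: "'l group_algebra"
  proof (induction p rule: ga_induct)
    case zero
    show ?case using assms(1)[of 0] by (simp add: Zero_fract_def)
  next
    case (add p d \<nu>)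
    have "Fract (p + ga_term d \<nu>) 1 = Fract p 1 + const d * X \<nu>" by (simp add: const_X)
    then show ?case using add assms by metis
  qed
  obtain a b where f: "f = Fract a b" "b \<noteq> 0" by (cases f)
  then have "f = Fract a 1 / Fract b 1" "Fract b 1 \<noteq> 0"
    by (simp_all add: divide_fract_def eq_fract Zero_fract_def)
  with * assms(5) show ?thesis by metis
qed

lemma ring_hom_divide:
  fixes h :: "'b::field \<Rightarrow> 'c::field"
  assumes "h 1 = 1" "\<And>x y. h (x * y) = h x * h y" "\<And>x. h x = 0 \<Longrightarrow> x = 0" "h 0 = 0"
  shows "h (x / y) = h x / h y"
proof (cases "y = 0")
  case False
  then have "h y * h (inverse y) = 1" using assms(1) assms(2)[of y "inverse y"] by simp
  then have "h (inverse y) = inverse (h y)" by (metis inverse_unique)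
  then show ?thesis using assms(2)[of x "inverse y"] by (simp add: divide_inverse)
qed (simp add: assms)

text \<open>Artin's argument. Translate the relation by y and subtract \<open>\<chi> u y\<close>
  times the relation itself: the term at u disappears, and the coefficient at a is multiplied by a
  factor that is nonzero for a suitable y.\<close>

lemma characters_independent:
  fixes \<chi> :: "'w \<Rightarrow> 'l::plus \<Rightarrow> 'k::field"
  assumes "finite A"
    and add: "\<And>w x y. w \<in> A \<Longrightarrow> x \<in> L \<Longrightarrow> y \<in> L \<Longrightarrow> \<chi> w (x + y) = \<chi> w x * \<chi> w y"
    and closed: "\<And>x y. x \<in> L \<Longrightarrow> y \<in> L \<Longrightarrow> x + y \<in> L"
    and nz: "\<And>w. w \<in> A \<Longrightarrow> \<exists>x\<in>L. \<chi> w x \<noteq> 0"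
    and dist: "\<And>w u. w \<in> A \<Longrightarrow> u \<in> A \<Longrightarrow> w \<noteq> u \<Longrightarrow> \<exists>x\<in>L. \<chi> w x \<noteq> \<chi> u x"
    and zero: "\<And>x. x \<in> L \<Longrightarrow> (\<Sum>w\<in>A. d w * \<chi> w x) = 0"
    and "w \<in> A"
  shows "d w = 0"
  using assms
proof (induction A arbitrary: d w rule: finite_induct)
  case (insert u A)
  have eq: "d u * \<chi> u x + (\<Sum>w\<in>A. d w * \<chi> w x) = 0" if "x \<in> L" for x
    using insert.prems(5)[OF that] insert.hyps by simp
  have A0: "d a = 0" if a: "a \<in> A" for a
  proof -
    have "u \<noteq> a" using insert.hyps a by auto
    then obtain y where y: "y \<in> L" "\<chi> u y \<noteq> \<chi> a y" using insert.prems(4)[of u a] a by auto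
    have "(d a * (\<chi> a y - \<chi> u y)) = 0"
    proof (rule insert.IH[where d = "\<lambda>w. d w * (\<chi> w y - \<chi> u y)"])
      fix x assume x: "x \<in> L"
      have "(\<Sum>w\<in>A. d w * (\<chi> w y - \<chi> u y) * \<chi> w x)
          = (\<Sum>w\<in>A. d w * \<chi> w (x + y)) - \<chi> u y * (\<Sum>w\<in>A. d w * \<chi> w x)"
        using x y insert.prems(1)
        by (simp add: sum_distrib_left algebra_simps flip: sum_subtractf)
      also have "(\<Sum>w\<in>A. d w * \<chi> w (x + y)) = - (d u * \<chi> u (x + y))"
        using eq[OF insert.prems(2)[OF x y(1)]] by (simp add: eq_neg_iff_add_eq_0 add.commute)
      also have "(\<Sum>w\<in>A. d w * \<chi> w x) = - (d u * \<chi> u x)"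
        using eq[OF x] by (simp add: eq_neg_iff_add_eq_0 add.commute)
      also have "- (d u * \<chi> u (x + y)) - \<chi> u y * - (d u * \<chi> u x) = 0"
        using insert.prems(1)[of u x y] x y by simp
      finally show "(\<Sum>w\<in>A. d w * (\<chi> w y - \<chi> u y) * \<chi> w x) = 0" .
    qed (use insert.prems a in \<open>auto\<close>)
    then show ?thesis using y by simp
  qed
  then have "d u * \<chi> u x = 0" if "x \<in> L" for x using eq[OF that] by simp
  then have "d u = 0" using insert.prems(3)[of u] by auto
  with A0 insert.prems show ?case by auto
qed simp

context metaplectic
begin

abbreviation act :: "('a \<Rightarrow> 'a) \<Rightarrow> 'a ratfun \<Rightarrow> 'a ratfun" where "act \<equiv> perm_act"

lemma act_X [simp]: "w \<in> W \<Longrightarrow> act w (X \<nu>) = X (w \<nu>)"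
  and act_const [simp]: "w \<in> W \<Longrightarrow> act w (const c) = const c"
  and act_add: "w \<in> W \<Longrightarrow> act w (f + h) = act w f + act w h"
  and act_mult: "w \<in> W \<Longrightarrow> act w (f * h) = act w f * act w h"
  by (rule perm_act_hom; simp add: W_add W_inj)+

lemma act_linear:
  assumes "w \<in> W"
  shows "act w 0 = 0" "act w (- f) = - act w f" "act w (f - h) = act w f - act w h"
    "act w (sum k A) = (\<Sum>a\<in>A. act w (k a))" "act w 1 = 1"
  using additive_minus[of "act w", OF act_add[OF assms]] additive_sum[of "act w", OF act_add[OF assms]]
    act_const[OF assms, of 1] by auto

lemma act_eq_0: "w \<in> W \<Longrightarrow> act w f = 0 \<longleftrightarrow> f = 0"
proof
  assume w: "w \<in> W" and z: "act w f = 0"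
  show "f = 0"
  proof (rule ccontr)
    assume "f \<noteq> 0"
    then have "act w f * act w (inverse f) = 1" using w by (simp add: act_linear flip: act_mult)
    then show False using z by simp
  qed
qed (simp add: act_linear)

lemma act_divide: "w \<in> W \<Longrightarrow> act w (f / h) = act w f / act w h"
  by (rule ring_hom_divide) (simp_all add: act_linear act_mult act_eq_0)

lemma act_inverse: "w \<in> W \<Longrightarrow> act w (inverse f) = inverse (act w f)"
  using act_divide[of w 1 f] by (simp add: act_linear inverse_eq_divide)

lemma act_power: "w \<in> W \<Longrightarrow> act w (f ^ k) = act w f ^ k"
  by (induction k) (simp_all add: act_linear act_mult)

lemma act_prod: "w \<in> W \<Longrightarrow> act w (prod f A) = (\<Prod>a\<in>A. act w (f a))"
  by (induction A rule: infinite_finite_induct) (simp_all add: act_linear act_mult)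

lemmas act_simps = act_add act_mult act_linear act_divide act_inverse act_power

lemma act_comp: "w \<in> W \<Longrightarrow> u \<in> W \<Longrightarrow> act (w \<circ> u) f = act w (act u f)"
proof (induction f rule: ratfun_induct)
  case (const c)
  then show ?case using act_const[OF W_comp, of w u c] by (simp add: comp_def)
next
  case (X \<nu>)
  then show ?case using act_X[OF W_comp, of w u \<nu>] by (simp add: comp_def)
next
  case (add f h)
  then show ?case using W_comp[of w u] by (simp only: act_add)
next
  case (mult f h)
  then show ?case using W_comp[of w u] by (simp only: act_mult)
next
  case (divide f h)
  then show ?case using W_comp[of w u] by (simp only: act_divide)
qed

lemma act_id: "act id f = f"
proof (induction f rule: ratfun_induct)
  case (const c)
  show ?case using act_const[OF W.id, of c] by (simp add: id_def)
next
  case (X \<nu>)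
  show ?case using act_X[OF W.id, of \<nu>] by (simp add: id_def)
qed (use W.id in \<open>simp_all only: act_simps\<close>)

lemma act_s_s [simp]: "i \<in> {1..r} \<Longrightarrow> act (s i) (act (s i) f) = f"
proof -
  assume i: "i \<in> {1..r}"
  have "s i \<circ> s i = id" using i by (simp add: fun_eq_iff)
  then show ?thesis using act_comp[of "s i" "s i" f] i act_id[of f] by simp
qed

subsection \<open>Rescaled roots\<close>

definition rt :: "'a \<Rightarrow> 'a" where
  "rt \<beta> = zscale (m \<beta>) \<beta>"

lemma m_pos: "\<beta> \<in> \<Phi> \<Longrightarrow> 0 < m \<beta>"
  using n_pos Q_nonzero[of \<beta>] unfolding m_def
  by (metis gcd_dvd1 gcd_pos_int pos_imp_zdiv_pos_iff zdvd_imp_le of_nat_0_less_iff less_le_trans zero_less_one)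

lemma m_W: "w \<in> W \<Longrightarrow> m (w \<beta>) = m \<beta>"
  by (simp add: m_def invariant)

lemma rt_W: "w \<in> W \<Longrightarrow> w (rt \<beta>) = rt (w \<beta>)"
  by (simp add: rt_def m_W W_linear)

lemma m_minus: "\<beta> \<in> \<Phi> \<Longrightarrow> m (- \<beta>) = m \<beta>"
  using m_W[of "refl \<beta>" \<beta>] by (simp add: refl_in_W refl_self)

lemma rt_minus: "\<beta> \<in> \<Phi> \<Longrightarrow> rt (- \<beta>) = - rt \<beta>"
  by (simp add: rt_def m_minus zscale_minus_right)

lemma rt_neq_0: "\<beta> \<in> \<Phi> \<Longrightarrow> rt \<beta> \<noteq> 0"
  using m_pos[of \<beta>] zero_not_root by (auto simp: rt_def)

lemma n_dvd_m_Q: "int n dvd m \<beta> * Q \<beta>"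
proof -
  have "m \<beta> * Q \<beta> = int n * (Q \<beta> div gcd (int n) (Q \<beta>))"
    unfolding m_def by (metis dvd_div_mult div_mult_swap gcd_dvd1 gcd_dvd2)
  then show ?thesis by simp
qed

lemma m_dvd_iff: "\<beta> \<in> \<Phi> \<Longrightarrow> m \<beta> dvd k \<longleftrightarrow> int n dvd k * Q \<beta>"
proof
  assume "m \<beta> dvd k"
  then show "int n dvd k * Q \<beta>" using n_dvd_m_Q[of \<beta>] by (metis dvd_trans mult_dvd_mono dvd_refl)
next
  assume b: "\<beta> \<in> \<Phi>" and d: "int n dvd k * Q \<beta>"
  let ?g = "gcd (int n) (Q \<beta>)"
  have g0: "?g \<noteq> 0" using Q_nonzero[OF b] by simp
  have "?g * m \<beta> dvd k * (?g * (Q \<beta> div ?g))" using d by (simp add: m_def)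
  then have "?g * m \<beta> dvd ?g * (k * (Q \<beta> div ?g))" by (simp add: ac_simps)
  then have "m \<beta> dvd k * (Q \<beta> div ?g)" using g0 Q_nonzero[OF b] by simp
  moreover have "coprime (m \<beta>) (Q \<beta> div ?g)"
    unfolding m_def using g0 by (intro div_gcd_coprime) auto
  ultimately show "m \<beta> dvd k" by (simp add: coprime_dvd_mult_left_iff)
qed

text \<open>The Cartan integer of the rescaled roots: the coroot of \<open>rt \<beta>\<close> is
  that of \<beta> divided by \<open>m \<beta>\<close>. For roots the division is exact, by
  \<open>cr_mult\<close>.\<close>

definition cr :: "'a \<Rightarrow> 'a \<Rightarrow> int" where
  "cr \<beta> \<gamma> = m \<gamma> * coroot \<beta> \<gamma> div m \<beta>"

lemma cr_mult: "\<beta> \<in> \<Phi> \<Longrightarrow> \<gamma> \<in> \<Phi> \<Longrightarrow> cr \<beta> \<gamma> * m \<beta> = coroot \<beta> (rt \<gamma>)"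
proof -
  assume b: "\<beta> \<in> \<Phi>" and c: "\<gamma> \<in> \<Phi>"
  have "m \<gamma> * coroot \<beta> \<gamma> * Q \<beta> = m \<gamma> * Q \<gamma> * coroot \<gamma> \<beta>"
    using coroot_B[OF b, of \<gamma>] coroot_B[OF c, of \<beta>] B_sym[of \<beta> \<gamma>] by (simp add: ac_simps)
  then have "m \<beta> dvd m \<gamma> * coroot \<beta> \<gamma>"
    unfolding m_dvd_iff[OF b] using n_dvd_m_Q[of \<gamma>] by (metis dvd_mult2)
  then show ?thesis using b by (simp add: cr_def rt_def coroot_linear)
qed

lemma refl_rt: "\<beta> \<in> \<Phi> \<Longrightarrow> \<gamma> \<in> \<Phi> \<Longrightarrow> refl \<beta> (rt \<gamma>) = rt \<gamma> - zscale (cr \<beta> \<gamma>) (rt \<beta>)"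
  by (simp add: reflection_def rt_def[of \<beta>] zscale_zscale cr_mult)

lemma cr_pos: "\<beta> \<in> \<Phi> \<Longrightarrow> \<gamma> \<in> \<Phi> \<Longrightarrow> 0 < cr \<beta> \<gamma> \<longleftrightarrow> 0 < coroot \<beta> \<gamma>"
  using cr_mult[of \<beta> \<gamma>] m_pos[of \<beta>] m_pos[of \<gamma>]
  by (simp add: rt_def coroot_linear) (metis zero_less_mult_pos zero_less_mult_pos2 mult_pos_pos)

lemma ip_rt: "\<beta> \<in> \<Phi> \<Longrightarrow> \<gamma> \<in> \<Phi> \<Longrightarrow> 2 * ip (rt \<gamma>) (rt \<beta>) = cr \<beta> \<gamma> * ip (rt \<beta>) (rt \<beta>)"
proof -
  assume b: "\<beta> \<in> \<Phi>" and c: "\<gamma> \<in> \<Phi>"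
  have "2 * ip (rt \<gamma>) (rt \<beta>) = m \<beta> * (2 * ip (rt \<gamma>) \<beta>)" by (simp add: rt_def[of \<beta>] ip_simps)
  also have "\<dots> = m \<beta> * (coroot \<beta> (rt \<gamma>) * ip \<beta> \<beta>)" by (simp only: ip_coroot[OF b])
  also have "\<dots> = cr \<beta> \<gamma> * (m \<beta> * (m \<beta> * ip \<beta> \<beta>))" by (simp flip: cr_mult[OF b c])
  also have "m \<beta> * (m \<beta> * ip \<beta> \<beta>) = ip (rt \<beta>) (rt \<beta>)" by (simp add: rt_def ip_simps)
  finally show ?thesis .
qed

text \<open>The quasi-minuscule weight: the dominant root of minimal rescaled length.\<close>

lemma quasi_minuscule:
  obtains \<theta> where "\<theta> \<in> \<Phi>"
    and "\<And>\<gamma>. \<gamma> \<in> \<Phi> \<Longrightarrow> 0 < coroot \<theta> \<gamma> \<Longrightarrow> \<gamma> \<in> positive_roots"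
    and "\<And>\<gamma>. \<gamma> \<in> \<Phi> \<Longrightarrow> 0 < coroot \<theta> \<gamma> \<Longrightarrow> \<gamma> \<noteq> \<theta> \<Longrightarrow> cr \<gamma> \<theta> = 1"
    and "\<And>\<gamma>. \<gamma> \<in> \<Phi> \<Longrightarrow> 0 < coroot \<theta> \<gamma> \<Longrightarrow> refl \<theta> \<gamma> \<notin> positive_roots"
proof -
  define nm where "nm \<beta> = nat (ip (rt \<beta>) (rt \<beta>))" for \<beta>
  have ne: "\<Phi> \<noteq> {}" using irreducible by (simp add: irreducible_roots_def)
  then obtain \<beta> where b: "\<beta> \<in> \<Phi>" "\<And>\<gamma>. \<gamma> \<in> \<Phi> \<Longrightarrow> nm \<beta> \<le> nm \<gamma>"
    using ex_has_least_nat[of "\<lambda>\<beta>. \<beta> \<in> \<Phi>" _ nm] by blast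
  obtain w where w: "w \<in> W" "\<forall>i\<in>{1..r}. coroot (\<alpha> i) (w \<beta>) \<ge> 0" using exists_dominant by blast
  define \<theta> where "\<theta> = w \<beta>"
  have \<theta>: "\<theta> \<in> \<Phi>" using w b by (simp add: \<theta>_def)
  have nm: "ip (rt \<theta>) (rt \<theta>) \<le> ip (rt \<gamma>) (rt \<gamma>)" if "\<gamma> \<in> \<Phi>" for \<gamma>
    using b(2)[OF that] ip_nonneg[of "rt \<gamma>"] w by (simp add: \<theta>_def nm_def ip_W flip: rt_W)
  have ippos: "0 < ip (rt \<gamma>) (rt \<gamma>)" if "\<gamma> \<in> \<Phi>" for \<gamma>
    using ip_root_pos[OF that] m_pos[OF that] by (simp add: rt_def ip_simps)
  have dom: "0 \<le> coroot \<gamma> \<theta>" if "\<gamma> \<in> positive_roots" for \<gamma>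
    using dominant_positive[OF _ that] w by (simp add: \<theta>_def)
  have cr_sym: "0 < coroot \<theta> \<gamma> \<longleftrightarrow> 0 < coroot \<gamma> \<theta>" if "\<gamma> \<in> \<Phi>" for \<gamma>
    using ip_coroot_pos[OF \<theta>, of \<gamma>] ip_coroot_pos[OF that, of \<theta>] by (simp add: ip_sym)
  have p: "\<gamma> \<in> positive_roots" if g: "\<gamma> \<in> \<Phi>" "0 < coroot \<theta> \<gamma>" for \<gamma>
  proof (rule ccontr)
    assume "\<gamma> \<notin> positive_roots"
    then have "0 \<le> coroot (- \<gamma>) \<theta>" using dom[of "- \<gamma>"] g by (simp add: minus_positive_iff)
    then show False using g cr_sym[OF g(1)] by (simp add: coroot_minus)
  qed
  have one: "cr \<gamma> \<theta> = 1" if g: "\<gamma> \<in> \<Phi>" "0 < coroot \<theta> \<gamma>" "\<gamma> \<noteq> \<theta>" for \<gamma>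
  proof -
    have pos: "0 < cr \<gamma> \<theta>" using cr_pos[of \<gamma> \<theta>] cr_sym[OF g(1)] g \<theta> by simp
    \<comment> \<open>Otherwise minimality of \<open>rt \<theta>\<close> forces
      \<open>rt \<theta> - rt \<gamma>\<close> to have norm 0. As \<open>ip\<close> is only
      semidefinite, this gives no equality, but it makes the difference orthogonal to all coroots.
      The product of the two reflections then translates \<open>rt \<theta>\<close> by twice this
      difference.\<close>
    have "cr \<gamma> \<theta> < 2"
    proof (rule ccontr)
      assume c2: "\<not> cr \<gamma> \<theta> < 2"
      let ?t = "rt \<theta>" and ?c = "rt \<gamma>"
      have e: "2 * ip ?t ?c = cr \<gamma> \<theta> * ip ?c ?c" by (rule ip_rt[OF g(1) \<theta>])
      have "2 * ip ?c ?c \<le> 2 * ip ?t ?c"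
        unfolding e using c2 ippos[OF g(1)] by (intro mult_right_mono) auto
      then have "ip (?t - ?c) (?t - ?c) \<le> 0"
        using nm[OF g(1)] by (simp add: ip_simps ip_sym[of ?c ?t])
      then have z: "ip (?t - ?c) (?t - ?c) = 0" using ip_nonneg[of "?t - ?c"] by simp
      have "coroot \<delta> (?t - ?c) = 0" if "\<delta> \<in> \<Phi>" for \<delta>
        using z finite_roots that unfolding ip_def
        by (subst (asm) sum_nonneg_eq_0_iff) (auto simp flip: power2_eq_square)
      from this[OF g(1)] have "coroot \<gamma> ?t = coroot \<gamma> ?c" using g by (simp add: coroot_linear)
      then have "cr \<gamma> \<theta> * m \<gamma> = 2 * m \<gamma>"
        using cr_mult[OF g(1) \<theta>] g by (simp add: rt_def[of \<gamma>] coroot_simps)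
      then have "cr \<gamma> \<theta> = 2" using m_pos[OF g(1)] by simp
      have "refl \<gamma> ?t = ?t - ?c - ?c" using refl_rt[OF g(1) \<theta>] \<open>cr \<gamma> \<theta> = 2\<close> by (simp add: zscale_2 algebra_simps)
      have "cr \<theta> \<gamma> * ip ?t ?t = 2 * ip ?t ?t"
      proof -
        have "coroot \<theta> ?t = coroot \<theta> ?c"
          using \<open>\<And>\<delta>. \<delta> \<in> \<Phi> \<Longrightarrow> coroot \<delta> (?t - ?c) = 0\<close>[OF \<theta>] \<theta> by (simp add: coroot_linear)
        then have "cr \<theta> \<gamma> * m \<theta> = 2 * m \<theta>"
          using cr_mult[OF \<theta> g(1)] \<theta> by (simp add: rt_def[of \<theta>] coroot_simps)
        then show ?thesis using m_pos[OF \<theta>] by simp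
      qed
      then have "cr \<theta> \<gamma> = 2" using ippos[OF \<theta>] by simp
      have r1: "refl \<theta> (refl \<gamma> ?t) = ?t + (?t - ?c) + (?t - ?c)"
      proof -
        have *: "refl \<theta> ?t = - ?t" "refl \<theta> ?c = ?c - ?t - ?t"
          using refl_rt[OF \<theta> g(1)] \<open>cr \<theta> \<gamma> = 2\<close> rt_W[OF refl_in_W[OF \<theta>], of \<theta>] \<theta>
          by (simp_all add: zscale_2 algebra_simps refl_self rt_minus)
        show ?thesis unfolding \<open>refl \<gamma> ?t = ?t - ?c - ?c\<close> W_linear(3)[OF refl_in_W[OF \<theta>]] *
          by (simp add: algebra_simps)
      qed
      have fx: "refl \<delta> (?t - ?c) = ?t - ?c" if "\<delta> \<in> \<Phi>" for \<delta>
        using \<open>\<And>\<delta>. \<delta> \<in> \<Phi> \<Longrightarrow> coroot \<delta> (?t - ?c) = 0\<close>[OF that] by (simp add: reflection_def)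
      text \<open>Translates of \<open>\<theta>\<close> by multiples of a nonzero radical vector would be infinitely many roots.\<close>
      define e where "e = (?t - ?c) + (?t - ?c)"
      have ind: "((refl \<theta> \<circ> refl \<gamma>) ^^ k) ?t = ?t + zscale (int k) e" for k
      proof (induction k)
        case (Suc k)
        have fe: "refl \<delta> e = e" if "\<delta> \<in> \<Phi>" for \<delta> using fx[OF that] refl_add[OF that] by (simp add: e_def)
        have "refl \<delta> (zscale j e) = zscale j e" if "\<delta> \<in> \<Phi>" for \<delta> j
          using fe[OF that] W_linear(4)[OF refl_in_W[OF that]] by simp
        then show ?case using Suc r1 g(1) \<theta>
          by (simp add: refl_add zscale_add_left e_def[symmetric] add.assoc)
      qed simp
      have "((refl \<theta> \<circ> refl \<gamma>) ^^ k) ?t \<in> rt ` \<Phi>" for k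
      proof (induction k)
        case (Suc k)
        then obtain \<delta> where d: "\<delta> \<in> \<Phi>" "((refl \<theta> \<circ> refl \<gamma>) ^^ k) ?t = rt \<delta>" by blast
        have "((refl \<theta> \<circ> refl \<gamma>) ^^ Suc k) ?t = rt (refl \<theta> (refl \<gamma> \<delta>))"
          using d rt_W[OF refl_in_W[OF \<theta>]] rt_W[OF refl_in_W[OF g(1)]] by simp
        moreover have "refl \<theta> (refl \<gamma> \<delta>) \<in> \<Phi>" using d(1) g(1) \<theta> by (intro refl_root)
        ultimately show ?case by (metis imageI)
      qed (use \<theta> in auto)
      then have "range (\<lambda>k. ?t + zscale (int k) e) \<subseteq> rt ` \<Phi>" unfolding ind by blast
      then have "finite (range (\<lambda>k. ?t + zscale (int k) e))" using finite_roots finite_subset by blast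
      moreover have "e \<noteq> 0"
      proof
        assume "e = 0"
        then have "zscale 2 (?t - ?c) = 0" by (simp add: zscale_2 e_def)
        then have "?t = ?c" by simp
        then have "zscale (m \<theta>) \<theta> = zscale (m \<gamma>) \<gamma>" by (simp add: rt_def)
        then have "\<gamma> = \<theta> \<or> \<gamma> = - \<theta>"
          using reduced[unfolded reduced_def, rule_format, OF \<theta> g(1)] m_pos[OF \<theta>] m_pos[OF g(1)] by (metis less_irrefl)
        then show False using g \<theta> by (auto simp: coroot_simps)
      qed
      then have "inj (\<lambda>k::nat. ?t + zscale (int k) e)" by (auto simp: inj_def zscale_cancel_right)
      ultimately show False using finite_imageD by blast
    qed
    with pos show ?thesis by simp
  qed
  \<comment> \<open>A dominant element is highest in its orbit: every lengthening step on the right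
    subtracts a nonnegative multiple of \<open>u (\<alpha> j)\<close>, which is a positive
    root.\<close>
  have orbit: "rt \<theta> - rt (u \<theta>) \<in> cone" if "u \<in> W" for u
    using that
  proof (induction rule: W_right_induct)
    case (step j u)
    have "rt (u (s j \<theta>)) = rt (u \<theta>) - zscale (coroot (\<alpha> j) (rt \<theta>)) (u (\<alpha> j))"
    proof -
      have "rt (u (s j \<theta>)) = u (s j (rt \<theta>))" using step by (simp add: rt_W)
      then show ?thesis using step by (simp add: s_eq_coroot[of j "rt \<theta>"] W_linear rt_W)
    qed
    then have eq: "rt \<theta> - rt ((u \<circ> s j) \<theta>) = (rt \<theta> - rt (u \<theta>)) + zscale (coroot (\<alpha> j) (rt \<theta>)) (u (\<alpha> j))"
      by simp
    have "zscale (coroot (\<alpha> j) (rt \<theta>)) (u (\<alpha> j)) \<in> cone"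
    proof (rule cone_zscale)
      show "u (\<alpha> j) \<in> cone" using step by (simp add: positive_iff)
      show "0 \<le> coroot (\<alpha> j) (rt \<theta>)"
        using dom[of "\<alpha> j"] step m_pos[OF \<theta>] by (simp add: rt_def coroot_linear)
    qed
    then show ?case unfolding eq by (rule cone_add[OF step.IH])
  qed simp
  have neg_cone: "\<gamma> \<notin> positive_roots" if "\<gamma> \<in> \<Phi>" "- rt \<gamma> \<in> cone" for \<gamma>
  proof -
    have "zscale (m \<gamma>) (- \<gamma>) \<in> cone" using that by (simp add: rt_def zscale_minus_right)
    then have "- \<gamma> \<in> cone" using cone_zscale_iff[OF m_pos[OF that(1)], of "- \<gamma>"] that by simp
    then show ?thesis using that minus_positive_iff[of \<gamma>] by (simp add: positive_iff)
  qed
  have rt_cone: "rt \<gamma> \<in> cone" if "\<gamma> \<in> positive_roots" for \<gamma>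
    using that cone_zscale[of \<gamma> "m \<gamma>"] m_pos[of \<gamma>] by (simp add: rt_def positive_iff)
  have down: "refl \<theta> \<gamma> \<notin> positive_roots" if g: "\<gamma> \<in> \<Phi>" "0 < coroot \<theta> \<gamma>" for \<gamma>
  proof (cases "\<gamma> = \<theta>")
    case True
    then show ?thesis using p[OF g] \<theta> by (simp add: refl_self minus_positive_iff)
  next
    case False
    have c1: "cr \<gamma> \<theta> = 1" by (rule one[OF g False])
    let ?k = "cr \<theta> \<gamma>"
    have k: "1 \<le> ?k" using cr_pos[OF \<theta> g(1)] g by simp
    \<comment> \<open>Since \<open>cr \<gamma> \<theta>\<close> is 1, rescaling this root gives
      \<open>rt \<gamma> - rt \<theta>\<close>. It serves to compare
      \<open>rt (refl \<theta> \<gamma>)\<close> with the cone.\<close>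
    let ?\<delta> = "refl \<gamma> (- \<theta>)"
    have d: "?\<delta> \<in> \<Phi>" using \<theta> g refl_root by simp
    have rd: "rt ?\<delta> = rt \<gamma> - rt \<theta>"
      using refl_rt[OF g(1) \<theta>] c1 rt_W[OF refl_in_W[OF g(1)], of "- \<theta>"] \<theta> W_linear(2)[OF refl_in_W[OF g(1)]]
      by (simp add: rt_minus)
    have rg: "rt (refl \<theta> \<gamma>) = rt \<gamma> - zscale ?k (rt \<theta>)"
      using refl_rt[OF \<theta> g(1)] rt_W[OF refl_in_W[OF \<theta>], of \<gamma>] by simp
    show ?thesis
    proof (cases "?k = 1")
      case True
      then have "rt (refl \<theta> \<gamma>) = rt ?\<delta>" using rd rg by simp
      have "\<not> ?\<delta> \<in> positive_roots"
      proof
        assume "?\<delta> \<in> positive_roots"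
        then have "0 \<le> coroot ?\<delta> \<theta>" by (rule dom)
        then have "0 \<le> coroot \<theta> ?\<delta>" using cr_sym[OF d] coroot_eq_0_sym[OF d \<theta>] by linarith
        then have "0 \<le> coroot \<theta> (rt ?\<delta>)" using m_pos[OF d] \<theta> by (simp add: rt_def coroot_linear)
        moreover have "coroot \<theta> (rt ?\<delta>) = - m \<theta>"
          unfolding rd using cr_mult[OF \<theta> g(1)] True \<theta> by (simp add: coroot_linear) (simp add: rt_def coroot_simps)
        ultimately show False using m_pos[OF \<theta>] by simp
      qed
      moreover have "- rt ?\<delta> \<in> cone"
        using rt_cone[of "- ?\<delta>"] calculation d by (simp add: minus_positive_iff rt_minus)
      ultimately show ?thesis
        using neg_cone[of "refl \<theta> \<gamma>"] \<open>rt (refl \<theta> \<gamma>) = rt ?\<delta>\<close> refl_root[OF \<theta> g(1)] by simp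
    next
      case False
      \<comment> \<open>For k at least 2, \<open>- rt (refl \<theta> \<gamma>)\<close> is the sum of
        \<open>rt \<theta> - rt ?\<delta>\<close> and k - 2 copies of \<open>rt \<theta>\<close>;
        the first summand is in the cone because \<theta> is highest in its orbit.\<close>
      have "refl \<theta> \<theta> = - \<theta>" using \<theta> by (simp add: refl_self)
      then have "?\<delta> = (refl \<gamma> \<circ> refl \<theta>) \<theta>" by simp
      then have "rt \<theta> - rt ?\<delta> \<in> cone"
        using orbit[OF W_comp[OF refl_in_W[OF g(1)] refl_in_W[OF \<theta>]]] by simp
      moreover have "zscale (?k - 2) (rt \<theta>) \<in> cone"
        using k False rt_cone[OF p[OF \<theta>]] \<theta> by (intro cone_zscale) (auto simp: coroot_self)
      ultimately have "(rt \<theta> - rt ?\<delta>) + zscale (?k - 2) (rt \<theta>) \<in> cone" by (rule cone_add)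
      moreover have "(rt \<theta> - rt ?\<delta>) + zscale (?k - 2) (rt \<theta>) = - rt (refl \<theta> \<gamma>)"
        unfolding rd rg by (simp add: zscale_diff_left zscale_2 algebra_simps)
      ultimately show ?thesis using neg_cone[of "refl \<theta> \<gamma>"] refl_root[OF \<theta> g(1)] by simp
    qed
  qed
  from that[OF \<theta> p one down] show thesis .
qed

declare One_nat_def [simp del] atLeastAtMost_iff [simp del]

lemma inv_comp_W: "w \<in> W \<Longrightarrow> u \<in> W \<Longrightarrow> inv (w \<circ> u) x = inv u (inv w x)"
  by (rule inv_f_eq) (simp_all add: W_inj W_comp)

lemma inv_refl: "\<beta> \<in> \<Phi> \<Longrightarrow> inv (refl \<beta>) x = refl \<beta> x"
  by (rule inv_f_eq) (simp_all add: W_inj refl_in_W)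

lemma refl_minus: "\<beta> \<in> \<Phi> \<Longrightarrow> refl (- \<beta>) = refl \<beta>"
  by (simp add: fun_eq_iff reflection_def coroot_minus zscale_minus_left zscale_minus_right)

lemma refl_conj: "w \<in> W \<Longrightarrow> \<beta> \<in> \<Phi> \<Longrightarrow> refl (w \<beta>) \<circ> w = w \<circ> refl \<beta>"
  by (simp add: fun_eq_iff refl_W)

lemma s_comp_conj:
  assumes "i \<in> {1..r}" "w \<in> W" "\<beta> \<in> \<Phi>" "w \<beta> = \<alpha> i \<or> w \<beta> = - \<alpha> i"
  shows "s i \<circ> w = w \<circ> refl \<beta>"
proof -
  have "refl (w \<beta>) = s i" using assms refl_minus[of "\<alpha> i"] by (auto simp: s_refl)
  then show ?thesis using refl_conj[OF assms(2,3)] by simp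
qed

lemma s_pos_diff: "i \<in> {1..r} \<Longrightarrow> \<delta> \<in> positive_roots - {\<alpha> i} \<Longrightarrow> s i \<delta> \<in> positive_roots - {\<alpha> i}"
proof -
  assume i: "i \<in> {1..r}" and d: "\<delta> \<in> positive_roots - {\<alpha> i}"
  have "s i \<delta> \<noteq> \<alpha> i"
  proof
    assume "s i \<delta> = \<alpha> i"
    then have "\<delta> = - \<alpha> i" using s_s[OF i, of \<delta>] s_simple[OF i] by simp
    then show False using d i minus_positive_iff[of "\<alpha> i"] by simp
  qed
  then show ?thesis using s_positive[OF i] d by blast
qed

subsection \<open>The periodic Hecke module\<close>

definition xx :: "nat \<Rightarrow> 'a ratfun" where
  "xx i = X (rt (\<alpha> i))"

text \<open>Together with \<open>zz\<close> below, the coefficients in T_i = cc + zz sigma_i. The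
  parameter is kept free, since the proof compares its value \<open>v\<close> with the value
  0.\<close>

definition cc :: "complex \<Rightarrow> nat \<Rightarrow> 'a ratfun" where
  "cc q i = (1 - const q) * xx i / (1 - xx i)"

lemma xx_neq [simp]: "i \<in> {1..r} \<Longrightarrow> xx i \<noteq> 1" "xx i \<noteq> 0"
  by (simp_all add: xx_def rt_neq_0)

lemma act_xx [simp]: "i \<in> {1..r} \<Longrightarrow> act (s i) (xx i) = inverse (xx i)"
  by (simp add: xx_def rt_W s_simple rt_minus X_minus)

text \<open>
  A function \<open>\<phi>\<close> on \<open>W\<close> stands for the element \<open>\<Sum>w. \<phi> w e\<^sub>w\<close> of the module with basis \<open>e\<^sub>w\<close>. The left operator
  \<open>left_op q i\<close> satisfies the Bernstein relation with respect to scalars, and sends \<open>e\<^sub>w\<close> to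
  \<open>e\<^bsub>s\<^sub>i w\<^esub>\<close> if that element is longer, otherwise to \<open>(q - 1) e\<^sub>w + q e\<^bsub>s\<^sub>i w\<^esub>\<close>. The right
  operators are linear over the scalars.
\<close>

definition left_op :: "complex \<Rightarrow> nat \<Rightarrow> (('a \<Rightarrow> 'a) \<Rightarrow> 'a ratfun) \<Rightarrow> ('a \<Rightarrow> 'a) \<Rightarrow> 'a ratfun" where
  "left_op q i \<phi> w = (if w \<notin> W then 0
     else if up i w then const q * act (s i) (\<phi> (s i \<circ> w)) + cc q i * (\<phi> w - act (s i) (\<phi> w))
     else act (s i) (\<phi> (s i \<circ> w)) - (1 - const q) * act (s i) (\<phi> w) + cc q i * (\<phi> w - act (s i) (\<phi> w)))"

definition right_op :: "complex \<Rightarrow> nat \<Rightarrow> (('a \<Rightarrow> 'a) \<Rightarrow> 'a ratfun) \<Rightarrow> ('a \<Rightarrow> 'a) \<Rightarrow> 'a ratfun" where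
  "right_op q j \<phi> w = (if w \<notin> W then 0
     else if w (\<alpha> j) \<in> positive_roots then const q * \<phi> (w \<circ> s j)
     else \<phi> (w \<circ> s j) - (1 - const q) * \<phi> w)"

text \<open>If \<open>w\<close> sends \<open>\<alpha> j\<close> to plus or minus
  \<open>\<alpha> i\<close>, then \<open>w \<circ> s j\<close> is \<open>s i \<circ> w\<close> and
  both operators work on the same pair. Otherwise moving on one side does not affect the length test
  on the other.\<close>

lemma left_right_commute:
  assumes i: "i \<in> {1..r}" and j: "j \<in> {1..r}"
  shows "left_op q i (right_op q j \<phi>) = right_op q j (left_op q i \<phi>)"
proof
  fix w
  show "left_op q i (right_op q j \<phi>) w = right_op q j (left_op q i \<phi>) w"
  proof (cases "w \<in> W")
    case w: True
    have W: "s i \<circ> w \<in> W" "w \<circ> s j \<in> W" "s i \<circ> (w \<circ> s j) \<in> W" using w i j by (simp_all add: W_comp)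
    have u: "up i (w \<circ> s j) \<longleftrightarrow> s j (inv w (\<alpha> i)) \<in> positive_roots"
      using w j inv_comp_W[of w "s j"] inv_refl[of "\<alpha> j"] by (simp add: up_def s_refl refl_in_W)
    have inv: "inv w (\<alpha> i) = \<beta> \<longleftrightarrow> w \<beta> = \<alpha> i" for \<beta>
      using inv_W(1)[OF w, of \<beta>] inv_W(2)[OF w, of "\<alpha> i"] by auto
    have ass: "(s i \<circ> w) \<circ> s j = s i \<circ> (w \<circ> s j)" by (simp add: comp_assoc)
    consider "w (\<alpha> j) = \<alpha> i" | "w (\<alpha> j) = - \<alpha> i" | "w (\<alpha> j) \<noteq> \<alpha> i" "w (\<alpha> j) \<noteq> - \<alpha> i" by blast
    then show ?thesis
    proof cases
      case 1
      then have e: "w \<circ> s j = s i \<circ> w" using s_comp_conj[OF i w, of "\<alpha> j"] j by (simp add: s_refl)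
      have p: "w (\<alpha> j) \<in> positive_roots" "(s i \<circ> w) (\<alpha> j) \<notin> positive_roots"
        using 1 i by (simp_all add: s_simple minus_positive_iff)
      have "up i w" using inv[of "\<alpha> j"] 1 j unfolding up_def by simp
      then have u': "up i w" "\<not> up i (s i \<circ> w)" using up_s[OF i w] by simp_all
      have ww: "s i \<circ> (s i \<circ> w) = w" "(s i \<circ> w) \<circ> s j = w" using s_comp_s[OF i] ass e by metis+
      show ?thesis
        unfolding left_op_def right_op_def e ww using w W u' p i by (simp add: act_simps algebra_simps)
    next
      case 2
      then have e: "w \<circ> s j = s i \<circ> w" using s_comp_conj[OF i w, of "\<alpha> j"] j by (simp add: s_refl)
      have p: "w (\<alpha> j) \<notin> positive_roots" "(s i \<circ> w) (\<alpha> j) \<in> positive_roots"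
        using 2 i by (simp_all add: s_simple minus_positive_iff W_linear)
      have "inv w (\<alpha> i) = - \<alpha> j" using inv[of "- \<alpha> j"] 2 w by (simp add: W_linear)
      then have "\<not> up i w" using j unfolding up_def by (simp add: minus_positive_iff)
      then have u': "\<not> up i w" "up i (s i \<circ> w)" using up_s[OF i w] by simp_all
      have ww: "s i \<circ> (s i \<circ> w) = w" "(s i \<circ> w) \<circ> s j = w" using s_comp_s[OF i] ass e by metis+
      show ?thesis
        unfolding left_op_def right_op_def e ww using w W u' p i by (simp add: act_simps algebra_simps)
    next
      case 3
      have "inv w (\<alpha> i) \<noteq> \<alpha> j" using inv[of "\<alpha> j"] 3(1) by simp
      moreover have "inv w (\<alpha> i) \<noteq> - \<alpha> j"
        using inv[of "- \<alpha> j"] 3(2) W_linear(2)[OF w, of "\<alpha> j"] by (metis add.inverse_inverse)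
      ultimately have u': "up i (w \<circ> s j) \<longleftrightarrow> up i w"
        unfolding u using s_pos_iff[OF j, of "inv w (\<alpha> i)"] w i by (simp add: up_def inv_in_W)
      have p: "(s i \<circ> w) (\<alpha> j) \<in> positive_roots \<longleftrightarrow> w (\<alpha> j) \<in> positive_roots"
        using s_pos_iff[OF i, of "w (\<alpha> j)"] 3 w j by simp
      show ?thesis
        unfolding left_op_def right_op_def ass using w W u' p i
        by (cases "up i w"; cases "w (\<alpha> j) \<in> positive_roots") (simp_all add: act_simps algebra_simps)
    qed
  qed (simp add: left_op_def right_op_def)
qed

text \<open>The power of q that accompanies the monomial in \<open>affine_op\<close>. Its change
  under a simple reflection balances the factor q in \<open>left_op\<close>.\<close>

definition zeta :: "'a \<Rightarrow> nat" where
  "zeta \<beta> = card {\<delta> \<in> positive_roots. 0 < coroot \<beta> \<delta>}"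

lemma zeta_split:
  assumes "i \<in> {1..r}"
  shows "zeta \<beta> = card {\<delta> \<in> positive_roots - {\<alpha> i}. 0 < coroot \<beta> \<delta>} + (if 0 < coroot \<beta> (\<alpha> i) then 1 else 0)"
proof -
  let ?A = "{\<delta> \<in> positive_roots - {\<alpha> i}. 0 < coroot \<beta> \<delta>}"
  have "{\<delta> \<in> positive_roots. 0 < coroot \<beta> \<delta>} = (if 0 < coroot \<beta> (\<alpha> i) then insert (\<alpha> i) ?A else ?A)"
    using assms by auto
  then show ?thesis unfolding zeta_def by simp
qed

lemma zeta_s:
  assumes i: "i \<in> {1..r}" and b: "\<beta> \<in> \<Phi>"
  shows "coroot \<beta> (\<alpha> i) = 0 \<Longrightarrow> zeta (s i \<beta>) = zeta \<beta>"
    and "0 < coroot \<beta> (\<alpha> i) \<Longrightarrow> zeta \<beta> = Suc (zeta (s i \<beta>))"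
proof -
  have c: "coroot (s i \<beta>) (s i \<delta>) = coroot \<beta> \<delta>" for \<delta> using coroot_W[of "s i" \<beta> \<delta>] i b by simp
  have c': "coroot (s i \<beta>) \<delta> = coroot \<beta> (s i \<delta>)" for \<delta> using c[of "s i \<delta>"] i by simp
  have "bij_betw (s i) {\<delta> \<in> positive_roots - {\<alpha> i}. 0 < coroot \<beta> \<delta>} {\<delta> \<in> positive_roots - {\<alpha> i}. 0 < coroot (s i \<beta>) \<delta>}"
  proof (rule bij_betwI[where g = "s i"])
    show "s i \<in> {\<delta> \<in> positive_roots - {\<alpha> i}. 0 < coroot \<beta> \<delta>} \<rightarrow> {\<delta> \<in> positive_roots - {\<alpha> i}. 0 < coroot (s i \<beta>) \<delta>}"
    proof
      fix \<delta> assume "\<delta> \<in> {\<delta> \<in> positive_roots - {\<alpha> i}. 0 < coroot \<beta> \<delta>}"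
      then show "s i \<delta> \<in> {\<delta> \<in> positive_roots - {\<alpha> i}. 0 < coroot (s i \<beta>) \<delta>}"
        using s_pos_diff[OF i, of \<delta>] c[of \<delta>] by simp
    qed
    show "s i \<in> {\<delta> \<in> positive_roots - {\<alpha> i}. 0 < coroot (s i \<beta>) \<delta>} \<rightarrow> {\<delta> \<in> positive_roots - {\<alpha> i}. 0 < coroot \<beta> \<delta>}"
    proof
      fix \<delta> assume "\<delta> \<in> {\<delta> \<in> positive_roots - {\<alpha> i}. 0 < coroot (s i \<beta>) \<delta>}"
      then show "s i \<delta> \<in> {\<delta> \<in> positive_roots - {\<alpha> i}. 0 < coroot \<beta> \<delta>}"
        using s_pos_diff[OF i, of \<delta>] c'[of \<delta>] by simp
    qed
  qed (use i in simp_all)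
  then have *: "card {\<delta> \<in> positive_roots - {\<alpha> i}. 0 < coroot (s i \<beta>) \<delta>} = card {\<delta> \<in> positive_roots - {\<alpha> i}. 0 < coroot \<beta> \<delta>}"
    by (rule bij_betw_same_card[symmetric])
  have a: "coroot (s i \<beta>) (\<alpha> i) = - coroot \<beta> (\<alpha> i)"
    using c'[of "\<alpha> i"] i b by (simp add: s_simple coroot_linear)
  show "coroot \<beta> (\<alpha> i) = 0 \<Longrightarrow> zeta (s i \<beta>) = zeta \<beta>"
    "0 < coroot \<beta> (\<alpha> i) \<Longrightarrow> zeta \<beta> = Suc (zeta (s i \<beta>))"
    unfolding zeta_split[OF i, of \<beta>] zeta_split[OF i, of "s i \<beta>"] * a by simp_all
qed

text \<open>The positive roots not orthogonal to \<open>\<alpha> i\<close> split by the sign of the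
  pairing into \<open>zeta (\<alpha> i)\<close> and \<open>zeta (- \<alpha> i)\<close> many, and
  these numbers differ by one, for \<open>\<alpha> i\<close> itself. Their total depends on \<theta>
  only, so one constant in \<open>affine_op\<close> can serve for all \<open>w\<close>.\<close>

lemma zeta_minus_simple:
  assumes i: "i \<in> {1..r}" and w: "w \<in> W" and t: "\<theta> \<in> \<Phi>" "w \<theta> = \<alpha> i"
  shows "zeta (- \<alpha> i) = (card {\<delta> \<in> \<Phi>. coroot \<theta> \<delta> \<noteq> 0} div 2 - 1) div 2"
proof -
  let ?P = "{\<delta> \<in> positive_roots. coroot (\<alpha> i) \<delta> \<noteq> 0}"
  have "bij_betw w {\<delta> \<in> \<Phi>. coroot \<theta> \<delta> \<noteq> 0} {\<delta> \<in> \<Phi>. coroot (\<alpha> i) \<delta> \<noteq> 0}"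
  proof (rule bij_betwI[where g = "inv w"])
    show "w \<in> {\<delta> \<in> \<Phi>. coroot \<theta> \<delta> \<noteq> 0} \<rightarrow> {\<delta> \<in> \<Phi>. coroot (\<alpha> i) \<delta> \<noteq> 0}"
      using coroot_W[OF w t(1)] t w by auto
    show "inv w \<in> {\<delta> \<in> \<Phi>. coroot (\<alpha> i) \<delta> \<noteq> 0} \<rightarrow> {\<delta> \<in> \<Phi>. coroot \<theta> \<delta> \<noteq> 0}"
    proof
      fix \<delta> assume "\<delta> \<in> {\<delta> \<in> \<Phi>. coroot (\<alpha> i) \<delta> \<noteq> 0}"
      then show "inv w \<delta> \<in> {\<delta> \<in> \<Phi>. coroot \<theta> \<delta> \<noteq> 0}"
        using coroot_W[OF w t(1), of "inv w \<delta>"] t w by (simp add: inv_in_W)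
    qed
  qed (use w in auto)
  then have "card {\<delta> \<in> \<Phi>. coroot \<theta> \<delta> \<noteq> 0} = card {\<delta> \<in> \<Phi>. coroot (\<alpha> i) \<delta> \<noteq> 0}"
    by (rule bij_betw_same_card)
  also have "{\<delta> \<in> \<Phi>. coroot (\<alpha> i) \<delta> \<noteq> 0} = ?P \<union> uminus ` ?P"
  proof (intro set_eqI iffI)
    fix \<delta> assume d: "\<delta> \<in> {\<delta> \<in> \<Phi>. coroot (\<alpha> i) \<delta> \<noteq> 0}"
    show "\<delta> \<in> ?P \<union> uminus ` ?P"
    proof (cases "\<delta> \<in> positive_roots")
      case False
      then have "- \<delta> \<in> ?P" using d i by (simp add: minus_positive_iff coroot_linear)
      then have "- (- \<delta>) \<in> uminus ` ?P" by blast
      then show ?thesis by simp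
    qed (use d in simp)
  qed (use i in \<open>auto simp: coroot_linear\<close>)
  also have "card \<dots> = card ?P + card (uminus ` ?P)"
    by (rule card_Un_disjoint) (auto simp: minus_positive_iff)
  also have "card (uminus ` ?P) = card ?P" by (rule card_image) simp
  also have "?P = {\<delta> \<in> positive_roots. 0 < coroot (\<alpha> i) \<delta>} \<union> {\<delta> \<in> positive_roots. 0 < coroot (- \<alpha> i) \<delta>}"
    using i by (auto simp: coroot_minus)
  also have "card \<dots> = zeta (\<alpha> i) + zeta (- \<alpha> i)"
    unfolding zeta_def using i by (intro card_Un_disjoint) (auto simp: coroot_minus)
  also have "zeta (\<alpha> i) = Suc (zeta (- \<alpha> i))"
    using zeta_s(2)[OF i, of "\<alpha> i"] i by (simp add: coroot_self s_simple)
  finally show ?thesis by simp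
qed

text \<open>For a root \<theta> this plays, up to a power of q, the part of the inverse of an affine
  Hecke generator acting from the right. With N the exponent in the last term, its eigenvalues on
  each pair \<open>w\<close>, \<open>w \<circ> refl \<theta>\<close> are q^N and -q^(N+1).\<close>

definition affine_op :: "complex \<Rightarrow> 'a \<Rightarrow> (('a \<Rightarrow> 'a) \<Rightarrow> 'a ratfun) \<Rightarrow> ('a \<Rightarrow> 'a) \<Rightarrow> 'a ratfun" where
  "affine_op q \<theta> \<phi> w = (if w \<notin> W then 0
     else const q ^ zeta (w \<theta>) * X (rt (w \<theta>)) * \<phi> (w \<circ> refl \<theta>)
       + (if w \<theta> \<in> positive_roots then 0
          else (1 - const q) * const q ^ ((card {\<delta> \<in> \<Phi>. coroot \<theta> \<delta> \<noteq> 0} div 2 - 1) div 2)) * \<phi> w)"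

lemma cr_W: "w \<in> W \<Longrightarrow> \<beta> \<in> \<Phi> \<Longrightarrow> cr (w \<beta>) (w \<gamma>) = cr \<beta> \<gamma>"
  by (simp add: cr_def m_W coroot_W)

lemma cr_minus: "\<beta> \<in> \<Phi> \<Longrightarrow> \<gamma> \<in> \<Phi> \<Longrightarrow> cr (- \<beta>) \<gamma> = - cr \<beta> \<gamma>"
proof -
  assume b: "\<beta> \<in> \<Phi>" and c: "\<gamma> \<in> \<Phi>"
  have "cr (- \<beta>) \<gamma> * m \<beta> = (- cr \<beta> \<gamma>) * m \<beta>"
    using cr_mult[OF b c] cr_mult[of "- \<beta>" \<gamma>] b c by (simp add: m_minus coroot_minus)
  then show ?thesis using m_pos[OF b] by (metis less_irrefl mult_cancel_right)
qed

text \<open>Everything depends on how \<open>inv w (\<alpha> i)\<close> pairs with \<theta>. If it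
  is \<theta> or its negative, both operators work on one pair. If it is orthogonal, no test and no
  scalar changes. If the pairing is positive, \<open>p\<close> and \<open>down\<close> put
  \<open>w\<close> and \<open>w \<circ> refl \<theta>\<close> into different branches of
  \<open>left_op\<close>, \<open>one\<close> changes the monomial by exactly one factor
  \<open>xx i\<close>, and the drop of \<open>zeta\<close> by one accounts for the remaining q. A
  negative pairing is the mirror image.\<close>

lemma left_affine_commute:
  assumes i: "i \<in> {1..r}" and t: "\<theta> \<in> \<Phi>"
    and p: "\<And>\<gamma>. \<gamma> \<in> \<Phi> \<Longrightarrow> 0 < coroot \<theta> \<gamma> \<Longrightarrow> \<gamma> \<in> positive_roots"
    and one: "\<And>\<gamma>. \<gamma> \<in> \<Phi> \<Longrightarrow> 0 < coroot \<theta> \<gamma> \<Longrightarrow> \<gamma> \<noteq> \<theta> \<Longrightarrow> cr \<gamma> \<theta> = 1"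
    and down: "\<And>\<gamma>. \<gamma> \<in> \<Phi> \<Longrightarrow> 0 < coroot \<theta> \<gamma> \<Longrightarrow> refl \<theta> \<gamma> \<notin> positive_roots"
  shows "left_op q i (affine_op q \<theta> \<phi>) = affine_op q \<theta> (left_op q i \<phi>)"
proof
  fix w
  show "left_op q i (affine_op q \<theta> \<phi>) w = affine_op q \<theta> (left_op q i \<phi>) w"
  proof (cases "w \<in> W")
    case w: True
    note rW = refl_in_W[OF t]
    have W: "s i \<circ> w \<in> W" "w \<circ> refl \<theta> \<in> W" "s i \<circ> (w \<circ> refl \<theta>) \<in> W" using w i rW by (simp_all add: W_comp)
    let ?\<gamma> = "inv w (\<alpha> i)"
    have g: "?\<gamma> \<in> \<Phi>" using w i by (simp add: inv_in_W)
    have wg: "w ?\<gamma> = \<alpha> i" using w by simp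
    have u: "up i (w \<circ> refl \<theta>) \<longleftrightarrow> refl \<theta> ?\<gamma> \<in> positive_roots"
      using w t rW inv_comp_W[of w "refl \<theta>"] inv_refl[of \<theta>] by (simp add: up_def)
    have ug: "up i w \<longleftrightarrow> ?\<gamma> \<in> positive_roots" by (simp add: up_def)
    have ass: "(s i \<circ> w) \<circ> refl \<theta> = s i \<circ> (w \<circ> refl \<theta>)" by (simp add: comp_assoc)
    have th: "(s i \<circ> w) \<theta> = s i (w \<theta>)" by simp
    have wt: "w \<theta> \<in> \<Phi>" using w t by simp
    have k: "coroot (w \<theta>) (\<alpha> i) = coroot \<theta> ?\<gamma>" using coroot_W[OF w t, of ?\<gamma>] wg by simp
    have c: "cc q i = (1 - const q) * xx i / (1 - xx i)" by (rule cc_def)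
    have x: "xx i \<noteq> 0" "1 - xx i \<noteq> 0" using i by simp_all
    have sX: "s i (rt (w \<theta>)) = rt (s i (w \<theta>))" using i by (simp add: rt_W)
    have sX': "s i (rt (s i (w \<theta>))) = rt (w \<theta>)" using i by (simp add: rt_W)
    have X': "X (rt (s i (w \<theta>))) = X (rt (w \<theta>)) * X (- zscale (cr ?\<gamma> \<theta>) (rt (\<alpha> i)))"
    proof -
      have "cr (\<alpha> i) (w \<theta>) = cr ?\<gamma> \<theta>" using cr_W[OF w g, of \<theta>] wg by simp
      then have "s i (rt (w \<theta>)) = rt (w \<theta>) + - zscale (cr ?\<gamma> \<theta>) (rt (\<alpha> i))"
        using refl_rt[of "\<alpha> i" "w \<theta>"] wt i by (simp add: s_refl)
      then show ?thesis unfolding sX[symmetric] by (simp only: X_add)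
    qed
    define A :: "'a ratfun" where "A = (if w \<theta> \<in> positive_roots then 0
          else (1 - const q) * const q ^ ((card {\<delta> \<in> \<Phi>. coroot \<theta> \<delta> \<noteq> 0} div 2 - 1) div 2))"
    have aA: "act (s i) A = A" unfolding A_def using i by (simp add: act_simps)
    consider "?\<gamma> = \<theta>" | "?\<gamma> = - \<theta>" | "coroot \<theta> ?\<gamma> = 0"
      | "0 < coroot \<theta> ?\<gamma>" "?\<gamma> \<noteq> \<theta>" | "coroot \<theta> ?\<gamma> < 0" "?\<gamma> \<noteq> - \<theta>" by linarith
    then show ?thesis
    proof cases
      case 1
      then have b: "w \<theta> = \<alpha> i" using wg by simp
      have e: "w \<circ> refl \<theta> = s i \<circ> w" using s_comp_conj[OF i w t] b by simp
      have ww: "s i \<circ> (s i \<circ> w) = w" "(s i \<circ> w) \<circ> refl \<theta> = w" using s_comp_s[OF i] ass e by metis+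
      have "up i w" using p[OF t] t unfolding ug 1 by (simp add: coroot_self)
      then have u': "up i w" "\<not> up i (s i \<circ> w)" using up_s[OF i w] by simp_all
      have n: "\<alpha> i \<in> positive_roots" "- \<alpha> i \<notin> positive_roots" using i by (simp_all add: minus_positive_iff)
      have z: "zeta (\<alpha> i) = Suc (zeta (- \<alpha> i))" using zeta_s(2)[OF i, of "\<alpha> i"] i by (simp add: coroot_self s_simple)
      have XX: "X (rt (\<alpha> i)) = xx i" "X (rt (- \<alpha> i)) = inverse (xx i)"
        using i by (simp_all add: xx_def rt_minus X_minus)
      show ?thesis
        unfolding left_op_def affine_op_def e ww th b zeta_minus_simple[OF i w t b, symmetric] c s_simple[OF i] z XX
        using w W(1) u' n i x by (simp add: act_simps) (simp add: field_simps)
    next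
      case 2
      then have b: "w \<theta> = - \<alpha> i" using wg w by (metis W_linear(2) add.inverse_inverse)
      have e: "w \<circ> refl \<theta> = s i \<circ> w" using s_comp_conj[OF i w t] b by simp
      have ww: "s i \<circ> (s i \<circ> w) = w" "(s i \<circ> w) \<circ> refl \<theta> = w" using s_comp_s[OF i] ass e by metis+
      have "\<not> up i w" using p[OF t] t unfolding ug 2 by (simp add: coroot_self minus_positive_iff)
      then have u': "\<not> up i w" "up i (s i \<circ> w)" using up_s[OF i w] by simp_all
      have b': "(w \<circ> refl \<theta>) \<theta> = \<alpha> i" using b t w by (simp add: refl_self W_linear)
      have n: "\<alpha> i \<in> positive_roots" "- \<alpha> i \<notin> positive_roots" using i by (simp_all add: minus_positive_iff)
      have z: "zeta (\<alpha> i) = Suc (zeta (- \<alpha> i))" using zeta_s(2)[OF i, of "\<alpha> i"] i by (simp add: coroot_self s_simple)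
      have XX: "X (rt (\<alpha> i)) = xx i" "X (rt (- \<alpha> i)) = inverse (xx i)"
        using i by (simp_all add: xx_def rt_minus X_minus)
      have ss: "s i (- \<alpha> i) = \<alpha> i" using s_simple[OF i] i by (simp add: W_linear)
      show ?thesis
        unfolding left_op_def affine_op_def e ww th b zeta_minus_simple[OF i W(2) t b', symmetric] c ss z XX
        using w W(1) u' n i x by (simp add: act_simps) (simp add: divide_simps, algebra)
    next
      case 3
      have rg: "refl \<theta> ?\<gamma> = ?\<gamma>" using 3 by (simp add: reflection_def)
      have u': "up i (w \<circ> refl \<theta>) \<longleftrightarrow> up i w" unfolding u ug rg ..
      have "cr ?\<gamma> \<theta> = 0" using 3 coroot_eq_0_sym[OF t g] by (simp add: cr_def)
      then have X0: "X (rt (s i (w \<theta>))) = X (rt (w \<theta>))" unfolding X' by simp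
      have z: "zeta (s i (w \<theta>)) = zeta (w \<theta>)" using zeta_s(1)[OF i wt] 3 k by simp
      have "w \<theta> \<noteq> \<alpha> i" "w \<theta> \<noteq> - \<alpha> i" using k 3 i by (auto simp: coroot_self coroot_minus)
      then have n: "s i (w \<theta>) \<in> positive_roots \<longleftrightarrow> w \<theta> \<in> positive_roots" by (rule s_pos_iff[OF i wt])
      show ?thesis
        unfolding left_op_def affine_op_def ass th z X0 n
        using w W u' i sX X0 by (simp add: act_simps algebra_simps)
    next
      case 4
      have u': "up i w" "\<not> up i (w \<circ> refl \<theta>)" unfolding u ug using p[OF g] down[OF g] 4 by simp_all
      have "cr ?\<gamma> \<theta> = 1" using one[OF g] 4 by simp
      then have X0: "X (rt (s i (w \<theta>))) = X (rt (w \<theta>)) / xx i"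
        unfolding X' by (simp add: X_minus xx_def divide_inverse)
      have z: "zeta (w \<theta>) = Suc (zeta (s i (w \<theta>)))" using zeta_s(2)[OF i wt] 4 k by simp
      have "w \<theta> \<noteq> \<alpha> i" using 4 inv_W(1)[OF w, of \<theta>] by auto
      moreover have "w \<theta> \<noteq> - \<alpha> i" using k 4 i by (auto simp: coroot_self coroot_minus)
      ultimately have n: "s i (w \<theta>) \<in> positive_roots \<longleftrightarrow> w \<theta> \<in> positive_roots" by (rule s_pos_iff[OF i wt])
      have sXw: "act (s i) (X (rt (w \<theta>))) = X (rt (w \<theta>)) / xx i" using i X0 by (simp add: sX)
      show ?thesis
        unfolding left_op_def affine_op_def ass th z X0 n c A_def[symmetric]
        using w W u' i x apply (simp add: act_simps sXw aA del: act_X) apply (simp add: divide_simps) by algebra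
    next
      case 5
      have g': "- ?\<gamma> \<in> \<Phi>" "0 < coroot \<theta> (- ?\<gamma>)" "- ?\<gamma> \<noteq> \<theta>" using g 5 t by (auto simp: coroot_linear)
      have "refl \<theta> ?\<gamma> \<in> \<Phi>" using t g refl_root by simp
      then have u': "\<not> up i w" "up i (w \<circ> refl \<theta>)"
        unfolding u ug using p[OF g'(1,2)] down[OF g'(1,2)] g W_linear(2)[OF rW] by (simp_all add: minus_positive_iff)
      have "cr ?\<gamma> \<theta> = - 1" using one[OF g'] cr_minus[OF g t] by simp
      then have X0: "X (rt (s i (w \<theta>))) = X (rt (w \<theta>)) * xx i"
        unfolding X' by (simp add: zscale_minus_left xx_def)
      have "coroot (s i (w \<theta>)) (\<alpha> i) = - coroot (w \<theta>) (\<alpha> i)"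
        using coroot_W[of "s i" "w \<theta>" "s i (\<alpha> i)"] i wt by (simp add: s_simple coroot_linear W_linear)
      then have z: "zeta (s i (w \<theta>)) = Suc (zeta (w \<theta>))"
        using zeta_s(2)[OF i, of "s i (w \<theta>)"] 5 k i wt by simp
      have "w \<theta> \<noteq> - \<alpha> i" using 5 inv_W(1)[OF w, of "- \<theta>"] W_linear(2)[OF w, of \<theta>] by auto
      moreover have "w \<theta> \<noteq> \<alpha> i" using k 5 i by (auto simp: coroot_self)
      ultimately have n: "s i (w \<theta>) \<in> positive_roots \<longleftrightarrow> w \<theta> \<in> positive_roots" by (intro s_pos_iff[OF i wt])
      have sXw: "act (s i) (X (rt (w \<theta>))) = X (rt (w \<theta>)) * xx i" using i X0 by (simp add: sX)
      show ?thesis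
        unfolding left_op_def affine_op_def ass th z X0 n c A_def[symmetric]
        using w W u' i x apply (simp add: act_simps sXw aA del: act_X) apply (simp add: divide_simps) by algebra
    qed
  qed (simp add: left_op_def affine_op_def)
qed

section \<open>Independence of the reduced word for the left operators\<close>

definition delta :: "'a \<Rightarrow> ('a \<Rightarrow> 'a) \<Rightarrow> ('a \<Rightarrow> 'a) \<Rightarrow> 'a ratfun" where
  "delta \<nu> w u = (if u = w then X \<nu> else 0)"

definition left_word :: "complex \<Rightarrow> nat list \<Rightarrow> (('a \<Rightarrow> 'a) \<Rightarrow> 'a ratfun) \<Rightarrow> ('a \<Rightarrow> 'a) \<Rightarrow> 'a ratfun" where
  "left_word q js \<phi> = foldr (left_op q) js \<phi>"

lemma left_word_simps: "left_word q [] \<phi> = \<phi>" "left_word q (i # js) \<phi> = left_op q i (left_word q js \<phi>)"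
  by (simp_all add: left_word_def)

lemma left_op_linear:
  assumes "i \<in> {1..r}"
  shows "left_op q i (\<lambda>w. const c * \<phi> w + const d * \<psi> w) = (\<lambda>w. const c * left_op q i \<phi> w + const d * left_op q i \<psi> w)"
  using assms by (intro ext) (simp add: left_op_def act_simps algebra_simps)

lemma left_word_linear:
  assumes "set js \<subseteq> {1..r}"
  shows "left_word q js (\<lambda>w. const c * \<phi> w + const d * \<psi> w) = (\<lambda>w. const c * left_word q js \<phi> w + const d * left_word q js \<psi> w)"
  using assms
proof (induction js)
  case (Cons i js)
  then show ?case unfolding left_word_simps using left_op_linear[of i] by simp
qed (simp add: left_word_simps)

lemma s_comp_eq_iff: "i \<in> {1..r} \<Longrightarrow> s i \<circ> u = w \<longleftrightarrow> u = s i \<circ> w"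
  using s_comp_s by metis

lemma left_op_delta:
  assumes i: "i \<in> {1..r}" and w: "w \<in> W" "up i w"
  shows "left_op q i (delta 0 w) = delta 0 (s i \<circ> w)"
proof
  fix u
  have sw: "s i \<circ> w \<in> W" using i w by (simp add: W_comp)
  have n: "\<not> up i (s i \<circ> w)" using up_s[OF i w(1)] w by simp
  consider "u \<notin> W" | "u \<in> W" "up i u" | "u \<in> W" "\<not> up i u" by blast
  then show "left_op q i (delta 0 w) u = delta 0 (s i \<circ> w) u"
  proof cases
    case 1
    then show ?thesis using sw by (auto simp: left_op_def delta_def)
  next
    case 2
    then have "u \<noteq> s i \<circ> w" using n by blast
    then show ?thesis using 2 i s_comp_eq_iff[OF i, of u w] by (simp add: left_op_def delta_def act_simps)
  next
    case 3
    then have "u \<noteq> w" using w by blast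
    then show ?thesis using 3 i s_comp_eq_iff[OF i, of u w] by (simp add: left_op_def delta_def act_simps)
  qed
qed

lemma left_word_delta: "reduced_word js w \<Longrightarrow> left_word q js (delta 0 id) = delta 0 w"
proof (induction rule: reduced_word_induct)
  case Nil
  show ?case by (simp only: left_word_simps)
next
  case (Cons i js w)
  then show ?case using left_op_delta[OF Cons(1,3,4), of q] by (simp only: left_word_simps)
qed

text \<open>The exponents that \<open>affine_op\<close> can produce. The monoid generated by the
  orbit is a group, because \<open>- rt \<theta>\<close> lies in the orbit.\<close>

inductive_set lat :: "'a \<Rightarrow> 'a set" for \<theta> where
  zero: "0 \<in> lat \<theta>"
| add: "\<nu> \<in> lat \<theta> \<Longrightarrow> u \<in> W \<Longrightarrow> \<nu> + u (rt \<theta>) \<in> lat \<theta>"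

lemma lat_add: "\<mu> \<in> lat \<theta> \<Longrightarrow> \<nu> \<in> lat \<theta> \<Longrightarrow> \<nu> + \<mu> \<in> lat \<theta>"
  by (induction rule: lat.induct) (auto simp: add.assoc[symmetric] intro: lat.add)

lemma lat_W: "\<nu> \<in> lat \<theta> \<Longrightarrow> w \<in> W \<Longrightarrow> w \<nu> \<in> lat \<theta>"
proof (induction rule: lat.induct)
  case (add \<nu> u)
  then show ?case using lat.add[of "w \<nu>" \<theta> "w \<circ> u"] by (simp add: W_simps W_comp)
qed (simp add: W_linear lat.zero)

lemma lat_minus: "\<theta> \<in> \<Phi> \<Longrightarrow> \<nu> \<in> lat \<theta> \<Longrightarrow> - \<nu> \<in> lat \<theta>"
proof (rotate_tac, induction rule: lat.induct)
  case (add \<nu> u)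
  have "(u \<circ> refl \<theta>) (rt \<theta>) = - u (rt \<theta>)"
    using add rt_W[OF refl_in_W[of \<theta>], of \<theta>] by (simp add: refl_self rt_minus W_linear)
  then show ?case
    using lat.add[of "- \<nu>" \<theta> "u \<circ> refl \<theta>"] add W_comp[of u "refl \<theta>"] refl_in_W[of \<theta>] by simp
qed (simp add: lat.zero)

text \<open>If a root has a multiple in \<open>lat \<theta>\<close>, then so has every root not
  orthogonal to it, as the difference between that multiple and its reflection shows. By
  irreducibility all roots have such multiples, so agreement on \<open>lat \<theta>\<close> is
  agreement on the roots.\<close>

lemma lat_separates:
  assumes t: "\<theta> \<in> \<Phi>" and w: "w \<in> W" "u \<in> W" and eq: "\<And>\<nu>. \<nu> \<in> lat \<theta> \<Longrightarrow> w \<nu> = u \<nu>"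
  shows "w = u"
proof -
  define V where "V = {\<beta> \<in> \<Phi>. \<exists>k. k \<noteq> 0 \<and> zscale k \<beta> \<in> lat \<theta>}"
  have orth: "coroot \<gamma> \<beta> = 0" if b: "\<beta> \<in> V" and c: "\<gamma> \<in> \<Phi> - V" for \<beta> \<gamma>
  proof (rule ccontr)
    assume nz: "coroot \<gamma> \<beta> \<noteq> 0"
    obtain k where k: "k \<noteq> 0" "zscale k \<beta> \<in> lat \<theta>" using b by (auto simp: V_def)
    have "refl \<gamma> (zscale k \<beta>) \<in> lat \<theta>" using lat_W[OF k(2) refl_in_W] c by blast
    then have "- refl \<gamma> (zscale k \<beta>) + zscale k \<beta> \<in> lat \<theta>" using k(2) lat_add lat_minus[OF t] by blast
    then have "zscale (k * coroot \<gamma> \<beta>) \<gamma> \<in> lat \<theta>" using c by (simp add: reflection_def coroot_linear)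
    then have "\<gamma> \<in> V" using nz k c by (auto simp: V_def intro!: exI[of _ "k * coroot \<gamma> \<beta>"])
    with c show False by blast
  qed
  have "0 + id (rt \<theta>) \<in> lat \<theta>" by (rule lat.add[OF lat.zero W.id])
  then have "rt \<theta> \<in> lat \<theta>" by simp
  then have "m \<theta> \<noteq> 0 \<and> zscale (m \<theta>) \<theta> \<in> lat \<theta>" using m_pos[OF t] by (simp add: rt_def)
  then have tV: "\<theta> \<in> V" using t unfolding V_def by blast
  have "\<Phi> - V = {}"
  proof (rule ccontr)
    assume ne: "\<Phi> - V \<noteq> {}"
    have "\<exists>\<Phi>1 \<Phi>2. \<Phi>1 \<noteq> {} \<and> \<Phi>2 \<noteq> {} \<and> \<Phi>1 \<inter> \<Phi>2 = {} \<and> \<Phi>1 \<union> \<Phi>2 = \<Phi> \<and>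
          (\<forall>\<beta>\<in>\<Phi>1. \<forall>\<gamma>\<in>\<Phi>2. coroot \<beta> \<gamma> = 0 \<and> coroot \<gamma> \<beta> = 0)"
    proof (intro exI conjI ballI)
      show "V \<noteq> {}" using tV by blast
      show "\<Phi> - V \<noteq> {}" by (rule ne)
      show "V \<inter> (\<Phi> - V) = {}" by blast
      show "V \<union> (\<Phi> - V) = \<Phi>" unfolding V_def by blast
      fix \<beta> \<gamma> assume "\<beta> \<in> V" "\<gamma> \<in> \<Phi> - V"
      then show "coroot \<gamma> \<beta> = 0" by (rule orth)
      then show "coroot \<beta> \<gamma> = 0" using coroot_eq_0_sym[of \<beta> \<gamma>] \<open>\<beta> \<in> V\<close> \<open>\<gamma> \<in> \<Phi> - V\<close> unfolding V_def by blast
    qed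
    then show False using irreducible unfolding irreducible_roots_def by blast
  qed
  show "w = u"
  proof (rule W_eqI[OF w])
    fix \<beta> assume "\<beta> \<in> \<Phi>"
    then obtain k where k: "k \<noteq> 0" "zscale k \<beta> \<in> lat \<theta>" using \<open>\<Phi> - V = {}\<close> unfolding V_def by blast
    then have "zscale k (w \<beta>) = zscale k (u \<beta>)" using eq[OF k(2)] w by (simp add: W_linear)
    then show "w \<beta> = u \<beta>" using k by (simp add: zscale_cancel_left)
  qed
qed

text \<open>The left operators along two reduced words of one element agree on \<open>e\<^sub>1\<close>, hence, as the right
  operators commute with them and \<open>e\<^sub>1\<close> generates, on all basis elements.\<close>

lemma left_words_agree:
  assumes q: "q \<noteq> 0" and red: "reduced_word as w" "reduced_word bs w"
  obtains \<theta> where "\<theta> \<in> \<Phi>" "\<And>\<nu> u. \<nu> \<in> lat \<theta> \<Longrightarrow> u \<in> W \<Longrightarrow> left_word q as (delta \<nu> u) = left_word q bs (delta \<nu> u)"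
proof -
  obtain \<theta> where t: "\<theta> \<in> \<Phi>"
    and qm: "\<And>\<gamma>. \<gamma> \<in> \<Phi> \<Longrightarrow> 0 < coroot \<theta> \<gamma> \<Longrightarrow> \<gamma> \<in> positive_roots"
      "\<And>\<gamma>. \<gamma> \<in> \<Phi> \<Longrightarrow> 0 < coroot \<theta> \<gamma> \<Longrightarrow> \<gamma> \<noteq> \<theta> \<Longrightarrow> cr \<gamma> \<theta> = 1"
      "\<And>\<gamma>. \<gamma> \<in> \<Phi> \<Longrightarrow> 0 < coroot \<theta> \<gamma> \<Longrightarrow> refl \<theta> \<gamma> \<notin> positive_roots"
    using quasi_minuscule by metis
  \<comment> \<open>The set on which the two words agree. It contains \<open>delta 0 id\<close>, is
    closed under constant combinations, and is stable under all operators that commute with the left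
    ones.\<close>
  define G where "G = {\<phi>. left_word q as \<phi> = left_word q bs \<phi>}"
  have sub: "set as \<subseteq> {1..r}" "set bs \<subseteq> {1..r}" using red by (simp_all add: reduced_word_iff)
  have lin: "(\<lambda>w. const c * \<phi> w + const d * \<psi> w) \<in> G" if "\<phi> \<in> G" "\<psi> \<in> G" for c d \<phi> \<psi>
    using that left_word_linear[OF sub(1)] left_word_linear[OF sub(2)] by (simp add: G_def)
  have comm: "left_word q js (right_op q j \<phi>) = right_op q j (left_word q js \<phi>)"
      "left_word q js (affine_op q \<theta> \<phi>) = affine_op q \<theta> (left_word q js \<phi>)"
    if "set js \<subseteq> {1..r}" "j \<in> {1..r}" for js j \<phi>
    using that(1)
    by (induction js)
      (simp_all add: left_word_simps left_right_commute[OF _ that(2)] left_affine_commute[OF _ t qm])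
  have right: "right_op q j \<phi> \<in> G" if "\<phi> \<in> G" "j \<in> {1..r}" for j \<phi>
    using that comm(1)[OF sub(1)] comm(1)[OF sub(2)] by (simp add: G_def)
  have "{1..r} \<noteq> {}"
  proof
    assume "{1..r} = {}"
    then have "\<Phi> = {}" using root_conj_simple by blast
    then show False using t by blast
  qed
  then obtain j0 where j0: "j0 \<in> {1..r}" by blast
  have aff: "affine_op q \<theta> \<phi> \<in> G" if "\<phi> \<in> G" for \<phi>
    using that comm(2)[OF sub(1) j0] comm(2)[OF sub(2) j0] by (simp add: G_def)
  have step: "delta \<nu> (w \<circ> s j) \<in> G" if d: "delta \<nu> w \<in> G" and w: "w \<in> W" and j: "j \<in> {1..r}" for \<nu> w j
  proof -
    have wj: "w \<circ> s j \<in> W" using w j by (simp add: W_comp)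
    have "(x \<circ> s j) \<circ> s j = x" for x using j by (simp add: fun_eq_iff)
    then have e: "u \<circ> s j = w \<longleftrightarrow> u = w \<circ> s j" for u by metis
    have p: "(w \<circ> s j) (\<alpha> j) \<in> positive_roots \<longleftrightarrow> w (\<alpha> j) \<notin> positive_roots"
      using w j by (simp add: s_simple W_linear minus_positive_iff)
    have ne: "w \<noteq> w \<circ> s j" using p by metis
    show ?thesis
    proof (cases "w (\<alpha> j) \<in> positive_roots")
      case True
      have "right_op q j (delta \<nu> w) = delta \<nu> (w \<circ> s j)"
        using True p wj w ne by (intro ext) (auto simp: right_op_def delta_def e simp del: o_apply)
      then show ?thesis using right[OF d j] by simp
    next
      case False
      have "right_op q j (delta \<nu> w) = (\<lambda>u. const q * delta \<nu> (w \<circ> s j) u - (1 - const q) * delta \<nu> w u)"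
        using False p wj w ne by (intro ext) (auto simp: right_op_def delta_def e simp del: o_apply)
      \<comment> \<open>Solving for the shorter basis element amounts to inverting the right
        operator; this is where q has to be nonzero.\<close>
      then have "delta \<nu> (w \<circ> s j) = (\<lambda>u. const (inverse q) * right_op q j (delta \<nu> w) u + const (inverse q * (1 - q)) * delta \<nu> w u)"
        using q by (intro ext) (simp add: algebra_simps const_diff flip: const_mult mult.assoc)
      then show ?thesis using lin[OF right[OF d j] d] by simp
    qed
  qed
  have all: "delta \<nu> u \<in> G" if d: "delta \<nu> w \<in> G" and w: "w \<in> W" and u: "u \<in> W" for \<nu> w u
  proof -
    have "delta \<nu> (w \<circ> x) \<in> G" if "x \<in> W" for x
      using that
    proof (induction rule: W_right_induct)
      case id
      show ?case using d by (simp add: id_def comp_def)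
    next
      case (step j x)
      then have "delta \<nu> (w \<circ> x) \<in> G" by (simp add: comp_def)
      from \<open>\<And>\<nu> w j. delta \<nu> w \<in> G \<Longrightarrow> w \<in> W \<Longrightarrow> j \<in> {1..r} \<Longrightarrow> delta \<nu> (w \<circ> s j) \<in> G\<close>[OF this W_comp[OF w step(2)] step(1)]
      show ?case by (simp add: comp_def)
    qed
    from this[of "inv w \<circ> u"] have "delta \<nu> (w \<circ> (inv w \<circ> u)) \<in> G" using w u by (simp add: W_comp inv_in_W)
    moreover have "w \<circ> (inv w \<circ> u) = u" using w by (simp add: fun_eq_iff)
    ultimately show ?thesis by simp
  qed
  have "delta \<nu> u \<in> G" if "\<nu> \<in> lat \<theta>" "u \<in> W" for \<nu> u
    using that
  proof (induction arbitrary: u rule: lat.induct)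
    case zero
    have "delta 0 id \<in> G" using left_word_delta[OF red(1)] left_word_delta[OF red(2)] by (simp add: G_def)
    then show ?case using all W.id zero by blast
  next
    case (add \<nu> y)
    \<comment> \<open>On \<open>delta \<nu> ?u'\<close> the affine operator yields a nonzero
      constant times the wanted \<open>delta (\<nu> + y (rt \<theta>)) y\<close>, plus a constant
      multiple of its argument, which is already in \<open>G\<close>.\<close>
    let ?u' = "y \<circ> refl \<theta>"
    have u': "?u' \<in> W" using add t by (simp add: W_comp refl_in_W)
    have rr: "x \<circ> refl \<theta> = ?u' \<longleftrightarrow> x = y" for x
    proof
      assume "x \<circ> refl \<theta> = ?u'"
      then have "(x \<circ> refl \<theta>) (refl \<theta> z) = ?u' (refl \<theta> z)" for z by simp
      then show "x = y" using t by (simp add: fun_eq_iff)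
    qed simp
    have ne: "?u' \<noteq> y"
    proof
      assume "?u' = y"
      then have "y (refl \<theta> \<theta>) = y \<theta>" by (metis o_apply)
      then have "refl \<theta> \<theta> = \<theta>" using W_inj[OF add.hyps(2)] by (simp add: inj_eq)
      then have "zscale 2 \<theta> = 0" using t by (simp add: reflection_def coroot_self)
      then show False using t zero_not_root by auto
    qed
    have p: "?u' \<theta> \<in> positive_roots \<longleftrightarrow> y \<theta> \<notin> positive_roots"
      using add t by (simp add: refl_self W_linear minus_positive_iff)
    have d: "delta \<nu> ?u' \<in> G" using add.IH u' by blast
    define A' where "A' = (if ?u' \<theta> \<in> positive_roots then 0
          else (1 - q) * q ^ ((card {\<delta> \<in> \<Phi>. coroot \<theta> \<delta> \<noteq> 0} div 2 - 1) div 2))"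
    have "affine_op q \<theta> (delta \<nu> ?u') = (\<lambda>x. const (q ^ zeta (y \<theta>)) * delta (\<nu> + y (rt \<theta>)) y x + const A' * delta \<nu> ?u' x)"
    proof
      fix x
      consider "x \<notin> W" | "x \<in> W" "x = y" | "x \<in> W" "x = ?u'" | "x \<in> W" "x \<noteq> y" "x \<noteq> ?u'" by blast
      then show "affine_op q \<theta> (delta \<nu> ?u') x = const (q ^ zeta (y \<theta>)) * delta (\<nu> + y (rt \<theta>)) y x + const A' * delta \<nu> ?u' x"
      proof cases
        case 1
        then show ?thesis using add.hyps(2) u' by (auto simp: affine_op_def delta_def simp del: o_apply)
      next
        case 2
        then show ?thesis using ne add.hyps(2)
          by (simp add: affine_op_def delta_def X_add rt_W const_power mult.commute)
      next
        case 3
        then have "x \<circ> refl \<theta> \<noteq> ?u'" using ne rr by metis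
        then show ?thesis using 3 ne
          by (simp add: affine_op_def delta_def A'_def const_power const_mult const_diff del: o_apply)
      next
        case 4
        then show ?thesis using rr[of x] by (simp add: affine_op_def delta_def)
      qed
    qed
    then have ae: "affine_op q \<theta> (delta \<nu> ?u') x = const (q ^ zeta (y \<theta>)) * delta (\<nu> + y (rt \<theta>)) y x + const A' * delta \<nu> ?u' x" for x
      by simp
    have "const (inverse (q ^ zeta (y \<theta>)) * q ^ zeta (y \<theta>)) = (1 :: 'a ratfun)" using q by simp
    then have i1: "const (inverse (q ^ zeta (y \<theta>))) * const (q ^ zeta (y \<theta>)) = (1 :: 'a ratfun)"
      by (simp only: const_mult)
    have i2: "const (- inverse (q ^ zeta (y \<theta>)) * A') = (- (const (inverse (q ^ zeta (y \<theta>))) * const A') :: 'a ratfun)"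
      by (simp only: mult_minus_left const_minus const_mult)
    have "delta (\<nu> + y (rt \<theta>)) y = (\<lambda>x. const (inverse (q ^ zeta (y \<theta>))) * affine_op q \<theta> (delta \<nu> ?u') x
        + const (- inverse (q ^ zeta (y \<theta>)) * A') * delta \<nu> ?u' x)"
      unfolding ae i2 using i1 by (intro ext) algebra
    then have "delta (\<nu> + y (rt \<theta>)) y \<in> G" using lin[OF aff[OF d] d] by simp
    then show ?case using all add by blast
  qed
  with that t show thesis unfolding G_def by blast
qed

subsection \<open>The standard action\<close>

definition zz :: "complex \<Rightarrow> nat \<Rightarrow> 'a ratfun" where
  "zz q i = - xx i * (1 - const q * xx i) / (1 - xx i)"

lemma sum_W_pairs:
  fixes F :: "('a \<Rightarrow> 'a) \<Rightarrow> 'c::ab_group_add"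
  assumes i: "i \<in> {1..r}"
  shows "(\<Sum>w\<in>W. F w) = (\<Sum>w\<in>{w\<in>W. up i w}. F w + F (s i \<circ> w))"
proof -
  have "W = {w\<in>W. up i w} \<union> {w\<in>W. \<not> up i w}" by blast
  then have "(\<Sum>w\<in>W. F w) = (\<Sum>w\<in>{w\<in>W. up i w}. F w) + (\<Sum>w\<in>{w\<in>W. \<not> up i w}. F w)"
    by (metis (no_types, lifting) sum.union_disjoint finite_W finite_Un disjoint_iff mem_Collect_eq)
  also have "(\<Sum>w\<in>{w\<in>W. \<not> up i w}. F w) = (\<Sum>w\<in>{w\<in>W. up i w}. F (s i \<circ> w))"
  proof (rule sum.reindex_bij_witness[where i = "\<lambda>w. s i \<circ> w" and j = "\<lambda>w. s i \<circ> w"], goal_cases)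
    case (2 w)
    then show ?case using i up_s[OF i, of w] by (simp add: W_comp)
  next
    case (4 w)
    then show ?case using i up_s[OF i, of w] by (simp add: W_comp)
  qed (simp_all only: s_comp_s[OF i])
  finally show ?thesis by (simp add: sum.distrib)
qed

lemma sum_W_shift:
  fixes F :: "('a \<Rightarrow> 'a) \<Rightarrow> 'c::ab_group_add"
  assumes i: "i \<in> {1..r}"
  shows "(\<Sum>w\<in>W. F (s i \<circ> w)) = (\<Sum>w\<in>W. F w)"
proof (rule sum.reindex_bij_witness[where i = "\<lambda>w. s i \<circ> w" and j = "\<lambda>w. s i \<circ> w"], goal_cases)
  case (2 w)
  then show ?case using i by (simp add: W_comp)
next
  case (4 w)
  then show ?case using i by (simp add: W_comp)
qed (simp_all only: s_comp_s[OF i])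

text \<open>If the \<open>N w\<close> transform under \<open>T\<close> like the basis of the Hecke
  module, then forming the sum of \<open>\<phi> w * N w\<close> turns \<open>left_op\<close> into
  \<open>T\<close>. It is used for multiples of \<open>Delta_q q\<close>, for the functions T_w f,
  and for the \<open>basis_vec\<close>; in the last case \<open>S\<close> restricts the scalars to
  degree 0.\<close>

lemma intertwine:
  assumes i: "i \<in> {1..r}"
    and T_sum: "\<And>h. T (\<Sum>w\<in>W. h w) = (\<Sum>w\<in>W. T (h w))"
    and bernstein: "\<And>h f. h \<in> S \<Longrightarrow> T (h * f) = act (s i) h * T f + cc q i * (h - act (s i) h) * f"
    and N_up: "\<And>w. w \<in> W \<Longrightarrow> up i w \<Longrightarrow> T (N w) = N (s i \<circ> w)"
    and N_down: "\<And>w. w \<in> W \<Longrightarrow> \<not> up i w \<Longrightarrow> T (N w) = const q * N (s i \<circ> w) - (1 - const q) * N w"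
    and S: "\<And>w. w \<in> W \<Longrightarrow> \<phi> w \<in> S"
  shows "T (\<Sum>w\<in>W. \<phi> w * N w) = (\<Sum>w\<in>W. left_op q i \<phi> w * N w)"
proof -
  have "T (\<Sum>w\<in>W. \<phi> w * N w) = (\<Sum>w\<in>W. act (s i) (\<phi> w) * T (N w) + cc q i * (\<phi> w - act (s i) (\<phi> w)) * N w)"
    unfolding T_sum using bernstein S by (intro sum.cong) auto
  also have "\<dots> = (\<Sum>w\<in>W. left_op q i \<phi> w * N w)"
    unfolding sum_W_pairs[OF i]
  proof (rule sum.cong[OF refl], goal_cases)
    case (1 w)
    then have w: "w \<in> W" "up i w" "s i \<circ> w \<in> W" "\<not> up i (s i \<circ> w)" using i up_s by (auto simp: W_comp)
    show ?case
      unfolding N_up[OF w(1,2)] N_down[OF w(3,4)] s_comp_s[OF i] left_op_def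
      using w by (simp add: s_comp_s[OF i] algebra_simps)
  qed
  finally show ?thesis .
qed

definition Delta_q :: "complex \<Rightarrow> 'a ratfun" where
  "Delta_q q = (\<Prod>\<beta>\<in>positive_roots. 1 - const q * X (rt \<beta>))"

lemma factor_neq_0: "\<beta> \<in> \<Phi> \<Longrightarrow> 1 - const q * X (rt \<beta>) \<noteq> 0"
  using const_X_eq_1[of q "rt \<beta>"] rt_neq_0 by simp

lemma Delta_q_neq_0: "Delta_q q \<noteq> 0"
  unfolding Delta_q_def using factor_neq_0 by (subst prod_zero_iff) auto

lemma act_Delta_q:
  assumes i: "i \<in> {1..r}"
  shows "act (s i) (Delta_q q) = Delta_q q * (1 - const q / xx i) / (1 - const q * xx i)"
proof -
  let ?f = "\<lambda>\<beta>. 1 - const q * X (rt \<beta>)"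
  have D: "Delta_q q = ?f (\<alpha> i) * (\<Prod>\<beta>\<in>positive_roots - {\<alpha> i}. ?f \<beta>)"
    unfolding Delta_q_def using i by (intro prod.remove) auto
  have "act (s i) (\<Prod>\<beta>\<in>positive_roots - {\<alpha> i}. ?f \<beta>) = (\<Prod>\<beta>\<in>positive_roots - {\<alpha> i}. ?f (s i \<beta>))"
    using i by (simp add: act_prod act_simps rt_W)
  also have "\<dots> = (\<Prod>\<beta>\<in>positive_roots - {\<alpha> i}. ?f \<beta>)"
    by (rule prod.reindex_bij_witness[where i = "s i" and j = "s i"]) (use s_pos_diff[OF i] i in auto)
  finally have "act (s i) (Delta_q q) = (1 - const q / xx i) * (\<Prod>\<beta>\<in>positive_roots - {\<alpha> i}. ?f \<beta>)"
    unfolding D using i by (simp add: act_simps rt_W s_simple rt_minus X_minus xx_def divide_inverse)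
  moreover have "1 - const q * xx i \<noteq> 0" unfolding xx_def using i by (intro factor_neq_0) simp
  moreover have "Delta_q q = (1 - const q * xx i) * (\<Prod>\<beta>\<in>positive_roots - {\<alpha> i}. ?f \<beta>)"
    unfolding D xx_def ..
  ultimately show ?thesis by simp
qed

definition T_std :: "complex \<Rightarrow> nat \<Rightarrow> 'a ratfun \<Rightarrow> 'a ratfun" where
  "T_std q i f = cc q i * f + zz q i * act (s i) f"

lemma T_std_sum: "i \<in> {1..r} \<Longrightarrow> T_std q i (sum h A) = (\<Sum>a\<in>A. T_std q i (h a))"
  by (simp add: T_std_def act_simps sum_distrib_left sum.distrib)

lemma T_std_mult: "i \<in> {1..r} \<Longrightarrow> T_std q i (h * f) = act (s i) h * T_std q i f + cc q i * (h - act (s i) h) * f"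
  by (simp add: T_std_def act_simps algebra_simps)

text \<open>This realises the trivial character of the Hecke algebra, which allows the basis element
  at \<open>w\<close> to be represented by \<open>const q ^ ell w * Delta_q q\<close>.\<close>

lemma T_std_Delta_q: "i \<in> {1..r} \<Longrightarrow> T_std q i (Delta_q q) = const q * Delta_q q"
proof -
  assume i: "i \<in> {1..r}"
  have "1 - const q * xx i \<noteq> 0" unfolding xx_def using i by (intro factor_neq_0) simp
  moreover have "xx i \<noteq> 0" "1 - xx i \<noteq> 0" using i by simp_all
  ultimately show ?thesis
    unfolding T_std_def act_Delta_q[OF i] zz_def cc_def by (simp add: divide_simps) algebra
qed

lemma T_std_word:
  assumes "set js \<subseteq> {1..r}"
  shows "foldr (T_std q) js (\<Sum>w\<in>W. \<phi> w * (const q ^ ell w * Delta_q q)) =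
    (\<Sum>w\<in>W. left_word q js \<phi> w * (const q ^ ell w * Delta_q q))"
  using assms
proof (induction js)
  case (Cons i js)
  then have i: "i \<in> {1..r}" by simp
  have c: "act (s i) (const q ^ k) = const q ^ k" for k using i by (simp add: act_simps)
  have T: "T_std q i (const q ^ k * Delta_q q) = const q * (const q ^ k * Delta_q q)" for k
    unfolding T_std_mult[OF i] c T_std_Delta_q[OF i] by (simp add: algebra_simps)
  have "T_std q i (\<Sum>w\<in>W. left_word q js \<phi> w * (const q ^ ell w * Delta_q q)) =
    (\<Sum>w\<in>W. left_op q i (left_word q js \<phi>) w * (const q ^ ell w * Delta_q q))"
  proof (rule intertwine[OF i, where S = UNIV])
    fix w assume w: "w \<in> W"
    show "T_std q i (const q ^ ell w * Delta_q q) = const q ^ ell (s i \<circ> w) * Delta_q q" if "up i w"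
      unfolding T ell_s_up[OF i w that] by simp
    show "T_std q i (const q ^ ell w * Delta_q q) =
      const q * (const q ^ ell (s i \<circ> w) * Delta_q q) - (1 - const q) * (const q ^ ell w * Delta_q q)" if "\<not> up i w"
      unfolding T ell_s_down[OF i w that] by (simp add: algebra_simps)
  qed (simp_all add: T_std_sum[OF i] T_std_mult[OF i])
  then show ?case using Cons by (simp add: left_word_simps)
qed (simp add: left_word_simps)

section \<open>Expansion of composites in the group elements\<close>

definition coef_op :: "(nat \<Rightarrow> 'a ratfun) \<Rightarrow> (nat \<Rightarrow> 'a ratfun) \<Rightarrow> nat \<Rightarrow> (('a \<Rightarrow> 'a) \<Rightarrow> 'a ratfun) \<Rightarrow> ('a \<Rightarrow> 'a) \<Rightarrow> 'a ratfun" where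
  "coef_op c z i \<rho> w = (if w \<in> W then c i * \<rho> w + z i * act (s i) (\<rho> (s i \<circ> w)) else 0)"

text \<open>The coefficients of a composite of operators \<open>c\<^sub>i + z\<^sub>i \<sigma>\<^sub>i\<close> with respect to the \<open>\<sigma>\<^sub>w\<close>.\<close>

definition coef :: "(nat \<Rightarrow> 'a ratfun) \<Rightarrow> (nat \<Rightarrow> 'a ratfun) \<Rightarrow> nat list \<Rightarrow> ('a \<Rightarrow> 'a) \<Rightarrow> 'a ratfun" where
  "coef c z js = foldr (coef_op c z) js (delta 0 id)"

lemma coef_simps: "coef c z [] = delta 0 id" "coef c z (i # js) = coef_op c z i (coef c z js)"
  by (simp_all add: coef_def)

text \<open>Stated for an abstract family \<open>A\<close>, so that it covers the permutation action
  and the metaplectic one; \<open>S\<close> holds the scalars over which \<sigma> is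
  semilinear.\<close>

lemma expand_word:
  assumes A_id: "\<And>f. A id f = f"
    and A_s: "\<And>i w f. i \<in> {1..r} \<Longrightarrow> w \<in> W \<Longrightarrow> A (s i \<circ> w) f = \<sigma> i (A w f)"
    and \<sigma>_sum: "\<And>i h. i \<in> {1..r} \<Longrightarrow> \<sigma> i (\<Sum>w\<in>W. h w) = (\<Sum>w\<in>W. \<sigma> i (h w))"
    and \<sigma>_mult: "\<And>i h f. i \<in> {1..r} \<Longrightarrow> h \<in> S \<Longrightarrow> \<sigma> i (h * f) = act (s i) h * \<sigma> i f"
    and S: "0 \<in> S" "1 \<in> S" "\<And>f h. f \<in> S \<Longrightarrow> h \<in> S \<Longrightarrow> f + h \<in> S" "\<And>f h. f \<in> S \<Longrightarrow> h \<in> S \<Longrightarrow> f * h \<in> S"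
      "\<And>i h. i \<in> {1..r} \<Longrightarrow> h \<in> S \<Longrightarrow> act (s i) h \<in> S" "\<And>i. i \<in> {1..r} \<Longrightarrow> c i \<in> S \<and> z i \<in> S"
    and js: "set js \<subseteq> {1..r}"
  shows "(\<forall>w. coef c z js w \<in> S) \<and> foldr (\<lambda>i f. c i * f + z i * \<sigma> i f) js f = (\<Sum>w\<in>W. coef c z js w * A w f)"
  using js
proof (induction js)
  case Nil
  have "(\<Sum>w\<in>W. delta 0 id w * A w f) = (\<Sum>w\<in>{id}. delta 0 id w * A w f)"
    using W.id by (intro sum.mono_neutral_right) (auto simp: delta_def)
  then show ?case using S(1,2) A_id by (simp add: coef_simps) (simp add: delta_def)
next
  case (Cons i js)
  then have i: "i \<in> {1..r}" and IH: "\<And>w. coef c z js w \<in> S"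
    "foldr (\<lambda>i f. c i * f + z i * \<sigma> i f) js f = (\<Sum>w\<in>W. coef c z js w * A w f)" by auto
  let ?\<rho> = "coef c z js"
  have "\<sigma> i (\<Sum>w\<in>W. ?\<rho> w * A w f) = (\<Sum>w\<in>W. act (s i) (?\<rho> w) * A (s i \<circ> w) f)"
    unfolding \<sigma>_sum[OF i] using \<sigma>_mult[OF i IH(1)] A_s[OF i] by (intro sum.cong) auto
  also have "\<dots> = (\<Sum>w\<in>W. act (s i) (?\<rho> (s i \<circ> w)) * A w f)"
    using sum_W_shift[OF i, of "\<lambda>w. act (s i) (?\<rho> (s i \<circ> w)) * A w f"] by (simp only: s_comp_s[OF i])
  finally have "foldr (\<lambda>i f. c i * f + z i * \<sigma> i f) (i # js) f = (\<Sum>w\<in>W. coef c z (i # js) w * A w f)"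
    by (simp add: IH(2) coef_simps coef_op_def sum_distrib_left sum.distrib distrib_right mult.assoc cong: sum.cong)
  moreover have "coef c z (i # js) w \<in> S" for w
    using S IH(1) i by (simp add: coef_simps coef_op_def)
  ultimately show ?case by blast
qed

lemma expand_std:
  assumes "set js \<subseteq> {1..r}"
  shows "foldr (\<lambda>i f. c i * f + z i * act (s i) f) js f = (\<Sum>w\<in>W. coef c z js w * act w f)"
proof (rule expand_word[where A = act and \<sigma> = "\<lambda>i. act (s i)" and S = UNIV, THEN conjunct2])
  show "act id f = f" for f by (rule act_id)
  show "act (s i \<circ> w) f = act (s i) (act w f)" if "i \<in> {1..r}" "w \<in> W" for i w f
    by (rule act_comp[OF s_in_W[OF that(1)] that(2)])
qed (simp_all add: assms act_simps)

lemma coef_outside: "w \<notin> W \<Longrightarrow> coef c z js w = 0"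
  using W.id by (cases js) (auto simp: coef_simps coef_op_def delta_def)

text \<open>For \<nu> in \<open>lat \<theta>\<close> the function \<open>X \<nu> * Delta_q q\<close>
  is the image of \<open>delta \<nu> id\<close>, so both words give the same result on it. The maps
  from \<nu> to \<open>X (u \<nu>)\<close> are distinct characters of \<open>lat \<theta>\<close>,
  and their independence separates the coefficients.\<close>

lemma coef_T_unique:
  assumes q: "q \<noteq> 0" and red: "reduced_word as w" "reduced_word bs w"
  shows "coef (cc q) (zz q) as = coef (cc q) (zz q) bs"
proof
  fix u
  have sub: "set as \<subseteq> {1..r}" "set bs \<subseteq> {1..r}" using red by (simp_all add: reduced_word_iff)
  obtain \<theta> where t: "\<theta> \<in> \<Phi>"
    and agree: "\<And>\<nu> u. \<nu> \<in> lat \<theta> \<Longrightarrow> u \<in> W \<Longrightarrow> left_word q as (delta \<nu> u) = left_word q bs (delta \<nu> u)"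
    using left_words_agree[OF assms] by metis
  have T: "foldr (T_std q) js (X \<nu> * Delta_q q) = (\<Sum>w\<in>W. left_word q js (delta \<nu> id) w * (const q ^ ell w * Delta_q q))"
    if "set js \<subseteq> {1..r}" for js \<nu>
  proof -
    have "(\<Sum>w\<in>W. delta \<nu> id w * (const q ^ ell w * Delta_q q)) = (\<Sum>w\<in>{id}. delta \<nu> id w * (const q ^ ell w * Delta_q q))"
      using W.id by (intro sum.mono_neutral_right) (auto simp: delta_def)
    also have "\<dots> = X \<nu> * Delta_q q" using ell_id by (simp add: delta_def)
    finally show ?thesis using T_std_word[OF that, of q "delta \<nu> id"] by simp
  qed
  have E: "foldr (T_std q) js f = (\<Sum>w\<in>W. coef (cc q) (zz q) js w * act w f)" if "set js \<subseteq> {1..r}" for js f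
    using expand_std[OF that, of "cc q" "zz q" f] by (simp add: T_std_def[abs_def])
  have eq: "(\<Sum>w\<in>W. ((coef (cc q) (zz q) as w - coef (cc q) (zz q) bs w) * act w (Delta_q q)) * X (w \<nu>)) = 0"
    if "\<nu> \<in> lat \<theta>" for \<nu>
  proof -
    have "foldr (T_std q) as (X \<nu> * Delta_q q) = foldr (T_std q) bs (X \<nu> * Delta_q q)"
      unfolding T[OF sub(1)] T[OF sub(2)] agree[OF that W.id] ..
    then have "(\<Sum>w\<in>W. coef (cc q) (zz q) as w * act w (X \<nu> * Delta_q q)) - (\<Sum>w\<in>W. coef (cc q) (zz q) bs w * act w (X \<nu> * Delta_q q)) = 0"
      unfolding E[OF sub(1)] E[OF sub(2)] by simp
    then show ?thesis unfolding sum_subtractf[symmetric]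
      by (simp add: act_simps algebra_simps cong: sum.cong)
  qed
  show "coef (cc q) (zz q) as u = coef (cc q) (zz q) bs u"
  proof (cases "u \<in> W")
    case True
    have "(coef (cc q) (zz q) as u - coef (cc q) (zz q) bs u) * act u (Delta_q q) = 0"
    proof (rule characters_independent[where A = W and L = "lat \<theta>" and \<chi> = "\<lambda>w \<nu>. X (w \<nu>)"
          and d = "\<lambda>w. (coef (cc q) (zz q) as w - coef (cc q) (zz q) bs w) * act w (Delta_q q)"])
      show "\<exists>x\<in>lat \<theta>. X (w x) \<noteq> (0 :: 'a ratfun)" for w using lat.zero by force
      show "\<exists>x\<in>lat \<theta>. X (w x) \<noteq> (X (u x) :: 'a ratfun)" if "w \<in> W" "u \<in> W" "w \<noteq> u" for w u
        using lat_separates[OF t that(1,2)] that(3) by auto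
      show "X (w (x + y)) = X (w x) * (X (w y) :: 'a ratfun)" if "w \<in> W" for w x y
        using that by (simp add: W_add X_add)
      show "x + y \<in> lat \<theta>" if "x \<in> lat \<theta>" "y \<in> lat \<theta>" for x y using lat_add[OF that(2,1)] .
    qed (fact finite_W eq True)+
    then show ?thesis using act_eq_0[OF True] Delta_q_neq_0 by simp
  qed (simp add: coef_outside)
qed

subsection \<open>Coefficients of the Demazure and Demazure-Lusztig operators\<close>

lemma poly_act: "w \<in> W \<Longrightarrow> act w (poly p (const q)) = poly (map_poly (act w) p) (const q)"
  by (induction p) (simp_all add: map_poly_pCons act_simps)

lemma coef_T_poly:
  assumes "set js \<subseteq> {1..r}"
  shows "\<exists>p. \<forall>q. coef (cc q) (zz q) js u = poly p (const q)"
  using assms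
proof (induction js arbitrary: u)
  case Nil
  show ?case by (intro exI[of _ "[:delta 0 id u:]"]) (simp add: coef_simps)
next
  case (Cons i js)
  then have i: "i \<in> {1..r}" and js: "set js \<subseteq> {1..r}" by auto
  obtain p1 where p1: "\<And>q. coef (cc q) (zz q) js u = poly p1 (const q)" using Cons.IH[OF js] by blast
  obtain p2 where p2: "\<And>q. coef (cc q) (zz q) js (s i \<circ> u) = poly p2 (const q)" using Cons.IH[OF js] by blast
  let ?y = "xx i / (1 - xx i)"
  have c: "cc q i = poly [:?y, - ?y:] (const q)" and z: "zz q i = poly [:- ?y, ?y * xx i:] (const q)" for q
    by (simp_all add: cc_def zz_def diff_divide_distrib algebra_simps)
  show ?case
  proof (cases "u \<in> W")
    case True
    show ?thesis
      by (rule exI[of _ "[:?y, - ?y:] * p1 + [:- ?y, ?y * xx i:] * map_poly (act (s i)) p2"])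
        (use True i in \<open>simp only: coef_simps coef_op_def p1 p2 c z poly_mult poly_add poly_act[OF s_in_W] if_True simp_thms\<close>)
  next
    case False
    then show ?thesis by (intro exI[of _ 0]) (simp add: coef_simps coef_op_def)
  qed
qed

text \<open>The module used for \<open>coef_T_unique\<close> degenerates at \<open>q = 0\<close>; this case follows since the coefficients
  are polynomials in \<open>q\<close>.\<close>

lemma coef_T_unique':
  assumes red: "reduced_word as w" "reduced_word bs w"
  shows "coef (cc q) (zz q) as = coef (cc q) (zz q) bs"
proof
  fix u
  have sub: "set as \<subseteq> {1..r}" "set bs \<subseteq> {1..r}" using red by (simp_all add: reduced_word_iff)
  obtain p where p: "\<And>q. coef (cc q) (zz q) as u = poly p (const q)" using coef_T_poly[OF sub(1)] by blast
  obtain p' where p': "\<And>q. coef (cc q) (zz q) bs u = poly p' (const q)" using coef_T_poly[OF sub(2)] by blast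
  have "const q \<in> {x. poly (p - p') x = 0}" if "q \<noteq> 0" for q
    using coef_T_unique[OF that assms] p[of q] p'[of q] by simp
  then have "const ` (UNIV - {0}) \<subseteq> {x. poly (p - p') x = 0}" by auto
  moreover have "infinite (const ` (UNIV - {0} :: complex set) :: 'a ratfun set)"
    using infinite_UNIV_char_0[where 'a = complex] by (subst finite_image_iff) (auto simp: inj_on_def)
  ultimately have "infinite {x. poly (p - p') x = 0}" using finite_subset by blast
  then have "p - p' = 0" using poly_roots_finite[of "p - p'"] by blast
  then show "coef (cc q) (zz q) as u = coef (cc q) (zz q) bs u" using p p' by simp
qed

section \<open>Multiplication rules for the coefficients of the T_w\<close>

definition T_coef :: "complex \<Rightarrow> ('a \<Rightarrow> 'a) \<Rightarrow> ('a \<Rightarrow> 'a) \<Rightarrow> 'a ratfun" where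
  "T_coef q w = coef (cc q) (zz q) (SOME js. reduced_word js w)"

lemma T_coef_word: "reduced_word js w \<Longrightarrow> coef (cc q) (zz q) js = T_coef q w"
  unfolding T_coef_def by (rule coef_T_unique') (auto intro: someI)

lemma T_coef_id: "T_coef q id = delta 0 id"
  using T_coef_word[of "[]" id q] ell_id by (simp add: reduced_word_iff coef_simps)

lemma T_coef_up:
  assumes "i \<in> {1..r}" "w \<in> W" "up i w"
  shows "coef_op (cc q) (zz q) i (T_coef q w) = T_coef q (s i \<circ> w)"
proof -
  obtain js where js: "reduced_word js w" using ex_reduced_word[OF assms(2)] by blast
  then have "word_prod js = w" by (simp add: reduced_word_iff)
  then have "reduced_word (i # js) (s i \<circ> w)" unfolding reduced_word_Cons using assms js by simp
  then show ?thesis using T_coef_word[OF js, of q] T_coef_word[of "i # js" "s i \<circ> w" q] by (simp only: coef_simps)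
qed

text \<open>The Hecke relation with eigenvalues q and -1. It reduces to two rational identities
  between \<open>cc\<close>, \<open>zz\<close> and their reflections.\<close>

lemma coef_op_quadratic:
  assumes i: "i \<in> {1..r}" and w: "w \<in> W"
  shows "coef_op (cc q) (zz q) i (coef_op (cc q) (zz q) i \<rho>) w
    = const q * \<rho> w - (1 - const q) * coef_op (cc q) (zz q) i \<rho> w"
proof -
  have x: "xx i \<noteq> 0" "1 - xx i \<noteq> 0" using i by simp_all
  have sw: "s i \<circ> w \<in> W" using i w by (simp add: W_comp)
  have a: "act (s i) (cc q i) = - (1 - const q) - cc q i"
    "act (s i) (zz q i) * zz q i = const q - (1 - const q) * cc q i - cc q i * cc q i"
    using i x by (simp_all add: cc_def zz_def act_simps) (simp_all add: divide_simps, algebra+)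
  have "coef_op (cc q) (zz q) i (coef_op (cc q) (zz q) i \<rho>) w = cc q i * (cc q i * \<rho> w + zz q i * act (s i) (\<rho> (s i \<circ> w)))
    + zz q i * (act (s i) (cc q i) * act (s i) (\<rho> (s i \<circ> w)) + act (s i) (zz q i) * \<rho> w)"
    using w sw i s_comp_s[OF i, of w] by (simp add: coef_op_def act_simps)
  also have "\<dots> = const q * \<rho> w - (1 - const q) * (cc q i * \<rho> w + zz q i * act (s i) (\<rho> (s i \<circ> w)))"
    using a by algebra
  finally show ?thesis using w by (simp add: coef_op_def)
qed

lemma T_coef_down:
  assumes i: "i \<in> {1..r}" and w: "w \<in> W" "\<not> up i w" and u: "u \<in> W"
  shows "coef_op (cc q) (zz q) i (T_coef q w) u = const q * T_coef q (s i \<circ> w) u - (1 - const q) * T_coef q w u"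
proof -
  have sw: "s i \<circ> w \<in> W" "up i (s i \<circ> w)" using i w up_s[OF i] by (simp_all add: W_comp)
  have "T_coef q w = coef_op (cc q) (zz q) i (T_coef q (s i \<circ> w))"
    using T_coef_up[OF i sw, of q] s_comp_s[OF i, of w] by simp
  then show ?thesis using coef_op_quadratic[OF i u, of q "T_coef q (s i \<circ> w)"] by simp
qed

lemma coef_op_sum:
  assumes "i \<in> {1..r}"
  shows "coef_op c z i (\<lambda>u. \<Sum>a\<in>A. h a u) u = (\<Sum>a\<in>A. coef_op c z i (h a) u)"
  using assms by (simp add: coef_op_def act_simps sum_distrib_left sum.distrib)

text \<open>On each pair \<open>w\<close>, \<open>s i \<circ> w\<close> the multiplication rules
  make T_w + T_{s_i w} an eigenvector.\<close>

lemma T_coef_sum: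
  assumes i: "i \<in> {1..r}" and u: "u \<in> W"
  shows "coef_op (cc q) (zz q) i (\<lambda>u. \<Sum>w\<in>W. T_coef q w u) u = const q * (\<Sum>w\<in>W. T_coef q w u)"
  unfolding coef_op_sum[OF i] unfolding sum_W_pairs[OF i] sum_distrib_left
proof (rule sum.cong[OF refl], goal_cases)
  case (1 w)
  then have w: "w \<in> W" "up i w" "s i \<circ> w \<in> W" "\<not> up i (s i \<circ> w)" using i up_s by (auto simp: W_comp)
  show ?case
    unfolding T_coef_up[OF i w(1,2)] T_coef_down[OF i w(3,4) u] s_comp_s[OF i] by (simp add: algebra_simps)
qed

text \<open>Each letter raises the length of the elements involved by at most one, and the maximal
  length can be reached only by taking the reflection at every letter.\<close>

lemma coef_support:
  assumes "set js \<subseteq> {1..r}" "u \<noteq> word_prod js" "length js \<le> ell u"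
  shows "coef c z js u = 0"
  using assms
proof (induction js arbitrary: u)
  case Nil
  then show ?case by (simp add: coef_simps delta_def id_def)
next
  case (Cons i js)
  have i: "i \<in> {1..r}" and js: "set js \<subseteq> {1..r}" using Cons.prems by auto
  show ?case
  proof (cases "u \<in> W")
    case u: True
    have "u \<noteq> word_prod js" using ell_word_le[OF js] Cons.prems(3) by auto
    then have 1: "coef c z js u = 0" using Cons.IH[OF js] Cons.prems(3) by simp
    have "s i \<circ> u \<noteq> word_prod js" using Cons.prems(2) s_comp_eq_iff[OF i] by (metis word_prod_simps(2))
    moreover have "length js \<le> ell (s i \<circ> u)"
      using ell_s_up[OF i u] ell_s_down[OF i u] Cons.prems(3) by (cases "up i u") simp_all
    ultimately have "coef c z js (s i \<circ> u) = 0" by (rule Cons.IH[OF js])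
    then show ?thesis using 1 i by (simp add: coef_simps coef_op_def act_simps)
  next
    case False
    then show ?thesis by (rule coef_outside)
  qed
qed

lemma T_coef_support:
  assumes "w \<in> W" "u \<noteq> w" "ell w \<le> ell u"
  shows "T_coef q w u = 0"
proof -
  obtain js where js: "reduced_word js w" using ex_reduced_word[OF assms(1)] by blast
  then have "coef (cc q) (zz q) js u = 0"
    using assms by (intro coef_support) (simp_all add: reduced_word_iff)
  then show ?thesis by (simp only: T_coef_word[OF js])
qed

definition left_invs :: "('a \<Rightarrow> 'a) \<Rightarrow> 'a set" where
  "left_invs w = {\<beta> \<in> positive_roots. inv w \<beta> \<notin> positive_roots}"

lemma left_invs_up:
  assumes i: "i \<in> {1..r}" and w: "w \<in> W" "up i w"
  shows "left_invs (s i \<circ> w) = insert (\<alpha> i) (s i ` left_invs w)" "\<alpha> i \<notin> s i ` left_invs w"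
proof -
  have n: "\<alpha> i \<notin> left_invs w" using w by (simp add: left_invs_def up_def)
  have *: "s i \<beta> \<in> positive_roots - {\<alpha> i}" if "\<beta> \<in> left_invs w" for \<beta>
  proof -
    have "\<beta> \<in> positive_roots - {\<alpha> i}" using that n unfolding left_invs_def by blast
    then show ?thesis by (rule s_pos_diff[OF i])
  qed
  show "\<alpha> i \<notin> s i ` left_invs w"
  proof
    assume "\<alpha> i \<in> s i ` left_invs w"
    then obtain \<beta> where "\<beta> \<in> left_invs w" "\<alpha> i = s i \<beta>" by blast
    with *[of \<beta>] show False by simp
  qed
  have inv: "inv (s i \<circ> w) \<beta> = inv w (s i \<beta>)" for \<beta> by (rule inv_comp_s[OF i w(1)])
  show "left_invs (s i \<circ> w) = insert (\<alpha> i) (s i ` left_invs w)"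
  proof (intro set_eqI iffI)
    fix \<beta> assume b: "\<beta> \<in> left_invs (s i \<circ> w)"
    show "\<beta> \<in> insert (\<alpha> i) (s i ` left_invs w)"
    proof (cases "\<beta> = \<alpha> i")
      case False
      then have "s i \<beta> \<in> positive_roots" using b s_positive[OF i] unfolding left_invs_def by blast
      then have "s i \<beta> \<in> left_invs w" using b inv unfolding left_invs_def by simp
      then have "s i (s i \<beta>) \<in> s i ` left_invs w" by blast
      then show ?thesis using i by simp
    qed simp
  next
    fix \<beta> assume b: "\<beta> \<in> insert (\<alpha> i) (s i ` left_invs w)"
    show "\<beta> \<in> left_invs (s i \<circ> w)"
    proof (cases "\<beta> = \<alpha> i")
      case True
      then show ?thesis using i w n inv[of "\<alpha> i"]
        by (simp add: left_invs_def up_def s_simple W_linear inv_in_W minus_positive_iff)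
    next
      case False
      then obtain \<gamma> where g: "\<gamma> \<in> left_invs w" "\<beta> = s i \<gamma>" using b by blast
      then show ?thesis using *[OF g(1)] inv[of \<beta>] i by (simp add: left_invs_def)
    qed
  qed
qed

text \<open>Only the \<open>zz\<close> terms reach the diagonal, and \<open>zz q i\<close> is
  \<open>1 - const q * xx i\<close> times \<open>zz 0 i\<close>. Transported by the letters further
  out, these factors run over the left inversions of \<open>w\<close>; for the longest element they
  multiply to \<open>Delta_q q\<close>.\<close>

lemma T_coef_diagonal:
  assumes "w \<in> W"
  shows "T_coef q w w = (\<Prod>\<beta>\<in>left_invs w. 1 - const q * X (rt \<beta>)) * T_coef 0 w w \<and> T_coef 0 w w \<noteq> 0"
  using assms
proof (induction rule: W_induct)
  case id
  have "left_invs id = {}" unfolding left_invs_def inv_id by simp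
  then show ?case using T_coef_id by (simp add: delta_def id_def)
next
  case (step i w)
  note i = step(1) and w = step(2,3)
  let ?f = "\<lambda>\<beta>. 1 - const q * X (rt \<beta>)"
  have sw: "s i \<circ> w \<in> W" using i w by (simp add: W_comp)
  have "s i \<circ> w \<noteq> w" using ell_s_up[OF i w] by (metis n_not_Suc_n)
  then have z: "T_coef p w (s i \<circ> w) = 0" for p
    using T_coef_support[OF w(1)] ell_s_up[OF i w] by simp
  have d: "T_coef p (s i \<circ> w) (s i \<circ> w) = zz p i * act (s i) (T_coef p w w)" for p
    using T_coef_up[OF i w, of p, symmetric] z[of p] sw s_comp_s[OF i, of w] by (simp add: coef_op_def)
  have zz: "zz q i = ?f (\<alpha> i) * zz 0 i" by (simp add: zz_def xx_def)
  have z0: "zz 0 i \<noteq> 0" using i by (simp add: zz_def)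
  have fin: "finite (left_invs w)" unfolding left_invs_def by simp
  have inj: "inj_on (s i) (left_invs w)" using W_inj[OF s_in_W[OF i]] by (simp add: inj_on_def)
  have "act (s i) (\<Prod>\<beta>\<in>left_invs w. ?f \<beta>) = (\<Prod>\<beta>\<in>left_invs w. ?f (s i \<beta>))"
    using i by (simp add: act_prod act_simps rt_W)
  also have "\<dots> = (\<Prod>\<beta>\<in>s i ` left_invs w. ?f \<beta>)" using inj by (simp add: prod.reindex)
  finally have "(\<Prod>\<beta>\<in>left_invs (s i \<circ> w). ?f \<beta>) = ?f (\<alpha> i) * act (s i) (\<Prod>\<beta>\<in>left_invs w. ?f \<beta>)"
    unfolding left_invs_up(1)[OF i w] using left_invs_up(2)[OF i w] fin by simp
  moreover have "T_coef q w w = (\<Prod>\<beta>\<in>left_invs w. ?f \<beta>) * T_coef 0 w w" and nz: "T_coef 0 w w \<noteq> 0"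
    using step.IH by blast+
  ultimately have "T_coef q (s i \<circ> w) (s i \<circ> w) = (\<Prod>\<beta>\<in>left_invs (s i \<circ> w). ?f \<beta>) * T_coef 0 (s i \<circ> w) (s i \<circ> w)"
    unfolding d zz using i by (simp add: act_mult)
  moreover have "T_coef 0 (s i \<circ> w) (s i \<circ> w) \<noteq> 0"
    unfolding d using nz z0 i by (simp add: act_eq_0)
  ultimately show ?case by blast
qed

lemma T_coef_diagonal_neq_0: "w \<in> W \<Longrightarrow> T_coef q w w \<noteq> 0"
proof -
  assume w: "w \<in> W"
  have "finite (left_invs w)" "\<And>\<beta>. \<beta> \<in> left_invs w \<Longrightarrow> 1 - const q * X (rt \<beta>) \<noteq> 0"
    using factor_neq_0[OF positive_root] by (simp_all add: left_invs_def)
  then have "(\<Prod>\<beta>\<in>left_invs w. 1 - const q * X (rt \<beta>)) \<noteq> 0" by (subst prod_zero_iff) blast+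
  then show ?thesis using T_coef_diagonal[OF w, of q] by simp
qed

lemma all_down_negative:
  assumes w: "w \<in> W" "\<And>i. i \<in> {1..r} \<Longrightarrow> \<not> up i w" and b: "\<beta> \<in> positive_roots"
  shows "inv w \<beta> \<notin> positive_roots"
proof -
  obtain c where c: "\<beta> = comb c" "\<forall>i\<in>{1..r}. 0 \<le> c i" using b unfolding positive_iff cone_def by blast
  have "- inv w (\<alpha> i) \<in> cone" if "i \<in> {1..r}" for i
    using w(2)[OF that] not_up[OF that w(1)] by (simp add: positive_iff)
  then have "(\<Sum>i=1..r. zscale (c i) (- inv w (\<alpha> i))) \<in> cone"
    using c by (intro cone_sum cone_zscale) auto
  then have "- inv w \<beta> \<in> cone"
    using w by (simp add: c comb_def W_simps inv_in_W zscale_minus_right sum_negf)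
  then show ?thesis using minus_positive_iff[of "inv w \<beta>"] w b by (simp add: positive_iff inv_in_W)
qed

text \<open>Both elements exchange positive and negative roots, so their quotient keeps positive
  roots positive and has length 0.\<close>

lemma longest_unique:
  assumes w: "w \<in> W" "\<And>i. i \<in> {1..r} \<Longrightarrow> \<not> up i w" and u: "u \<in> W" "\<And>i. i \<in> {1..r} \<Longrightarrow> \<not> up i u"
  shows "w = u"
proof -
  have "(inv u \<circ> w) \<beta> \<in> positive_roots" if b: "\<beta> \<in> positive_roots" for \<beta>
  proof -
    have wb: "w \<beta> \<in> \<Phi>" using w b by simp
    have "w \<beta> \<notin> positive_roots" using all_down_negative[OF w, of "w \<beta>"] b w by auto
    then have "- w \<beta> \<in> positive_roots" using wb by (simp add: minus_positive_iff)
    then have "inv u (- w \<beta>) \<notin> positive_roots" using all_down_negative[OF u, of "- w \<beta>"] by blast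
    then show ?thesis using u wb by (simp add: W_linear inv_in_W minus_positive_iff)
  qed
  then have "{\<beta> \<in> positive_roots. (inv u \<circ> w) \<beta> \<notin> positive_roots} = {}" by blast
  then have "ell (inv u \<circ> w) = 0" unfolding ell_def by simp
  then have "inv u \<circ> w = id" using w u by (intro W_eq_id W_comp inv_in_W)
  then have "u (inv u (w x)) = u x" for x by (simp add: fun_eq_iff)
  then show ?thesis using u by (simp add: fun_eq_iff)
qed

section \<open>Subwords and the Demazure operator of the longest element\<close>

lemma subseq_set: "subseq bs js \<Longrightarrow> set bs \<subseteq> set js"
  by (induction rule: list_emb.induct) auto

definition subprods :: "nat list \<Rightarrow> ('a \<Rightarrow> 'a) set" where
  "subprods js = word_prod ` {bs. subseq bs js}"

lemma subprods_Cons: "subprods (i # js) = subprods js \<union> (\<lambda>u. s i \<circ> u) ` subprods js"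
proof (intro set_eqI iffI)
  fix u assume "u \<in> subprods (i # js)"
  then obtain bs where bs: "subseq bs (i # js)" "u = word_prod bs" unfolding subprods_def by blast
  show "u \<in> subprods js \<union> (\<lambda>u. s i \<circ> u) ` subprods js"
  proof (cases "subseq bs js")
    case False
    with bs(1) obtain cs where "bs = i # cs" "subseq cs js" by cases auto
    then show ?thesis using bs(2) unfolding subprods_def by auto
  qed (use bs in \<open>auto simp: subprods_def\<close>)
next
  fix u assume "u \<in> subprods js \<union> (\<lambda>u. s i \<circ> u) ` subprods js"
  then consider bs where "subseq bs js" "u = word_prod bs" | bs where "subseq bs js" "u = s i \<circ> word_prod bs"
    unfolding subprods_def by blast
  then show "u \<in> subprods (i # js)"
  proof cases
    case (1 bs)
    then show ?thesis unfolding subprods_def by (intro image_eqI[of _ _ bs]) auto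
  next
    case (2 bs)
    then show ?thesis unfolding subprods_def by (intro image_eqI[of _ _ "i # bs"]) auto
  qed
qed

lemma subprods_W: "set js \<subseteq> {1..r} \<Longrightarrow> subprods js \<subseteq> W"
  unfolding subprods_def using subseq_set by (blast intro: word_in_W)

text \<open>If \<open>s i\<close> shortens \<open>u\<close>, exchange realises the product by
  deleting a letter from the subword of \<open>u\<close>, so downward steps stay inside the
  set.\<close>

lemma subprods_exchange:
  assumes js: "set js \<subseteq> {1..r}" and i: "i \<in> {1..r}" and u: "u \<in> subprods js" "\<not> up i u"
  shows "s i \<circ> u \<in> subprods js"
proof -
  obtain bs where bs: "subseq bs js" "u = word_prod bs" using u(1) unfolding subprods_def by blast
  have "set bs \<subseteq> {1..r}" using subseq_set[OF bs(1)] js by blast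
  moreover have "inv (word_prod bs) (\<alpha> i) \<notin> positive_roots" using u(2) bs(2) by (simp add: up_def)
  ultimately obtain as j cs where e: "bs = as @ j # cs" "refl (\<alpha> i) \<circ> word_prod bs = word_prod (as @ cs)"
    using exchange[of bs "\<alpha> i"] i by auto
  have "subseq (as @ cs) bs" unfolding e(1) by (intro list_emb_append_mono) auto
  then have "subseq (as @ cs) js" using bs(1) by (rule subseq_order.trans)
  moreover have "s i \<circ> u = word_prod (as @ cs)" using e(2) bs(2) i by (simp add: s_refl)
  ultimately show ?thesis unfolding subprods_def by blast
qed

definition dc :: "nat \<Rightarrow> 'a ratfun" where "dc i = 1 / (1 - xx i)"
definition dz :: "nat \<Rightarrow> 'a ratfun" where "dz i = - xx i / (1 - xx i)"

lemma coef_op_D: "i \<in> {1..r} \<Longrightarrow> w \<in> W \<Longrightarrow> coef_op dc dz i \<rho> w = \<rho> w + coef_op (cc 0) (zz 0) i \<rho> w"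
proof -
  assume i: "i \<in> {1..r}" and w: "w \<in> W"
  have "1 - xx i \<noteq> 0" using i by simp
  then have "dc i = 1 + cc 0 i" "dz i = zz 0 i" by (simp_all add: dc_def dz_def cc_def zz_def field_simps)
  then show ?thesis using w by (simp add: coef_op_def algebra_simps)
qed

text \<open>At \<open>q = 0\<close>, \<open>(1 + T\<^sub>i) T\<^sub>w\<close> is \<open>T\<^sub>w + T\<^bsub>s\<^sub>i w\<^esub>\<close> if \<open>s\<^sub>i w\<close> is longer and \<open>0\<close> otherwise.\<close>

lemma coef_D:
  assumes "reduced_word js w" "u \<in> W"
  shows "coef dc dz js u = (\<Sum>y\<in>subprods js. T_coef 0 y u)"
  using assms
proof (induction arbitrary: u rule: reduced_word_induct)
  case Nil
  have "{bs :: nat list. subseq bs []} = {[]}" by auto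
  then have "subprods [] = {id}" unfolding subprods_def by (simp only: image_insert image_empty word_prod_simps)
  then show ?case using T_coef_id[of 0] by (simp add: coef_simps id_def)
next
  case (Cons i js w)
  note i = Cons(1)
  have js: "set js \<subseteq> {1..r}" using Cons(2) by (simp add: reduced_word_iff)
  let ?S = "subprods js" and ?U = "{y \<in> subprods js. up i y}"
  have SW: "?S \<subseteq> W" by (rule subprods_W[OF js])
  then have fin: "finite ?S" "finite ?U" using finite_subset[OF _ finite_W] by auto
  \<comment> \<open>Any element of the old set that goes down is \<open>s i\<close> times one that
    goes up. So the new set is made of pairs, one for each element going up, while each element
    going down contributes 0.\<close>
  have S': "subprods (i # js) = ?U \<union> (\<lambda>y. s i \<circ> y) ` ?U"
  proof -
    have "y \<in> (\<lambda>y. s i \<circ> y) ` ?U \<and> s i \<circ> y \<in> ?U" if "y \<in> ?S" "\<not> up i y" for y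
    proof -
      have "y \<in> W" using that(1) SW by blast
      then have "s i \<circ> y \<in> ?U" using subprods_exchange[OF js i that] up_s[OF i, of y] that(2) by blast
      moreover have "y = s i \<circ> (s i \<circ> y)" by (simp only: s_comp_s[OF i])
      ultimately show ?thesis by blast
    qed
    then have "y \<in> subprods (i # js) \<longleftrightarrow> y \<in> ?U \<union> (\<lambda>y. s i \<circ> y) ` ?U" for y
      unfolding subprods_Cons by blast
    then show ?thesis by blast
  qed
  have disj: "?U \<inter> (\<lambda>y. s i \<circ> y) ` ?U = {}"
  proof (rule ccontr)
    assume "?U \<inter> (\<lambda>y. s i \<circ> y) ` ?U \<noteq> {}"
    then obtain y where y: "y \<in> ?S" "up i y" "up i (s i \<circ> y)" by blast
    then have "y \<in> W" using SW by blast
    with y up_s[OF i, of y] show False by blast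
  qed
  have inj: "inj_on (\<lambda>y. s i \<circ> y) ?U" 
  proof (rule inj_onI)
    fix x y assume "s i \<circ> x = s i \<circ> y"
    then have "s i \<circ> (s i \<circ> x) = s i \<circ> (s i \<circ> y)" by (rule arg_cong)
    then show "x = y" unfolding s_comp_s[OF i] .
  qed
  have "coef dc dz js u = (\<Sum>y\<in>?S. T_coef 0 y u)" by (rule Cons.IH[OF Cons.prems])
  moreover have "coef dc dz js (s i \<circ> u) = (\<Sum>y\<in>?S. T_coef 0 y (s i \<circ> u))"
    by (rule Cons.IH[OF W_comp[OF s_in_W[OF i] Cons.prems]])
  ultimately have eq: "coef_op dc dz i (coef dc dz js) u = coef_op dc dz i (\<lambda>u. \<Sum>y\<in>?S. T_coef 0 y u) u"
    by (simp only: coef_op_def)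
  also have "\<dots> = (\<Sum>y\<in>?S. T_coef 0 y u + coef_op (cc 0) (zz 0) i (T_coef 0 y) u)"
    unfolding coef_op_sum[OF i] coef_op_D[OF i Cons.prems] ..
  also have "\<dots> = (\<Sum>y\<in>?S. if up i y then T_coef 0 y u + T_coef 0 (s i \<circ> y) u else 0)"
  proof (rule sum.cong[OF refl], goal_cases)
    case (1 y)
    then have "y \<in> W" using SW by blast
    show ?case
    proof (cases "up i y")
      case True
      then show ?thesis using T_coef_up[OF i \<open>y \<in> W\<close> True, of 0] by simp
    next
      case False
      then show ?thesis using T_coef_down[OF i \<open>y \<in> W\<close> False Cons.prems, of 0] by simp
    qed
  qed
  also have "\<dots> = (\<Sum>y\<in>?U. T_coef 0 y u + T_coef 0 (s i \<circ> y) u)"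
    using fin by (simp add: sum.inter_filter)
  also have "\<dots> = (\<Sum>y\<in>?U. T_coef 0 y u) + (\<Sum>y\<in>(\<lambda>y. s i \<circ> y) ` ?U. T_coef 0 y u)"
    unfolding sum.reindex[OF inj] sum.distrib by (simp only: o_def)
  also have "\<dots> = (\<Sum>y\<in>subprods (i # js). T_coef 0 y u)"
    unfolding S' by (rule sum.union_disjoint[symmetric, OF fin(2) finite_imageI[OF fin(2)] disj])
  finally show ?case by (simp only: coef_simps)
qed

text \<open>Descending induction on the length: an element with an upward step arises by a downward
  step from a longer one, and \<open>w\<close> is the only element without upward steps.\<close>

lemma subprods_longest:
  assumes js: "reduced_word js w" and w: "longest w"
  shows "subprods js = W"
proof
  have sub: "set js \<subseteq> {1..r}" using js by (simp add: reduced_word_iff)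
  then show "subprods js \<subseteq> W" by (rule subprods_W)
  have wW: "w \<in> W" using w by (simp add: longest_def)
  have wS: "w \<in> subprods js" using js unfolding subprods_def reduced_word_iff by blast
  have "u \<in> subprods js" if "u \<in> W" for u
    using that
  proof (induction "card positive_roots - ell u" arbitrary: u rule: less_induct)
    case less
    show ?case
    proof (cases "\<exists>i\<in>{1..r}. up i u")
      case True
      then obtain i where i: "i \<in> {1..r}" "up i u" by blast
      have su: "s i \<circ> u \<in> W" using i less.prems by (simp add: W_comp)
      have e: "ell (s i \<circ> u) = Suc (ell u)" by (rule ell_s_up[OF i(1) less.prems i(2)])
      have "ell (s i \<circ> u) \<le> card positive_roots" unfolding ell_def by (rule card_mono) auto
      then have "card positive_roots - ell (s i \<circ> u) < card positive_roots - ell u" using e by linarith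
      then have "s i \<circ> u \<in> subprods js" using less.hyps su by blast
      moreover have "\<not> up i (s i \<circ> u)" using up_s[OF i(1) less.prems] i(2) by simp
      ultimately have "s i \<circ> (s i \<circ> u) \<in> subprods js" by (rule subprods_exchange[OF sub i(1)])
      then show ?thesis unfolding s_comp_s[OF i(1)] .
    next
      case False
      then have "u = w" using longest_unique[OF less.prems _ wW longest_down[OF w]] by blast
      then show ?thesis using wS by simp
    qed
  qed
  then show "W \<subseteq> subprods js" by blast
qed

text \<open>T_i multiplies both the sum of all T_w and the function \<open>Delta_q q\<close> by q.
  The two eigenvalue equations have the same coefficients, and these cancel in the quotient.\<close>

lemma T_coef_sum_invariant:
  assumes i: "i \<in> {1..r}" and u: "u \<in> W"
  shows "act (s i) ((\<Sum>w\<in>W. T_coef q w u) / Delta_q q) = (\<Sum>w\<in>W. T_coef q w (s i \<circ> u)) / Delta_q q"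
proof -
  let ?E = "\<lambda>u. \<Sum>w\<in>W. T_coef q w u"
  have su: "s i \<circ> u \<in> W" using i u by (simp add: W_comp)
  have x: "xx i \<noteq> 0" "1 - xx i \<noteq> 0" "1 - const q * xx i \<noteq> 0"
    using i factor_neq_0[of "\<alpha> i" q] by (simp_all add: xx_def rt_neq_0)
  have D: "Delta_q q \<noteq> 0" by (rule Delta_q_neq_0)
  have D': "act (s i) (Delta_q q) \<noteq> 0" using D i by (simp add: act_eq_0)
  have "cc q i * ?E (s i \<circ> u) + zz q i * act (s i) (?E u) = const q * ?E (s i \<circ> u)"
    using T_coef_sum[OF i su, of q] su s_comp_s[OF i, of u] by (simp add: coef_op_def)
  then have "zz q i * act (s i) (?E u) = (const q - cc q i) * ?E (s i \<circ> u)" by (simp add: algebra_simps)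
  then have "zz q i * act (s i) (?E u) * Delta_q q = ?E (s i \<circ> u) * ((const q - cc q i) * Delta_q q)" by simp
  also have "(const q - cc q i) * Delta_q q = zz q i * act (s i) (Delta_q q)"
    unfolding act_Delta_q[OF i] using x by (simp add: cc_def zz_def) (simp add: divide_simps, algebra)
  finally have "zz q i * (act (s i) (?E u) * Delta_q q) = zz q i * (?E (s i \<circ> u) * act (s i) (Delta_q q))"
    by (simp only: ac_simps)
  moreover have "zz q i \<noteq> 0" using x by (simp add: zz_def)
  ultimately have "act (s i) (?E u) * Delta_q q = ?E (s i \<circ> u) * act (s i) (Delta_q q)"
    by (rule mult_left_cancel[THEN iffD1, rotated])
  then show ?thesis using D D' i by (simp add: act_divide frac_eq_eq)
qed

lemma Delta_coef_longest:
  assumes js: "reduced_word js w" and w: "longest w" and u: "u \<in> W"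
  shows "Delta_q q * coef dc dz js u = (\<Sum>y\<in>W. T_coef q y u)"
proof -
  have wW: "w \<in> W" using w by (simp add: longest_def)
  have D: "coef dc dz js u = (\<Sum>y\<in>W. T_coef 0 y u)" if "u \<in> W" for u
    using coef_D[OF js that] subprods_longest[OF js w] by simp
  have D0: "Delta_q 0 = 1" by (simp add: Delta_q_def)
  have top: "(\<Sum>y\<in>W. T_coef p y w) = T_coef p w w" for p
  proof -
    have "(\<Sum>y\<in>W. T_coef p y w) = (\<Sum>y\<in>{w}. T_coef p y w)"
    proof (rule sum.mono_neutral_right)
      show "\<forall>y\<in>W - {w}. T_coef p y w = 0"
      proof
        fix y assume y: "y \<in> W - {w}"
        then have "len y \<le> len w" using w unfolding longest_def by blast
        then have "ell y \<le> ell w" using y len_eq_ell[OF wW] len_eq_ell[of y] by simp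
        then show "T_coef p y w = 0" using y by (intro T_coef_support) auto
      qed
    qed (use wW in auto)
    then show ?thesis by simp
  qed
  have "left_invs w = positive_roots"
    unfolding left_invs_def using all_down_negative[OF wW longest_down[OF w]] by blast
  then have diag: "T_coef q w w = Delta_q q * T_coef 0 w w"
    using T_coef_diagonal[OF wW, of q] by (simp add: Delta_q_def)
  \<comment> \<open>\<open>F p\<close> is equivariant, hence determined by its value at the longest
    element; there the diagonal formula removes the dependence on p. At p = 0 the denominator is 1
    and \<open>F\<close> gives the coefficients of the Demazure operator.\<close>
  define F where "F p x = (\<Sum>y\<in>W. T_coef p y x) / Delta_q p" for p x
  have F_s: "F p (s i \<circ> x) = act (s i) (F p x)" if "i \<in> {1..r}" "x \<in> W" for p i x
    unfolding F_def by (rule T_coef_sum_invariant[OF that, symmetric])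
  have F_w: "F q w = F 0 w"
    unfolding F_def top diag D0 using Delta_q_neq_0[of q] by simp
  have F_eq: "F q (x \<circ> w) = F 0 (x \<circ> w)" if "x \<in> W" for x
    using that
  proof (induction rule: W_induct)
    case id
    show ?case using F_w by (simp add: comp_def)
  next
    case (step i x)
    have "F p ((s i \<circ> x) \<circ> w) = act (s i) (F p (x \<circ> w))" for p
      unfolding comp_assoc by (rule F_s[OF step(1) W_comp[OF step(2) wW]])
    then show ?case using step.IH by (simp add: comp_def)
  qed
  have "(u \<circ> inv w) \<circ> w = u" using wW by (simp add: fun_eq_iff)
  then have "F q u = F 0 u" using F_eq[of "u \<circ> inv w"] u wW by (simp only: W_comp inv_in_W)
  then show ?thesis using D[OF u] Delta_q_neq_0[of q] unfolding F_def D0 by (simp add: field_simps)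
qed

text \<open>The operator of sigma_i on the Hecke module, found by solving T_i = cc + zz sigma_i.
  Only \<open>v\<close> enters and none of the \<open>g j\<close>, so it serves the permutation
  action and the metaplectic one alike.\<close>

definition hat :: "nat \<Rightarrow> (('a \<Rightarrow> 'a) \<Rightarrow> 'a ratfun) \<Rightarrow> ('a \<Rightarrow> 'a) \<Rightarrow> 'a ratfun" where
  "hat i \<phi> w = (if w \<in> W then (left_op v i \<phi> w - cc v i * \<phi> w) / zz v i else 0)"

lemma zz_neq_0: "i \<in> {1..r} \<Longrightarrow> zz q i \<noteq> 0"
  using factor_neq_0[of "\<alpha> i" q] by (simp add: zz_def xx_def rt_neq_0)

lemma hat_intertwine:
  assumes i: "i \<in> {1..r}"
    and eq: "cc v i * (\<Sum>w\<in>W. \<phi> w * N w) + zz v i * f = (\<Sum>w\<in>W. left_op v i \<phi> w * N w)"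
  shows "f = (\<Sum>w\<in>W. hat i \<phi> w * N w)"
proof -
  have "zz v i * f = (\<Sum>w\<in>W. left_op v i \<phi> w * N w) - (\<Sum>w\<in>W. cc v i * \<phi> w * N w)"
    using eq by (simp add: sum_distrib_left algebra_simps)
  also have "\<dots> = (\<Sum>w\<in>W. zz v i * (hat i \<phi> w * N w))"
    unfolding sum_subtractf[symmetric] using zz_neq_0[OF i, of v]
    by (intro sum.cong) (simp_all add: hat_def algebra_simps diff_divide_distrib)
  finally show ?thesis using zz_neq_0[OF i, of v] by (simp flip: sum_distrib_left)
qed

lemma T_std_expand:
  assumes i: "i \<in> {1..r}"
  shows "T_std q i (\<Sum>u\<in>W. \<rho> u * act u f) = (\<Sum>u\<in>W. coef_op (cc q) (zz q) i \<rho> u * act u f)"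
proof -
  have "act (s i) (\<Sum>u\<in>W. \<rho> u * act u f) = (\<Sum>u\<in>W. act (s i) (\<rho> u) * act (s i \<circ> u) f)"
    unfolding act_linear(4)[OF s_in_W[OF i]]
    using i act_comp[OF s_in_W[OF i]] by (intro sum.cong) (simp_all add: act_mult)
  also have "\<dots> = (\<Sum>u\<in>W. act (s i) (\<rho> (s i \<circ> u)) * act u f)"
    using sum_W_shift[OF i, of "\<lambda>u. act (s i) (\<rho> (s i \<circ> u)) * act u f"] by (simp only: s_comp_s[OF i])
  finally show ?thesis
    by (simp add: T_std_def coef_op_def sum_distrib_left sum.distrib distrib_right mult.assoc cong: sum.cong)
qed

text \<open>The functions T_w f, formed with the permutation action, multiply under T_i like the
  basis elements.\<close>

lemma hat_std:
  assumes i: "i \<in> {1..r}"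
  shows "act (s i) (\<Sum>w\<in>W. \<phi> w * (\<Sum>u\<in>W. T_coef v w u * act u f)) = (\<Sum>w\<in>W. hat i \<phi> w * (\<Sum>u\<in>W. T_coef v w u * act u f))"
proof (rule hat_intertwine[OF i])
  let ?N = "\<lambda>w. \<Sum>u\<in>W. T_coef v w u * act u f"
  have "T_std v i (\<Sum>w\<in>W. \<phi> w * ?N w) = (\<Sum>w\<in>W. left_op v i \<phi> w * ?N w)"
  proof (rule intertwine[OF i, where S = UNIV])
    fix w assume w: "w \<in> W"
    show "T_std v i (?N w) = ?N (s i \<circ> w)" if "up i w"
      unfolding T_std_expand[OF i] T_coef_up[OF i w that] ..
    show "T_std v i (?N w) = const v * ?N (s i \<circ> w) - (1 - const v) * ?N w" if "\<not> up i w"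
    proof -
      have "(\<Sum>u\<in>W. coef_op (cc v) (zz v) i (T_coef v w) u * act u f)
        = (\<Sum>u\<in>W. (const v * T_coef v (s i \<circ> w) u - (1 - const v) * T_coef v w u) * act u f)"
        using T_coef_down[OF i w that] by (intro sum.cong) simp_all
      then show ?thesis unfolding T_std_expand[OF i]
        by (simp add: sum_distrib_left left_diff_distrib sum_subtractf mult.assoc)
    qed
  qed (simp_all add: T_std_sum[OF i] T_std_mult[OF i])
  then show "cc v i * (\<Sum>w\<in>W. \<phi> w * ?N w) + zz v i * act (s i) (\<Sum>w\<in>W. \<phi> w * ?N w) = (\<Sum>w\<in>W. left_op v i \<phi> w * ?N w)"
    unfolding T_std_def .
qed

text \<open>Triangularity: at an element of maximal length in the support of \<psi>, only its own
  T_w has a coefficient, and that is a nonzero diagonal one. Letting f run through the monomials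
  isolates this coefficient.\<close>

lemma T_coef_independent:
  assumes zero: "\<And>f. (\<Sum>w\<in>W. \<psi> w * (\<Sum>u\<in>W. T_coef v w u * act u f)) = 0" and "w \<in> W"
  shows "\<psi> w = 0"
proof (rule ccontr)
  assume "\<psi> w \<noteq> 0"
  define A where "A = {w \<in> W. \<psi> w \<noteq> 0}"
  have A: "finite (ell ` A)" "ell ` A \<noteq> {}" using \<open>\<psi> w \<noteq> 0\<close> \<open>w \<in> W\<close> by (auto simp: A_def)
  obtain x where x: "x \<in> A" "ell x = Max (ell ` A)" using Max_in[OF A] by auto
  have mx: "ell y \<le> ell x" if "y \<in> A" for y unfolding x(2) using A that by (intro Max_ge) auto
  have xW: "x \<in> W" using x by (simp add: A_def)
  have "(\<Sum>w\<in>W. \<psi> w * T_coef v w x) = 0"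
  proof (rule characters_independent[where A = W and L = UNIV and \<chi> = "\<lambda>u \<nu>. X (u \<nu>)"
        and d = "\<lambda>u. \<Sum>w\<in>W. \<psi> w * T_coef v w u"])
    show "X (w (a + b)) = X (w a) * (X (w b) :: 'a ratfun)" if "w \<in> W" for w a b
      using that by (simp add: W_add X_add)
    show "\<exists>a\<in>UNIV. X (w a) \<noteq> (0 :: 'a ratfun)" for w by simp
    show "\<exists>a\<in>UNIV. X (w a) \<noteq> (X (u a) :: 'a ratfun)" if "w \<noteq> u" for w u :: "'a \<Rightarrow> 'a"
      using that by (auto simp: fun_eq_iff)
    fix \<nu>
    have "(\<Sum>u\<in>W. (\<Sum>w\<in>W. \<psi> w * T_coef v w u) * X (u \<nu>)) = (\<Sum>u\<in>W. \<Sum>w\<in>W. \<psi> w * (T_coef v w u * act u (X \<nu>)))"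
      by (intro sum.cong) (simp_all add: sum_distrib_right mult.assoc)
    also have "\<dots> = (\<Sum>w\<in>W. \<Sum>u\<in>W. \<psi> w * (T_coef v w u * act u (X \<nu>)))" by (rule sum.swap)
    also have "\<dots> = 0" using zero[of "X \<nu>"] by (simp add: sum_distrib_left)
    finally show "(\<Sum>u\<in>W. (\<Sum>w\<in>W. \<psi> w * T_coef v w u) * X (u \<nu>)) = 0" .
  qed (use xW in simp_all)
  also have "(\<Sum>w\<in>W. \<psi> w * T_coef v w x) = (\<Sum>w\<in>{x}. \<psi> w * T_coef v w x)"
  proof (rule sum.mono_neutral_right)
    show "\<forall>y\<in>W - {x}. \<psi> y * T_coef v y x = 0"
    proof
      fix y assume y: "y \<in> W - {x}"
      show "\<psi> y * T_coef v y x = 0"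
      proof (cases "y \<in> A")
        case True
        then have "T_coef v y x = 0" using y mx by (intro T_coef_support) auto
        then show ?thesis by simp
      next
        case False
        then show ?thesis using y by (simp add: A_def)
      qed
    qed
  qed (use xW in auto)
  finally show False using x T_coef_diagonal_neq_0[OF xW, of v] by (simp add: A_def)
qed

text \<open>The relations of \<open>W\<close> are evident for the permutation action. They transfer
  to \<open>hat\<close> because the representation by the functions T_w f, for all f together, is
  faithful.\<close>

lemma hat_word:
  assumes js: "set js \<subseteq> {1..r}" "word_prod js = id" and \<phi>: "\<And>w. w \<notin> W \<Longrightarrow> \<phi> w = 0"
  shows "foldr hat js \<phi> = \<phi>"
proof
  fix w
  let ?N = "\<lambda>f w. \<Sum>u\<in>W. T_coef v w u * act u f"
  have word: "act (word_prod js) (\<Sum>w\<in>W. \<phi> w * ?N f w) = (\<Sum>w\<in>W. foldr hat js \<phi> w * ?N f w)" if "set js \<subseteq> {1..r}" for js f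
    using that
  proof (induction js)
    case Nil
    then show ?case using act_id by (simp add: id_def)
  next
    case (Cons i js)
    then have i: "i \<in> {1..r}" and js: "word_prod js \<in> W" by (simp_all add: word_in_W)
    have "act (s i \<circ> word_prod js) (\<Sum>w\<in>W. \<phi> w * ?N f w) = act (s i) (\<Sum>w\<in>W. foldr hat js \<phi> w * ?N f w)"
      using Cons unfolding act_comp[OF s_in_W[OF i] js] by simp
    also have "\<dots> = (\<Sum>w\<in>W. hat i (foldr hat js \<phi>) w * ?N f w)" by (rule hat_std[OF i])
    finally show ?case by (simp add: comp_def)
  qed
  show "foldr hat js \<phi> w = \<phi> w"
  proof (cases "w \<in> W")
    case True
    have "foldr hat js \<phi> w - \<phi> w = 0"
    proof (rule T_coef_independent[OF _ True])
      fix f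
      have "(\<Sum>w\<in>W. foldr hat js \<phi> w * ?N f w) = (\<Sum>w\<in>W. \<phi> w * ?N f w)"
        using word[OF js(1), of f] unfolding js(2) act_id by simp
      then show "(\<Sum>w\<in>W. (foldr hat js \<phi> w - \<phi> w) * ?N f w) = 0"
        by (simp add: left_diff_distrib sum_subtractf)
    qed
    then show ?thesis by simp
  next
    case False
    then show ?thesis using \<phi>[OF False] by (cases js) (simp_all add: hat_def)
  qed
qed

subsection \<open>Homogeneous components\<close>

lemma chars_hom:
  assumes "\<xi> \<in> chars"
  shows "\<xi> (\<nu> + \<mu>) = \<xi> \<nu> * \<xi> \<mu>" "\<nu> \<in> Lambda0 \<Longrightarrow> \<xi> \<nu> = 1" "\<xi> 0 = 1" "\<xi> \<nu> \<noteq> 0"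
proof -
  have z: "0 \<in> Lambda0" by (simp add: Lambda0_def B_simps)
  show *: "\<xi> (\<nu> + \<mu>) = \<xi> \<nu> * \<xi> \<mu>" "\<nu> \<in> Lambda0 \<Longrightarrow> \<xi> \<nu> = 1" for \<nu> \<mu> using assms by (auto simp: chars_def)
  show 0: "\<xi> 0 = 1" using *(2)[OF z] .
  show "\<xi> \<nu> \<noteq> 0" using *(1)[of \<nu> "- \<nu>"] 0 by auto
qed

lemma char_simps:
  assumes "\<xi> \<in> chars"
  shows "char_act \<xi> (X \<nu>) = const (\<xi> \<nu>) * X \<nu>" "char_act \<xi> (const c) = const c"
    "char_act \<xi> (f + h) = char_act \<xi> f + char_act \<xi> h" "char_act \<xi> (f * h) = char_act \<xi> f * char_act \<xi> h"
  by (rule char_act_hom; simp add: chars_hom[OF assms])+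

lemma char_linear:
  assumes "\<xi> \<in> chars"
  shows "char_act \<xi> 0 = 0" "char_act \<xi> (- f) = - char_act \<xi> f" "char_act \<xi> (f - h) = char_act \<xi> f - char_act \<xi> h"
    "char_act \<xi> (sum k A) = (\<Sum>a\<in>A. char_act \<xi> (k a))" "char_act \<xi> 1 = 1"
  using additive_minus[of "char_act \<xi>", OF char_simps(3)[OF assms]] additive_sum[of "char_act \<xi>", OF char_simps(3)[OF assms]]
    char_simps(2)[OF assms, of 1] by auto

lemma char_prod: "\<xi> \<in> chars \<Longrightarrow> char_act \<xi> (prod k A) = (\<Prod>a\<in>A. char_act \<xi> (k a))"
  by (induction A rule: infinite_finite_induct) (simp_all add: char_simps char_linear)

lemma char_eq_0: "\<xi> \<in> chars \<Longrightarrow> char_act \<xi> f = 0 \<longleftrightarrow> f = 0"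
proof
  assume w: "\<xi> \<in> chars" and z: "char_act \<xi> f = 0"
  show "f = 0"
  proof (rule ccontr)
    assume "f \<noteq> 0"
    then have "char_act \<xi> f * char_act \<xi> (inverse f) = 1" using w by (simp add: char_linear flip: char_simps(4))
    then show False using z by simp
  qed
qed (simp add: char_linear)

lemma char_divide: "\<xi> \<in> chars \<Longrightarrow> char_act \<xi> (f / h) = char_act \<xi> f / char_act \<xi> h"
  by (rule ring_hom_divide) (simp_all add: char_linear char_simps char_eq_0)

lemma chars_mult: "\<xi> \<in> chars \<Longrightarrow> \<eta> \<in> chars \<Longrightarrow> (\<lambda>\<nu>. \<xi> \<nu> * \<eta> \<nu>) \<in> chars"
  and chars_inverse: "\<xi> \<in> chars \<Longrightarrow> (\<lambda>\<nu>. inverse (\<xi> \<nu>)) \<in> chars"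
  and chars_1: "(\<lambda>\<nu>. 1) \<in> chars"
  by (simp_all add: chars_def)

lemma char_char:
  assumes "\<xi> \<in> chars" "\<eta> \<in> chars"
  shows "char_act \<xi> (char_act \<eta> f) = char_act (\<lambda>\<nu>. \<xi> \<nu> * \<eta> \<nu>) f"
proof (induction f rule: ratfun_induct)
  case (X \<nu>)
  then show ?case using assms chars_mult[OF assms] by (simp add: char_simps const_mult ac_simps)
qed (simp_all only: char_simps(2-4) char_divide assms chars_mult[OF assms])

lemma act_char:
  assumes "i \<in> {1..r}" "\<xi> \<in> chars" "(\<lambda>\<nu>. \<xi> (s i \<nu>)) \<in> chars"
  shows "char_act \<xi> (act (s i) f) = act (s i) (char_act (\<lambda>\<nu>. \<xi> (s i \<nu>)) f)"
proof (induction f rule: ratfun_induct)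
  case (X \<nu>)
  then show ?case using assms by (simp add: char_simps act_simps)
qed (simp_all only: char_simps(2-4) char_divide assms act_add act_mult act_divide act_const s_in_W[OF assms(1)])

lemma char_act_1: "char_act (\<lambda>\<nu>. 1) f = f" for f :: "'a ratfun"
  by (induction f rule: ratfun_induct)
    (simp_all add: char_simps[OF chars_1] char_divide[OF chars_1])

text \<open>A character is determined on a basis of the lattice, where its values are n-th roots of
  unity since n times the lattice lies in \<open>Lambda0\<close>.\<close>

lemma finite_chars: "finite chars"
proof -
  obtain Y :: "'a set" where Y: "finite Y" and
    *: "\<forall>x. \<exists>!c. (\<forall>b. b \<notin> Y \<longrightarrow> c b = 0) \<and> x = (\<Sum>b\<in>Y. zscale (c b) b)"
    using ex_finite_zbasis by (elim exE conjE)
  have pow: "\<xi> b ^ n = 1" if x: "\<xi> \<in> chars" for \<xi> b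
  proof -
    have "\<xi> (zscale (int k) b) = \<xi> b ^ k" for k
      by (induction k) (simp_all add: zscale_succ chars_hom[OF x] add.commute[of 1])
    moreover have "zscale (int n) b \<in> Lambda0" by (simp add: Lambda0_def B_simps)
    ultimately show ?thesis using chars_hom(2)[OF x] by metis
  qed
  have ext: "\<xi> = \<eta>" if x: "\<xi> \<in> chars" "\<eta> \<in> chars" and e: "\<And>b. b \<in> Y \<Longrightarrow> \<xi> b = \<eta> b" for \<xi> \<eta>
  proof
    fix \<nu>
    have add: "\<xi> (x + y) = \<eta> (x + y)" if "\<xi> x = \<eta> x" "\<xi> y = \<eta> y" for x y
      using that chars_hom(1)[OF x(1)] chars_hom(1)[OF x(2)] by simp
    have neg: "\<xi> (- x) = \<eta> (- x)" if "\<xi> x = \<eta> x" for x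
    proof -
      have "\<xi> x * \<xi> (- x) = \<eta> x * \<eta> (- x)"
        using chars_hom(1)[OF x(1), of x "- x"] chars_hom(1)[OF x(2), of x "- x"] chars_hom(3)[OF x(1)] chars_hom(3)[OF x(2)] by simp
      then show ?thesis using that chars_hom(4)[OF x(1), of x] by simp
    qed
    have scale: "\<xi> (zscale k b) = \<eta> (zscale k b)" if "b \<in> Y" for k b
    proof (induction k rule: int_induct[where k = 0])
      case base
      show ?case using chars_hom(3)[OF x(1)] chars_hom(3)[OF x(2)] by simp
    next
      case (step1 k)
      then show ?case using add e[OF that] by (simp add: zscale_succ)
    next
      case (step2 k)
      then show ?case using add[OF _ neg[OF e[OF that]]] by (simp add: zscale_diff_left)
    qed
    have "\<xi> (\<Sum>b\<in>Y. zscale (c b) b) = \<eta> (\<Sum>b\<in>Y. zscale (c b) b)" for c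
      using Y scale
    proof (induction Y)
      case empty
      then show ?case using chars_hom(3)[OF x(1)] chars_hom(3)[OF x(2)] by simp
    next
      case (insert b Y)
      then show ?case using add by simp
    qed
    moreover obtain c where "\<nu> = (\<Sum>b\<in>Y. zscale (c b) b)" using *[rule_format, of \<nu>] by (elim ex1E conjE)
    ultimately show "\<xi> \<nu> = \<eta> \<nu>" by simp
  qed
  have "inj_on (\<lambda>\<xi>. restrict \<xi> Y) chars"
  proof (rule inj_onI)
    fix \<xi> \<eta> assume x: "\<xi> \<in> chars" "\<eta> \<in> chars" "restrict \<xi> Y = restrict \<eta> Y"
    show "\<xi> = \<eta>" by (rule ext[OF x(1,2)]) (metis x(3) restrict_apply')
  qed
  moreover have "(\<lambda>\<xi>. restrict \<xi> Y) ` chars \<subseteq> (Y \<rightarrow>\<^sub>E {z. z ^ n = 1})" using pow by auto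
  moreover have "finite {z::complex. z ^ n = 1}" using n_pos by (intro finite_roots_unity) simp
  ultimately show ?thesis using Y by (meson finite_PiE finite_imageD finite_subset)
qed

lemma K_iff: "f \<in> K \<nu> \<longleftrightarrow> (\<forall>\<xi>\<in>chars. char_act \<xi> f = const (\<xi> \<nu>) * f)"
  by (simp add: K_def)

lemma K_0_iff: "f \<in> K 0 \<longleftrightarrow> (\<forall>\<xi>\<in>chars. char_act \<xi> f = f)"
  by (auto simp: K_iff chars_hom(3))

lemma K_add: "f \<in> K \<nu> \<Longrightarrow> h \<in> K \<nu> \<Longrightarrow> f + h \<in> K \<nu>"
  by (simp add: K_iff char_simps distrib_left)

lemma K_diff: "f \<in> K \<nu> \<Longrightarrow> h \<in> K \<nu> \<Longrightarrow> f - h \<in> K \<nu>"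
  by (simp add: K_iff char_linear right_diff_distrib)

lemma K_mult: "f \<in> K \<nu> \<Longrightarrow> h \<in> K \<mu> \<Longrightarrow> f * h \<in> K (\<nu> + \<mu>)"
  by (simp add: K_iff char_simps chars_hom const_mult ac_simps)

lemma K_X: "X \<nu> \<in> K \<nu>"
  by (simp add: K_iff char_simps)

lemma K_const: "const c \<in> K 0"
  by (simp add: K_0_iff char_simps)

lemma K_0_divide: "f \<in> K 0 \<Longrightarrow> h \<in> K 0 \<Longrightarrow> f / h \<in> K 0"
  by (simp add: K_0_iff char_divide)

lemma K_0_1: "1 \<in> K 0" and K_zero: "0 \<in> K \<nu>"
  by (simp_all add: K_iff char_linear chars_hom)

lemma K_0_mult: "f \<in> K 0 \<Longrightarrow> h \<in> K \<nu> \<Longrightarrow> f * h \<in> K \<nu>"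
  using K_mult[of f 0 h \<nu>] by simp

lemma Lambda0_s:
  assumes "i \<in> {1..r}" "\<nu> \<in> Lambda0"
  shows "s i \<nu> \<in> Lambda0"
proof -
  have "int n dvd B (\<alpha> j) (s i \<nu>)" if j: "j \<in> {1..r}" for j
  proof -
    have "B (\<alpha> j) (s i \<nu>) = B (s i (\<alpha> j)) \<nu>" using B_W[OF s_in_W[OF assms(1)], of "\<alpha> j" "s i \<nu>"] assms(1) by (metis s_s)
    also have "\<dots> = B (\<alpha> j) \<nu> - coroot (\<alpha> i) (\<alpha> j) * B (\<alpha> i) \<nu>" by (simp add: s_eq_coroot B_simps)
    finally show ?thesis using assms j by (simp add: Lambda0_def)
  qed
  then show ?thesis by (simp add: Lambda0_def)
qed

lemma chars_s: "i \<in> {1..r} \<Longrightarrow> \<xi> \<in> chars \<Longrightarrow> (\<lambda>\<nu>. \<xi> (s i \<nu>)) \<in> chars"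
  using Lambda0_s by (auto simp: chars_def W_add[OF s_in_W])

lemma K_0_act: "i \<in> {1..r} \<Longrightarrow> f \<in> K 0 \<Longrightarrow> act (s i) f \<in> K 0"
  using act_char chars_s by (simp add: K_0_iff)

lemma rt_Lambda0: "\<beta> \<in> \<Phi> \<Longrightarrow> rt \<beta> \<in> Lambda0"
proof -
  assume b: "\<beta> \<in> \<Phi>"
  have "int n dvd B (\<alpha> j) (rt \<beta>)" for j
  proof -
    have "B (\<alpha> j) (rt \<beta>) = m \<beta> * Q \<beta> * coroot \<beta> (\<alpha> j)"
      using coroot_B[OF b, of "\<alpha> j"] by (simp add: rt_def B_simps ac_simps)
    then show ?thesis using n_dvd_m_Q[of \<beta>] by simp
  qed
  then show ?thesis by (simp add: Lambda0_def)
qed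

lemma K_Lambda0: "\<mu> \<in> Lambda0 \<Longrightarrow> f \<in> K (\<nu> + \<mu>) \<longleftrightarrow> f \<in> K \<nu>"
  by (auto simp: K_iff chars_hom)

lemma X_K_0: "\<mu> \<in> Lambda0 \<Longrightarrow> X \<mu> \<in> K 0"
  using K_X[of \<mu>] K_Lambda0[of \<mu> "X \<mu>" 0] by simp

lemma xx_K_0: "i \<in> {1..r} \<Longrightarrow> xx i \<in> K 0"
  by (simp add: xx_def X_K_0 rt_Lambda0)

lemma coeffs_K_0:
  assumes "i \<in> {1..r}"
  shows "cc q i \<in> K 0" "zz q i \<in> K 0" "dc i \<in> K 0" "dz i \<in> K 0"
proof -
  have m: "- f \<in> K 0" if "f \<in> K 0" for f using K_diff[OF K_zero that] by simp
  show "cc q i \<in> K 0" "zz q i \<in> K 0" "dc i \<in> K 0" "dz i \<in> K 0"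
    unfolding cc_def zz_def dc_def dz_def using xx_K_0[OF assms]
    by (auto intro!: K_0_divide K_0_mult m K_diff K_const K_0_1)
qed

lemma homogeneous_induct [case_names homogeneous add]:
  assumes hom: "\<And>\<nu> f. f \<in> K \<nu> \<Longrightarrow> P f" and add: "\<And>f h. P f \<Longrightarrow> P h \<Longrightarrow> P (f + h)"
  shows "P f"
proof -
  obtain a b where f: "f = Fract a b" "b \<noteq> 0" by (cases f)
  let ?f = "\<lambda>p. Fract p 1 :: 'a ratfun"
  have char_poly: "\<exists>q. char_act \<xi> (?f p) = ?f q" if x: "\<xi> \<in> chars" for \<xi> p
  proof (induction p rule: ga_induct)
    case zero
    show ?case by (intro exI[of _ 0]) (simp add: char_linear[OF x] flip: Zero_fract_def)
  next
    case (add p d \<nu>)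
    then obtain q where q: "char_act \<xi> (?f p) = ?f q" by blast
    have "?f (p + ga_term d \<nu>) = ?f p + const d * X \<nu>" by (simp add: const_X)
    then have "char_act \<xi> (?f (p + ga_term d \<nu>)) = ?f q + const d * (const (\<xi> \<nu>) * X \<nu>)"
      by (simp add: char_simps[OF x] q)
    also have "\<dots> = ?f q + const (d * \<xi> \<nu>) * X \<nu>" by (simp add: const_mult mult.assoc)
    also have "\<dots> = ?f (q + ga_term (d * \<xi> \<nu>) \<nu>)" by (simp add: const_X)
    finally show ?case by blast
  qed
  define N where "N = (\<Prod>\<xi>\<in>chars. char_act \<xi> (?f b))"
  have b0: "?f b \<noteq> 0" using f by (simp add: Zero_fract_def eq_fract)
  have N0: "N \<noteq> 0" unfolding N_def using b0 char_eq_0 finite_chars by (subst prod_zero_iff) auto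
  have N: "N \<in> K 0"
    unfolding K_0_iff
  proof
    fix \<eta> assume e: "\<eta> \<in> chars"
    have "char_act \<eta> N = (\<Prod>\<xi>\<in>chars. char_act \<eta> (char_act \<xi> (?f b)))"
      unfolding N_def by (rule char_prod[OF e])
    also have "\<dots> = (\<Prod>\<xi>\<in>chars. char_act (\<lambda>\<nu>. \<eta> \<nu> * \<xi> \<nu>) (?f b))"
      using char_char[OF e] by (intro prod.cong) auto
    also have "\<dots> = N" unfolding N_def
      by (rule prod.reindex_bij_witness[where i = "\<lambda>\<xi> \<nu>. inverse (\<eta> \<nu>) * \<xi> \<nu>" and j = "\<lambda>\<xi> \<nu>. \<eta> \<nu> * \<xi> \<nu>"])
        (use chars_hom(4)[OF e] in \<open>auto simp: fun_eq_iff mult.assoc[symmetric] intro: chars_mult[OF e] chars_mult[OF chars_inverse[OF e]]\<close>)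
    finally show "char_act \<eta> N = N" .
  qed
  have "\<exists>q. (\<Prod>\<xi>\<in>A. char_act \<xi> (?f b)) = ?f q" if "A \<subseteq> chars" for A
    using finite_subset[OF that finite_chars] that
  proof (induction A)
    case empty
    show ?case by (intro exI[of _ 1]) (simp flip: One_fract_def)
  next
    case (insert \<xi> A)
    then obtain q q' where "(\<Prod>\<xi>\<in>A. char_act \<xi> (?f b)) = ?f q" "char_act \<xi> (?f b) = ?f q'"
      using char_poly by blast
    then show ?case using insert by (intro exI[of _ "q' * q"]) simp
  qed
  then obtain q where q: "(\<Prod>\<xi>\<in>chars - {\<lambda>\<nu>. 1}. char_act \<xi> (?f b)) = ?f q" by blast
  have Nq: "N = ?f b * ?f q"
    unfolding N_def using prod.remove[OF finite_chars chars_1, of "\<lambda>\<xi>. char_act \<xi> (?f b)"] q char_act_1[of "?f b"] by simp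
  then have q0: "?f q \<noteq> 0" using N0 unfolding Nq mult_eq_0_iff by blast
  have "f = ?f a / ?f b" using f by (simp add: divide_fract_def)
  moreover have "?f (a * q) = ?f a * ?f q" by simp
  ultimately have "f = ?f (a * q) / N" by (simp only: Nq mult_divide_mult_cancel_right[OF q0])
  moreover have "P (?f p / N)" for p
  proof (induction p rule: ga_induct)
    case zero
    show ?case using hom[OF K_zero] by (simp flip: Zero_fract_def)
  next
    case (add p d \<nu>)
    have "?f (p + ga_term d \<nu>) = ?f p + const d * X \<nu>" by (simp add: const_X)
    then have "?f (p + ga_term d \<nu>) / N = ?f p / N + (const d / N) * X \<nu>"
      by (simp only: add_divide_distrib times_divide_eq_left)
    moreover have "(const d / N) * X \<nu> \<in> K \<nu>" by (intro K_0_mult K_0_divide K_const N K_X)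
    ultimately show ?case using assms(2)[OF add hom] by metis
  qed
  ultimately show ?thesis by simp
qed

subsection \<open>The metaplectic action\<close>

definition uroot :: "int \<Rightarrow> complex" where
  "uroot k = cis (2 * pi * (of_int k / of_nat n))"

lemma uroot_add: "uroot (j + k) = uroot j * uroot k"
  by (simp add: uroot_def cis_mult add_divide_distrib distrib_left)

lemma uroot_mult_n [simp]: "uroot (int n * k) = 1"
  using n_pos by (simp add: uroot_def)

lemma uroot_power: "uroot k ^ t = uroot (int t * k)"
  by (induction t) (simp_all add: uroot_def[of 0] distrib_right uroot_add)

lemma uroot_eq_1: "uroot k = 1 \<longleftrightarrow> int n dvd k"
proof
  assume "uroot k = 1"
  have "uroot k = uroot (int n * (k div int n) + k mod int n)" by simp
  also have "\<dots> = uroot (k mod int n)" unfolding uroot_add by simp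
  finally have 1: "uroot (int (nat (k mod int n))) = uroot (int 0)"
    using n_pos \<open>uroot k = 1\<close> by (simp add: uroot_def[of 0])
  have "bij_betw (\<lambda>k. cis (2 * pi * real k / real n)) {..<n} {z. z ^ n = 1}"
    using n_pos by (intro bij_betw_roots_unity) simp
  then have "inj_on (\<lambda>k. cis (2 * pi * real k / real n)) {..<n}" by (rule bij_betw_imp_inj_on)
  then have "x < n \<Longrightarrow> y < n \<Longrightarrow> cis (2 * pi * real x / real n) = cis (2 * pi * real y / real n) \<Longrightarrow> x = y" for x y
    unfolding inj_on_def by blast
  moreover have "nat (k mod int n) < n" using n_pos by (simp add: nat_less_iff)
  moreover have "0 < n" using n_pos by simp
  moreover have "cis (2 * pi * real (nat (k mod int n)) / real n) = cis (2 * pi * real 0 / real n)"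
    using 1 unfolding uroot_def of_int_of_nat_eq times_divide_eq_right .
  ultimately have "nat (k mod int n) = 0" by blast
  moreover have "0 \<le> k mod int n" using n_pos by simp
  ultimately have "k mod int n = 0" by linarith
  then show "int n dvd k" by (rule mod_0_imp_dvd)
next
  assume "int n dvd k"
  then obtain j where "k = int n * j" by (rule dvdE)
  then show "uroot k = 1" by simp
qed

lemma uroot_sum: "(\<Sum>t<n. uroot (int t * k)) = (if int n dvd k then of_nat n else 0)"
proof (cases "int n dvd k")
  case True
  then have "uroot (int t * k) = 1" for t by (simp add: uroot_eq_1)
  then show ?thesis using True by simp
next
  case False
  then have "uroot k \<noteq> 1" by (simp add: uroot_eq_1)
  then have "(\<Sum>t<n. uroot k ^ t) = (uroot k ^ n - 1) / (uroot k - 1)" by (rule geometric_sum)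
  then show ?thesis using False by (simp add: uroot_power)
qed

lemma uroot_char: "i \<in> {1..r} \<Longrightarrow> (\<lambda>\<nu>. uroot (k * B \<nu> (\<alpha> i))) \<in> chars"
  by (auto simp: chars_def B_simps distrib_left uroot_add uroot_eq_1 Lambda0_def B_sym)

lemma sigma_homogeneous_cong:
  assumes i: "i \<in> {1..r}" and eq: "B \<nu> (\<alpha> i) mod int n = B \<mu> (\<alpha> i) mod int n"
  shows "sigma_homogeneous i \<nu> f = sigma_homogeneous i \<mu> f"
proof -
  have k: "B \<nu> (\<alpha> i) = coroot (\<alpha> i) \<nu> * Q (\<alpha> i)" for \<nu> using coroot_B[of "\<alpha> i" \<nu>] i by simp
  have "B \<nu> (\<alpha> i) div Q (\<alpha> i) = coroot (\<alpha> i) \<nu>" for \<nu> using Q_nonzero[of "\<alpha> i"] i by (simp add: k)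
  moreover have "(- coroot (\<alpha> i) \<nu>) mod m (\<alpha> i) = (- coroot (\<alpha> i) \<mu>) mod m (\<alpha> i)"
  proof -
    have "int n dvd (- coroot (\<alpha> i) \<nu> - - coroot (\<alpha> i) \<mu>) * Q (\<alpha> i)"
      using eq unfolding k by (simp add: mod_eq_dvd_iff algebra_simps) (metis dvd_minus_iff minus_diff_eq)
    then show ?thesis using m_dvd_iff[of "\<alpha> i"] i by (simp add: mod_eq_dvd_iff)
  qed
  moreover have "g (Q (\<alpha> i) - B \<nu> (\<alpha> i)) = g (Q (\<alpha> i) - B \<mu> (\<alpha> i))"
    using g_periodic[of "Q (\<alpha> i) - B \<nu> (\<alpha> i)"] g_periodic[of "Q (\<alpha> i) - B \<mu> (\<alpha> i)"] eq by (metis mod_diff_right_eq)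
  ultimately show ?thesis by (simp add: sigma_homogeneous_def)
qed

lemma sigma_homogeneous_linear:
  assumes "i \<in> {1..r}"
  shows "sigma_homogeneous i \<nu> (f + h) = sigma_homogeneous i \<nu> f + sigma_homogeneous i \<nu> h"
    "sigma_homogeneous i \<nu> (f * h) = act (s i) f * sigma_homogeneous i \<nu> h"
    "sigma_homogeneous i \<nu> 0 = 0"
  using assms by (simp_all add: sigma_homogeneous_def act_simps add_divide_distrib distrib_right)

lemma sigma_spec:
  assumes i: "i \<in> {1..r}"
  shows "sigma i (f + h) = sigma i f + sigma i h" "f \<in> K \<nu> \<Longrightarrow> sigma i f = sigma_homogeneous i \<nu> f"
proof -
  \<comment> \<open>Fourier projection onto the part where \<open>B \<nu> (\<alpha> i)\<close> is j
    modulo n. These n classes suffice because the formula for sigma_i depends on the degree only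
    through this residue.\<close>
  define pr where "pr j f = const (1 / of_nat n) * (\<Sum>t<n. const (uroot (- (int t * int j))) * char_act (\<lambda>\<nu>. uroot (int t * B \<nu> (\<alpha> i))) f)" for j f
  \<comment> \<open>For a residue attained by no weight this is an arbitrary weight; on homogeneous
    functions the corresponding projection is 0.\<close>
  define rep where "rep j = (SOME \<nu>. B \<nu> (\<alpha> i) mod int n = int j)" for j
  define F where "F f = (\<Sum>j<n. sigma_homogeneous i (rep j) (pr j f))" for f
  have pr_add: "pr j (f + h) = pr j f + pr j h" for j f h
    unfolding pr_def by (simp add: char_simps[OF uroot_char[OF i]] distrib_left sum.distrib)
  have pr_K: "pr j f = (if int n dvd B \<nu> (\<alpha> i) - int j then f else 0)" if f: "f \<in> K \<nu>" for j f \<nu>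
  proof -
    have "pr j f = const (1 / of_nat n) * (\<Sum>t<n. const (uroot (int t * (B \<nu> (\<alpha> i) - int j))) * f)"
      unfolding pr_def using f uroot_char[OF i]
      by (simp add: K_iff right_diff_distrib mult.assoc[symmetric] flip: const_mult uroot_add)
    also have "(\<Sum>t<n. const (uroot (int t * (B \<nu> (\<alpha> i) - int j))) * f) = const (\<Sum>t<n. uroot (int t * (B \<nu> (\<alpha> i) - int j))) * f"
      by (simp add: additive_sum[of const, OF const_add] sum_distrib_right)
    also have "const (1 / of_nat n) * \<dots> = const (1 / of_nat n * (\<Sum>t<n. uroot (int t * (B \<nu> (\<alpha> i) - int j)))) * f"
      by (simp only: const_mult mult.assoc)
    finally show ?thesis using n_pos unfolding uroot_sum by auto
  qed
  have F1: "F (f + h) = F f + F h" for f h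
    unfolding F_def by (simp add: pr_add sigma_homogeneous_linear[OF i] sum.distrib)
  have F2: "F f = sigma_homogeneous i \<nu> f" if f: "f \<in> K \<nu>" for f \<nu>
  proof -
    define j0 where "j0 = nat (B \<nu> (\<alpha> i) mod int n)"
    have j0: "j0 < n" "int j0 = B \<nu> (\<alpha> i) mod int n" using n_pos by (simp_all add: j0_def nat_less_iff)
    have j: "int n dvd B \<nu> (\<alpha> i) - int j \<longleftrightarrow> j = j0" if "j < n" for j
      using that j0 by (metis mod_eq_dvd_iff mod_pos_pos_trivial of_nat_0_le_iff of_nat_eq_iff of_nat_less_iff mod_mod_trivial)
    have "F f = (\<Sum>j<n. if j = j0 then sigma_homogeneous i (rep j) f else 0)"
      unfolding F_def pr_K[OF f] using j by (intro sum.cong) (auto simp: sigma_homogeneous_linear[OF i])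
    also have "\<dots> = sigma_homogeneous i (rep j0) f" using j0 by simp
    also have "\<dots> = sigma_homogeneous i \<nu> f"
    proof (rule sigma_homogeneous_cong[OF i])
      have "B (rep j0) (\<alpha> i) mod int n = int j0" unfolding rep_def using j0 by (intro someI) simp
      then show "B (rep j0) (\<alpha> i) mod int n = B \<nu> (\<alpha> i) mod int n" using j0 by simp
    qed
    finally show ?thesis .
  qed
  have "sigma i = F"
    unfolding sigma_def
  proof (rule the_equality)
    show "(\<forall>f h. F (f + h) = F f + F h) \<and> (\<forall>\<nu>. \<forall>f\<in>K \<nu>. F f = sigma_homogeneous i \<nu> f)" using F1 F2 by blast
    fix G assume G: "(\<forall>f h. G (f + h) = G f + G h) \<and> (\<forall>\<nu>. \<forall>f\<in>K \<nu>. G f = sigma_homogeneous i \<nu> f)"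
    show "G = F"
    proof
      fix f
      show "G f = F f"
      proof (induction f rule: homogeneous_induct)
        case (homogeneous \<nu> f)
        then show ?case using G F2 by simp
      next
        case (add f h)
        then show ?case using G F1 by simp
      qed
    qed
  qed
  then show "sigma i (f + h) = sigma i f + sigma i h" "f \<in> K \<nu> \<Longrightarrow> sigma i f = sigma_homogeneous i \<nu> f"
    using F1 F2 by simp_all
qed

lemma sigma_sum: "i \<in> {1..r} \<Longrightarrow> sigma i (sum h A) = (\<Sum>a\<in>A. sigma i (h a))"
  by (rule additive_sum) (rule sigma_spec)

lemma sigma_mult:
  assumes "i \<in> {1..r}" "h \<in> K 0"
  shows "sigma i (h * f) = act (s i) h * sigma i f"
proof (induction f rule: homogeneous_induct)
  case (homogeneous \<nu> f)
  then show ?case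
    using sigma_spec(2)[OF assms(1), of f \<nu>] sigma_spec(2)[OF assms(1), of "h * f" \<nu>] K_0_mult[OF assms(2)]
    by (simp add: sigma_homogeneous_linear(2)[OF assms(1)])
next
  case (add f k)
  then show ?case by (simp add: distrib_left sigma_spec(1)[OF assms(1)])
qed

lemma demazure_eq: "i \<in> {1..r} \<Longrightarrow> demazure i f = dc i * f + dz i * sigma i f"
  by (simp add: demazure_def dc_def dz_def diff_divide_distrib flip: rt_def xx_def)

lemma demazure_lusztig_eq: "i \<in> {1..r} \<Longrightarrow> demazure_lusztig i f = cc v i * f + zz v i * sigma i f"
  unfolding demazure_lusztig_def rt_def[symmetric] xx_def[symmetric]
  by (simp add: demazure_eq dc_def dz_def cc_def zz_def) (simp add: divide_simps, algebra)

lemma demazure_lusztig_sum: "i \<in> {1..r} \<Longrightarrow> demazure_lusztig i (sum h A) = (\<Sum>a\<in>A. demazure_lusztig i (h a))"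
  by (simp add: demazure_lusztig_eq sigma_sum sum_distrib_left sum.distrib)

lemma demazure_lusztig_mult:
  "i \<in> {1..r} \<Longrightarrow> h \<in> K 0 \<Longrightarrow>
    demazure_lusztig i (h * f) = act (s i) h * demazure_lusztig i f + cc v i * (h - act (s i) h) * f"
  by (simp add: demazure_lusztig_eq sigma_mult) (simp add: algebra_simps)

text \<open>The number \<open>k \<nu> + (- k \<nu>) mod m (\<alpha> i)\<close> is the least multiple
  of \<open>m (\<alpha> i)\<close> that is at least \<open>k \<nu>\<close>. Thus the (1 - v) part of
  sigma_i shifts the exponent by a multiple of the rescaled root and combines with the
  \<open>cc\<close> term.\<close>

lemma demazure_lusztig_X:
  assumes i: "i \<in> {1..r}"
  defines "k \<equiv> coroot (\<alpha> i)"
  shows "demazure_lusztig i (X \<nu>) = cc v i * (X \<nu> - X (\<nu> - zscale (k \<nu> + (- k \<nu>) mod m (\<alpha> i)) (\<alpha> i)))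
    + const v * const (g (Q (\<alpha> i) * (1 - k \<nu>))) * X (s i \<nu> + \<alpha> i)"
proof -
  have b: "B \<nu> (\<alpha> i) = k \<nu> * Q (\<alpha> i)" using coroot_B[of "\<alpha> i" \<nu>] i by (simp add: k_def)
  then have d: "B \<nu> (\<alpha> i) div Q (\<alpha> i) = k \<nu>" using Q_nonzero[of "\<alpha> i"] i by simp
  have gg: "Q (\<alpha> i) - B \<nu> (\<alpha> i) = Q (\<alpha> i) * (1 - k \<nu>)" by (simp add: b algebra_simps)
  have s: "s i \<nu> = \<nu> - zscale (k \<nu>) (\<alpha> i)" by (simp add: s_eq_coroot k_def)
  have nz: "1 - const v * xx i \<noteq> 0" "1 - xx i \<noteq> 0"
    using i factor_neq_0[of "\<alpha> i" v] by (simp_all add: xx_def rt_neq_0)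
  have X1: "X (zscale (1 - m (\<alpha> i)) (\<alpha> i)) * xx i = X (\<alpha> i)"
    unfolding xx_def rt_def by (simp add: zscale_diff_left flip: X_add)
  have X2: "X (s i \<nu>) * X (zscale (- ((- k \<nu>) mod m (\<alpha> i))) (\<alpha> i)) = X (\<nu> - zscale (k \<nu> + (- k \<nu>) mod m (\<alpha> i)) (\<alpha> i))"
    by (simp add: s zscale_add_left zscale_minus_left algebra_simps flip: X_add)
  have "sigma i (X \<nu>) = sigma_homogeneous i \<nu> (X \<nu>)" by (rule sigma_spec(2)[OF i K_X])
  also have "\<dots> = X (s i \<nu>) / (1 - const v * xx i) * (X (zscale (- ((- k \<nu>) mod m (\<alpha> i))) (\<alpha> i)) * (1 - const v)
      - const v * const (g (Q (\<alpha> i) * (1 - k \<nu>))) * X (zscale (1 - m (\<alpha> i)) (\<alpha> i)) * (1 - xx i))"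
    using i unfolding sigma_homogeneous_def d gg by (simp flip: rt_def xx_def)
  finally have sg: "sigma i (X \<nu>) = \<dots>" .
  have "zz v i * sigma i (X \<nu>) = - cc v i * (X (s i \<nu>) * X (zscale (- ((- k \<nu>) mod m (\<alpha> i))) (\<alpha> i)))
      + const v * const (g (Q (\<alpha> i) * (1 - k \<nu>))) * (X (s i \<nu>) * (X (zscale (1 - m (\<alpha> i)) (\<alpha> i)) * xx i))"
    unfolding sg zz_def cc_def using nz by (simp add: divide_simps) algebra
  also have "X (s i \<nu>) * (X (zscale (1 - m (\<alpha> i)) (\<alpha> i)) * xx i) = X (s i \<nu> + \<alpha> i)"
    unfolding X1 X_add ..
  finally show ?thesis unfolding demazure_lusztig_eq[OF i] X2 by (simp add: algebra_simps)
qed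

lemma g_mult_n: "int n dvd j \<Longrightarrow> g j = - 1"
  using g_periodic[of j] g_0 by (simp add: dvd_eq_mod_eq_0)

lemma g_inverse: "\<not> int n dvd j \<Longrightarrow> g j * g (- j) = inverse v"
proof -
  assume j: "\<not> int n dvd j"
  let ?j = "j mod int n"
  have "?j \<noteq> 0" "0 \<le> ?j" "?j < int n" using j n_pos by (simp_all add: dvd_eq_mod_eq_0)
  then have "g ?j * g (int n - ?j) = inverse v" by (intro g_mult) linarith+
  moreover have "g (int n - ?j) = g (- j)"
    using g_periodic[of "int n - ?j"] g_periodic[of "- j"] by (simp add: mod_simps)
  ultimately show ?thesis using g_periodic[of j] by simp
qed

text \<open>Here \<open>k \<nu> - 1\<close> is the pairing of \<open>\<nu> - \<rho>\<close> with the coroot, where \<open>\<rho>\<close> is half the sum of the positive roots.\<close>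

lemma demazure_lusztig_X_cases:
  assumes i: "i \<in> {1..r}"
  defines "k \<equiv> coroot (\<alpha> i)"
  shows "- m (\<alpha> i) \<le> k \<nu> - 1 \<Longrightarrow> k \<nu> - 1 < 0 \<Longrightarrow>
      demazure_lusztig i (X \<nu>) = const v * const (g (Q (\<alpha> i) * (1 - k \<nu>))) * X (s i \<nu> + \<alpha> i)"
    and "k \<nu> - 1 = 0 \<Longrightarrow> demazure_lusztig i (X \<nu>) = - X \<nu>"
    and "0 < k \<nu> - 1 \<Longrightarrow> k \<nu> - 1 < m (\<alpha> i) \<Longrightarrow>
      demazure_lusztig i (X \<nu>) = const v * const (g (Q (\<alpha> i) * (1 - k \<nu>))) * X (s i \<nu> + \<alpha> i) - (1 - const v) * X \<nu>"
    and "k \<nu> - 1 = m (\<alpha> i) \<Longrightarrow> demazure_lusztig i (X \<nu>) = - X (s i \<nu> + \<alpha> i) - (1 - const v) * X \<nu>"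
proof -
  let ?m = "m (\<alpha> i)"
  have mp: "0 < ?m" using m_pos i by simp
  note T = demazure_lusztig_X[OF i, of \<nu>, folded k_def]
  have nz: "xx i \<noteq> 0" "1 - xx i \<noteq> 0" using i by simp_all
  have s: "s i \<nu> + \<alpha> i = \<nu> - zscale (k \<nu> - 1) (\<alpha> i)"
    by (simp add: s_eq_coroot k_def zscale_diff_left)
  have X1: "X (\<nu> - zscale ?m (\<alpha> i)) = X \<nu> / xx i" by (simp add: X_diff xx_def rt_def)
  have mid: "demazure_lusztig i (X \<nu>) = const v * const (g (Q (\<alpha> i) * (1 - k \<nu>))) * X (s i \<nu> + \<alpha> i) - (1 - const v) * X \<nu>"
    if h: "0 \<le> k \<nu> - 1" "k \<nu> - 1 < ?m"
  proof -
    have "(- k \<nu>) mod ?m = (?m - k \<nu> + (- 1) * ?m) mod ?m" by simp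
    also have "\<dots> = ?m - k \<nu>" unfolding mod_mult_self1 using h mp by (intro mod_pos_pos_trivial) auto
    finally have "(- k \<nu>) mod ?m = ?m - k \<nu>" .
    then have e: "k \<nu> + (- k \<nu>) mod ?m = ?m" by simp
    show ?thesis unfolding T e X1 cc_def using nz by (simp add: divide_simps) algebra
  qed
  show "demazure_lusztig i (X \<nu>) = const v * const (g (Q (\<alpha> i) * (1 - k \<nu>))) * X (s i \<nu> + \<alpha> i)"
    if "- ?m \<le> k \<nu> - 1" "k \<nu> - 1 < 0"
  proof -
    have "(- k \<nu>) mod ?m = - k \<nu>" using that by (intro mod_pos_pos_trivial) auto
    then show ?thesis unfolding T by simp
  qed
  show "demazure_lusztig i (X \<nu>) = - X \<nu>" if h: "k \<nu> - 1 = 0"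
  proof -
    have "s i \<nu> + \<alpha> i = \<nu>" unfolding s h by simp
    moreover have "g (Q (\<alpha> i) * (1 - k \<nu>)) = - 1" using h g_0 by simp
    ultimately have "demazure_lusztig i (X \<nu>) = const v * const (- 1) * X \<nu> - (1 - const v) * X \<nu>"
      using mid h mp by simp
    then show ?thesis by (simp add: const_minus left_diff_distrib)
  qed
  show "demazure_lusztig i (X \<nu>) = const v * const (g (Q (\<alpha> i) * (1 - k \<nu>))) * X (s i \<nu> + \<alpha> i) - (1 - const v) * X \<nu>"
    if "0 < k \<nu> - 1" "k \<nu> - 1 < ?m" using mid that by simp
  show "demazure_lusztig i (X \<nu>) = - X (s i \<nu> + \<alpha> i) - (1 - const v) * X \<nu>" if h: "k \<nu> - 1 = ?m"
  proof -
    \<comment> \<open>At k = m + 1 rounding up jumps to 2m. The extra shift adds -(1 - v) to the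
      coefficient of the reflected monomial, where the g-term gives -v, so that the total is
      -1.\<close>
    have "(- k \<nu>) mod ?m = (?m - 1 + (- 2) * ?m) mod ?m" using h by (simp add: algebra_simps)
    also have "\<dots> = ?m - 1" unfolding mod_mult_self1 using mp by (intro mod_pos_pos_trivial) auto
    finally have e: "k \<nu> + (- k \<nu>) mod ?m = ?m + ?m" using h by simp
    have "int n dvd Q (\<alpha> i) * (1 - k \<nu>)"
      using n_dvd_m_Q[of "\<alpha> i"] h by (metis dvd_minus_iff minus_diff_eq mult.commute mult_minus_right)
    then have gm: "g (Q (\<alpha> i) * (1 - k \<nu>)) = - 1" by (rule g_mult_n)
    have X2: "X (\<nu> - zscale (?m + ?m) (\<alpha> i)) = X \<nu> / (xx i * xx i)"
      by (simp only: X_diff X_add zscale_add_left xx_def rt_def)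
    have X3: "X (s i \<nu> + \<alpha> i) = X \<nu> / xx i" unfolding s h X1 ..
    show ?thesis unfolding T e gm X2 X3 cc_def using nz by (simp add: const_minus divide_simps) algebra
  qed
qed

subsection \<open>Small weights\<close>

definition two_rho :: 'a where
  "two_rho = (\<Sum>\<beta>\<in>positive_roots. \<beta>)"

text \<open>As \<open>\<rho>\<close> need not lie in the lattice, the sum \<open>rho_diff w\<close> stands for \<open>\<rho> - w \<rho>\<close>, so that \<open>dot w \<mu>\<close> is
  \<open>w (\<mu> - \<rho>) + \<rho>\<close>.\<close>

definition rho_diff :: "('a \<Rightarrow> 'a) \<Rightarrow> 'a" where
  "rho_diff w = (\<Sum>\<beta>\<in>left_invs w. \<beta>)"

definition dot :: "('a \<Rightarrow> 'a) \<Rightarrow> 'a \<Rightarrow> 'a" where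
  "dot w \<mu> = w \<mu> + rho_diff w"

lemma s_two_rho: "i \<in> {1..r} \<Longrightarrow> s i two_rho = two_rho - \<alpha> i - \<alpha> i"
proof -
  assume i: "i \<in> {1..r}"
  have D: "two_rho = \<alpha> i + (\<Sum>\<beta>\<in>positive_roots - {\<alpha> i}. \<beta>)"
    unfolding two_rho_def using i by (intro sum.remove) auto
  have "(\<Sum>\<beta>\<in>positive_roots - {\<alpha> i}. s i \<beta>) = (\<Sum>\<beta>\<in>positive_roots - {\<alpha> i}. \<beta>)"
    by (rule sum.reindex_bij_witness[where i = "s i" and j = "s i"]) (use s_pos_diff[OF i] i in auto)
  then show ?thesis unfolding D using i by (simp add: W_simps s_simple)
qed

lemma coroot_two_rho: "i \<in> {1..r} \<Longrightarrow> coroot (\<alpha> i) two_rho = 2"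
proof -
  assume i: "i \<in> {1..r}"
  have "zscale (coroot (\<alpha> i) two_rho) (\<alpha> i) = zscale 2 (\<alpha> i)"
    using s_two_rho[OF i] by (simp add: s_eq_coroot zscale_2 algebra_simps)
  moreover have "\<alpha> i \<noteq> 0" using zero_not_root simple_root[OF i] by metis
  ultimately show ?thesis by (simp add: zscale_cancel_right)
qed

lemma rho_diff_up:
  assumes i: "i \<in> {1..r}" and w: "w \<in> W" "up i w"
  shows "rho_diff (s i \<circ> w) = s i (rho_diff w) + \<alpha> i"
proof -
  have fin: "finite (left_invs w)" unfolding left_invs_def by simp
  have inj: "inj_on (s i) (left_invs w)" using W_inj[OF s_in_W[OF i]] by (simp add: inj_on_def)
  have "rho_diff (s i \<circ> w) = \<alpha> i + (\<Sum>\<beta>\<in>s i ` left_invs w. \<beta>)"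
    unfolding rho_diff_def left_invs_up(1)[OF i w] using left_invs_up(2)[OF i w] fin by simp
  also have "(\<Sum>\<beta>\<in>s i ` left_invs w. \<beta>) = s i (rho_diff w)"
    using inj i by (simp add: rho_diff_def W_linear(5) sum.reindex)
  finally show ?thesis by (simp only: add.commute)
qed

lemma dot_up: "i \<in> {1..r} \<Longrightarrow> w \<in> W \<Longrightarrow> up i w \<Longrightarrow> dot (s i \<circ> w) \<mu> = s i (dot w \<mu>) + \<alpha> i"
  by (simp only: dot_def rho_diff_up W_add[OF s_in_W] comp_apply add.assoc)

lemma dot_shift: "w \<in> W \<Longrightarrow> dot w \<mu> + dot w \<mu> - two_rho = w (\<mu> + \<mu> - two_rho)"
proof (induction rule: W_induct)
  case id
  have "left_invs id = {}" unfolding left_invs_def inv_id by simp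
  then have "dot id \<mu> = \<mu>" by (simp add: dot_def rho_diff_def)
  then show ?case by (simp add: id_def)
next
  case (step i w)
  have "dot (s i \<circ> w) \<mu> + dot (s i \<circ> w) \<mu> - two_rho = s i (dot w \<mu> + dot w \<mu> - two_rho)"
    unfolding dot_up[OF step(1-3)] using s_two_rho[OF step(1)] step(1) by (simp add: W_simps algebra_simps)
  then show ?case using step.IH by (simp add: comp_def)
qed

lemma double_cancel: "(x :: 'a) + x = y + y \<Longrightarrow> x = y"
  using zscale_cancel_left[of 2 x y] by (simp add: zscale_2)

text \<open>In terms of \<mu> - \<rho>: antidominant, with pairings at least
  \<open>- m \<gamma>\<close>. Both ends are included, and every pairing met along the dot orbit
  then falls under a case of \<open>demazure_lusztig_X_cases\<close>.\<close>

definition small :: "'a \<Rightarrow> bool" where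
  "small \<mu> \<longleftrightarrow> (\<forall>\<gamma>\<in>positive_roots.
     - 2 * m \<gamma> \<le> coroot \<gamma> (\<mu> + \<mu> - two_rho) \<and> coroot \<gamma> (\<mu> + \<mu> - two_rho) \<le> 0)"

text \<open>In a coset of \<open>Lambda0\<close>, a weight at minimal distance from \<open>\<rho>\<close> is small up to the dot action.\<close>

lemma exists_small:
  obtains \<mu> w \<kappa> where "small \<mu>" "w \<in> W" "\<kappa> \<in> Lambda0" "\<tau> = dot w \<mu> + \<kappa>"
proof -
  define y where "y \<kappa> = (\<tau> - \<kappa>) + (\<tau> - \<kappa>) - two_rho" for \<kappa>
  have "0 \<in> Lambda0" by (simp add: Lambda0_def B_simps)
  then obtain \<kappa> where k: "\<kappa> \<in> Lambda0" "\<And>\<kappa>'. \<kappa>' \<in> Lambda0 \<Longrightarrow> nat (ip (y \<kappa>) (y \<kappa>)) \<le> nat (ip (y \<kappa>') (y \<kappa>'))"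
    using ex_has_least_nat[of "\<lambda>\<kappa>. \<kappa> \<in> Lambda0" 0 "\<lambda>\<kappa>. nat (ip (y \<kappa>) (y \<kappa>))"] by blast
  define Y where "Y = y \<kappa>"
  \<comment> \<open>Moving \<kappa> by \<open>rt \<gamma>\<close> cannot shorten \<open>Y\<close>;
    expanding the norm bounds the pairing with \<gamma>.\<close>
  have bound: "coroot \<gamma> Y \<le> 2 * m \<gamma>" if g: "\<gamma> \<in> \<Phi>" for \<gamma>
  proof -
    have "\<kappa> + rt \<gamma> \<in> Lambda0" using k(1) rt_Lambda0[OF g] by (simp add: Lambda0_def B_simps)
    then have "ip Y Y \<le> ip (y (\<kappa> + rt \<gamma>)) (y (\<kappa> + rt \<gamma>))"
      using k(2)[of "\<kappa> + rt \<gamma>"] ip_nonneg[of "y (\<kappa> + rt \<gamma>)"] ip_nonneg[of Y] by (simp add: Y_def)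
    also have "y (\<kappa> + rt \<gamma>) = Y - rt \<gamma> - rt \<gamma>" by (simp add: Y_def y_def algebra_simps)
    finally have "ip Y (rt \<gamma>) \<le> ip (rt \<gamma>) (rt \<gamma>)" by (simp add: ip_simps ip_sym[of "rt \<gamma>" Y])
    then have "m \<gamma> * (2 * ip Y \<gamma>) \<le> m \<gamma> * (2 * m \<gamma> * ip \<gamma> \<gamma>)" by (simp add: rt_def ip_simps)
    then have "2 * ip Y \<gamma> \<le> 2 * m \<gamma> * ip \<gamma> \<gamma>" using m_pos[OF g] by simp
    then have "coroot \<gamma> Y * ip \<gamma> \<gamma> \<le> (2 * m \<gamma>) * ip \<gamma> \<gamma>" unfolding ip_coroot[OF g] .
    then show ?thesis using ip_root_pos[OF g] by simp
  qed
  obtain u where u: "u \<in> W" "\<forall>i\<in>{1..r}. coroot (\<alpha> i) (u (- Y)) \<ge> 0" using exists_dominant by blast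
  define \<mu> where "\<mu> = dot u (\<tau> - \<kappa>)"
  have d: "\<mu> + \<mu> - two_rho = u Y" using dot_shift[OF u(1), of "\<tau> - \<kappa>"] by (simp add: \<mu>_def Y_def y_def)
  have "small \<mu>"
    unfolding small_def d
  proof
    fix \<gamma> assume g: "\<gamma> \<in> positive_roots"
    then have gr: "\<gamma> \<in> \<Phi>" by simp
    have "0 \<le> coroot \<gamma> (u (- Y))" by (rule dominant_positive[OF u(2) g])
    then have 1: "coroot \<gamma> (u Y) \<le> 0" using gr u(1) by (simp add: W_linear coroot_linear)
    have ig: "- inv u \<gamma> \<in> \<Phi>" using u gr by (simp add: inv_in_W)
    have "coroot (- inv u \<gamma>) Y \<le> 2 * m (- inv u \<gamma>)" by (rule bound[OF ig])
    moreover have "coroot (- inv u \<gamma>) Y = - coroot \<gamma> (u Y)"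
      using coroot_minus[of "inv u \<gamma>" Y] coroot_W'[OF u(1) gr, of Y] ig by simp
    moreover have "m (- inv u \<gamma>) = m \<gamma>" using m_minus[of "inv u \<gamma>"] ig m_W[OF inv_in_W[OF u(1)]] by simp
    ultimately show "- 2 * m \<gamma> \<le> coroot \<gamma> (u Y) \<and> coroot \<gamma> (u Y) \<le> 0" using 1 by simp
  qed
  moreover have "inv u \<in> W" using u by (simp add: inv_in_W)
  moreover have "\<tau> = dot (inv u) \<mu> + \<kappa>"
  proof -
    have "dot (inv u) \<mu> + dot (inv u) \<mu> - two_rho = (\<tau> - \<kappa>) + (\<tau> - \<kappa>) - two_rho"
      unfolding dot_shift[OF \<open>inv u \<in> W\<close>] d using u(1) by (simp add: Y_def y_def)
    then have "dot (inv u) \<mu> + dot (inv u) \<mu> = (\<tau> - \<kappa>) + (\<tau> - \<kappa>)" by (simp only: diff_eq_eq diff_add_cancel)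
    then have "dot (inv u) \<mu> = \<tau> - \<kappa>" by (rule double_cancel)
    then show ?thesis by simp
  qed
  ultimately show thesis using that k(1) by blast
qed

text \<open>The factor of the reflected monomial when T_i is applied at pairing d of \<mu> - \<rho>
  with \<gamma>, namely v g(-Q d). At d = 0 this formula would give -v, because g_0 is -1; but there
  T_i acts as -1, hence the separate case.\<close>

definition kappa :: "'a \<Rightarrow> 'a \<Rightarrow> complex" where
  "kappa \<mu> \<gamma> = (if coroot \<gamma> (\<mu> + \<mu> - two_rho) = 0 then - 1
     else v * g (- Q \<gamma> * (coroot \<gamma> (\<mu> + \<mu> - two_rho) div 2)))"

text \<open>The roots \<open>- inv w \<beta>\<close> are the positive roots that \<open>w\<close>
  makes negative, one for each letter of a reduced word.\<close>

definition kappa_prod :: "'a \<Rightarrow> ('a \<Rightarrow> 'a) \<Rightarrow> complex" where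
  "kappa_prod \<mu> w = (\<Prod>\<beta>\<in>left_invs w. kappa \<mu> (- inv w \<beta>))"

text \<open>The constants make the \<open>basis_vec \<mu> w\<close>, for small \<open>\<mu>\<close>, transform like the basis \<open>e\<^sub>w\<close> of the
  periodic Hecke module.\<close>

definition basis_vec :: "'a \<Rightarrow> ('a \<Rightarrow> 'a) \<Rightarrow> 'a ratfun" where
  "basis_vec \<mu> w = const (kappa_prod \<mu> w) * X (dot w \<mu>)"

lemma kappa_prod_neq_0: "kappa_prod \<mu> w \<noteq> 0"
proof -
  have "finite (left_invs w)" by (simp add: left_invs_def)
  then show ?thesis unfolding kappa_prod_def kappa_def using v_nonzero g_nonzero by (subst prod_zero_iff) auto
qed

lemma kappa_prod_up:
  assumes i: "i \<in> {1..r}" and w: "w \<in> W" "up i w"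
  shows "kappa_prod \<mu> (s i \<circ> w) = kappa \<mu> (inv w (\<alpha> i)) * kappa_prod \<mu> w"
proof -
  have fin: "finite (left_invs w)" unfolding left_invs_def by simp
  have inj: "inj_on (s i) (left_invs w)" using W_inj[OF s_in_W[OF i]] by (simp add: inj_on_def)
  have inv: "inv (s i \<circ> w) \<beta> = inv w (s i \<beta>)" for \<beta> by (rule inv_comp_s[OF i w(1)])
  show ?thesis
    unfolding kappa_prod_def left_invs_up(1)[OF i w] inv
    using left_invs_up(2)[OF i w] fin inj i w
    by (simp add: prod.reindex s_simple W_linear inv_in_W)
qed

lemma quadratic_step:
  fixes p q :: "'b :: comm_ring_1"
  shows "p * (q * c) = q \<Longrightarrow> p * (q * c * a - (1 - q) * b) = q * a - (1 - q) * (p * b)"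
proof -
  assume h: "p * (q * c) = q"
  have "p * (q * c * a - (1 - q) * b) = p * (q * c) * a - (1 - q) * (p * b)" by (simp add: algebra_simps)
  then show ?thesis unfolding h .
qed

lemma quadratic_step_unit:
  fixes p q :: "'b :: comm_ring_1"
  shows "p = - q \<Longrightarrow> p * (- a - (1 - q) * b) = q * a - (1 - q) * (p * b)"
  by (simp add: algebra_simps)

lemma quadratic_step_scale:
  fixes p q :: "'b :: comm_ring_1"
  assumes "p * t = q * a - (1 - q) * (p * b)"
  shows "p * k * t = q * (k * a) - (1 - q) * (p * k * b)"
proof -
  have "p * k * t = k * (p * t)" by (simp add: ac_simps)
  then show ?thesis unfolding assms by (simp add: algebra_simps)
qed

text \<open>Upwards, \<open>kappa\<close> is the factor produced by T_i. Downwards, T_i has to undo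
  an upward step: for d strictly between 0 and \<open>m (\<alpha> i)\<close> the two factors
  multiply to v because g_j g_{-j} = 1/v, and at both ends the exceptional cases of T_i agree with
  \<open>kappa\<close>.\<close>

lemma basis_vec_step:
  assumes i: "i \<in> {1..r}" and w: "w \<in> W" and small: "small \<mu>"
  shows "up i w \<Longrightarrow> demazure_lusztig i (basis_vec \<mu> w) = basis_vec \<mu> (s i \<circ> w)"
    and "\<not> up i w \<Longrightarrow> demazure_lusztig i (basis_vec \<mu> w) = const v * basis_vec \<mu> (s i \<circ> w) - (1 - const v) * basis_vec \<mu> w"
proof -
  define y where "y = \<mu> + \<mu> - two_rho"
  define \<nu> where "\<nu> = dot w \<mu>"
  define \<gamma> where "\<gamma> = inv w (\<alpha> i)"
  define d where "d = coroot (\<alpha> i) \<nu> - 1"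
  have T_const: "demazure_lusztig i (const c * f) = const c * demazure_lusztig i f" for c f
    using demazure_lusztig_mult[OF i K_const] i by simp
  have g: "\<gamma> \<in> \<Phi>" using w i by (simp add: \<gamma>_def inv_in_W)
  have wg: "w \<gamma> = \<alpha> i" using w by (simp add: \<gamma>_def)
  have mg: "m \<gamma> = m (\<alpha> i)" "Q \<gamma> = Q (\<alpha> i)" using m_W[OF w, of \<gamma>] invariant[OF w, of \<gamma>] wg by simp_all
  have e: "coroot \<gamma> y = 2 * d"
  proof -
    have "coroot \<gamma> y = coroot (\<alpha> i) (w y)" using coroot_W[OF w g, of y] wg by simp
    also have "w y = \<nu> + \<nu> - two_rho" unfolding y_def \<nu>_def dot_shift[OF w] ..
    also have "coroot (\<alpha> i) (\<nu> + \<nu> - two_rho) = 2 * d"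
      using i coroot_two_rho[OF i] by (simp add: coroot_simps d_def)
    finally show ?thesis .
  qed
  have mpos: "0 < m (\<alpha> i)" using m_pos i by simp
  have k1: "1 - coroot (\<alpha> i) \<nu> = - d" by (simp add: d_def)
  note T = demazure_lusztig_X_cases[OF i, of \<nu>, folded d_def, unfolded k1]
  show "demazure_lusztig i (basis_vec \<mu> w) = basis_vec \<mu> (s i \<circ> w)" if u: "up i w"
  proof -
    have gp: "\<gamma> \<in> positive_roots" using u by (simp add: up_def \<gamma>_def)
    have b: "- m (\<alpha> i) \<le> d" "d \<le> 0" using bspec[OF small[unfolded small_def] gp, folded y_def] unfolding e mg by linarith+
    have dd: "dot (s i \<circ> w) \<mu> = s i \<nu> + \<alpha> i" unfolding \<nu>_def by (rule dot_up[OF i w u])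
    have kp: "kappa_prod \<mu> (s i \<circ> w) = kappa \<mu> \<gamma> * kappa_prod \<mu> w"
      unfolding \<gamma>_def by (rule kappa_prod_up[OF i w u])
    have "demazure_lusztig i (X \<nu>) = const (kappa \<mu> \<gamma>) * X (s i \<nu> + \<alpha> i)"
    proof (cases "d = 0")
      case True
      have "s i \<nu> + \<alpha> i = \<nu>" using True by (simp add: s_eq_coroot d_def)
      then show ?thesis using T(2)[OF True] e True by (simp add: kappa_def const_minus flip: y_def)
    next
      case False
      then have "kappa \<mu> \<gamma> = v * g (Q (\<alpha> i) * - d)" using e by (simp add: kappa_def mg flip: y_def)
      then show ?thesis using T(1) b False by (simp add: const_mult)
    qed
    then show ?thesis unfolding basis_vec_def T_const kp dd \<nu>_def[symmetric] const_mult by (simp only: ac_simps)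
  qed
  show "demazure_lusztig i (basis_vec \<mu> w) = const v * basis_vec \<mu> (s i \<circ> w) - (1 - const v) * basis_vec \<mu> w" if u: "\<not> up i w"
  proof -
    let ?w = "s i \<circ> w"
    have w': "?w \<in> W" "up i ?w" using i w up_s[OF i w] u by (simp_all add: W_comp)
    have ig: "inv ?w (\<alpha> i) = - \<gamma>" using inv_comp_s[OF i w, of "\<alpha> i"] i w by (simp add: s_simple W_linear inv_in_W \<gamma>_def)
    have gp: "- \<gamma> \<in> positive_roots" using u not_up[OF i w] by (simp add: \<gamma>_def)
    have cm: "coroot (- \<gamma>) y = - 2 * d" using e coroot_minus[OF g] by simp
    have b: "0 \<le> d" "d \<le> m (\<alpha> i)"
      using bspec[OF small[unfolded small_def] gp, folded y_def] unfolding cm m_minus[OF g] mg by linarith+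
    have kp: "kappa_prod \<mu> w = kappa \<mu> (- \<gamma>) * kappa_prod \<mu> ?w"
      using kappa_prod_up[OF i w', of \<mu>] unfolding s_comp_s[OF i] ig .
    have dd: "\<nu> = s i (dot ?w \<mu>) + \<alpha> i"
      using dot_up[OF i w', of \<mu>] unfolding s_comp_s[OF i] \<nu>_def .
    then have dd': "dot ?w \<mu> = s i \<nu> + \<alpha> i" using i by (simp add: W_add s_simple)
    have Qm: "Q (- \<gamma>) = Q (\<alpha> i)" using invariant[OF refl_in_W[OF g], of \<gamma>] g mg by (simp add: refl_self)
    have kap: "kappa \<mu> (- \<gamma>) = (if d = 0 then - 1 else v * g (Q (\<alpha> i) * d))"
    proof -
      have "(- 2 * d) div 2 = - d" by presburger
      then show ?thesis using cm by (simp add: kappa_def Qm flip: y_def)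
    qed
    have "const (kappa \<mu> (- \<gamma>)) * demazure_lusztig i (X \<nu>) =
      const v * X (s i \<nu> + \<alpha> i) - (1 - const v) * (const (kappa \<mu> (- \<gamma>)) * X \<nu>)"
    proof -
      consider "d = 0" | "0 < d" "d < m (\<alpha> i)" | "d = m (\<alpha> i)" using b by linarith
      then show ?thesis
      proof cases
        case 1
        have "s i \<nu> + \<alpha> i = \<nu>" using 1 by (simp add: s_eq_coroot d_def)
        then show ?thesis using T(2)[OF 1] 1 by (simp add: kap const_minus algebra_simps)
      next
        case 2
        have "\<not> m (\<alpha> i) dvd d" using 2 zdvd_not_zless by blast
        then have "\<not> int n dvd Q (\<alpha> i) * d" using m_dvd_iff[of "\<alpha> i" d] i by (simp add: mult.commute)
        then have "g (Q (\<alpha> i) * d) * g (Q (\<alpha> i) * - d) = inverse v" using g_inverse by simp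
        then have "v * g (Q (\<alpha> i) * d) * (v * g (Q (\<alpha> i) * - d)) = v" using v_nonzero by (simp add: ac_simps)
        then have "const (kappa \<mu> (- \<gamma>)) * (const v * const (g (Q (\<alpha> i) * - d))) = const v"
          using 2 by (simp add: kap flip: const_mult)
        then show ?thesis unfolding T(3)[OF 2] by (rule quadratic_step)
      next
        case 3
        have "int n dvd Q (\<alpha> i) * d" unfolding 3 using n_dvd_m_Q[of "\<alpha> i"] by (simp only: mult.commute)
        then have "g (Q (\<alpha> i) * d) = - 1" by (rule g_mult_n)
        moreover have "d \<noteq> 0" using 3 mpos by linarith
        ultimately have "kappa \<mu> (- \<gamma>) = - v" unfolding kap by simp
        then have "const (kappa \<mu> (- \<gamma>)) = - const v" by (simp only: const_minus)
        then show ?thesis unfolding T(4)[OF 3] by (rule quadratic_step_unit)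
      qed
    qed
    from quadratic_step_scale[OF this, of "const (kappa_prod \<mu> ?w)"]
    show ?thesis unfolding basis_vec_def T_const kp dd' \<nu>_def[symmetric] unfolding T_const unfolding const_mult .
  qed
qed

subsection \<open>The Weyl group action\<close>

lemma left_op_K_0:
  assumes i: "i \<in> {1..r}" and \<phi>: "\<And>w. \<phi> w \<in> K 0"
  shows "left_op q i \<phi> w \<in> K 0"
  unfolding left_op_def using i \<phi>
  by (simp add: K_add K_diff K_0_mult K_const K_0_1 K_zero K_0_act coeffs_K_0)

lemma hat_K_0: "i \<in> {1..r} \<Longrightarrow> (\<And>w. \<phi> w \<in> K 0) \<Longrightarrow> hat i \<phi> w \<in> K 0"
  unfolding hat_def by (simp add: K_diff K_0_mult K_0_divide K_zero coeffs_K_0 left_op_K_0)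

lemma sigma_basis:
  assumes i: "i \<in> {1..r}" and small: "small \<mu>" and \<phi>: "\<And>w. \<phi> w \<in> K 0"
  shows "sigma i (\<Sum>w\<in>W. \<phi> w * basis_vec \<mu> w) = (\<Sum>w\<in>W. hat i \<phi> w * basis_vec \<mu> w)"
proof (rule hat_intertwine[OF i])
  have "demazure_lusztig i (\<Sum>w\<in>W. \<phi> w * basis_vec \<mu> w) = (\<Sum>w\<in>W. left_op v i \<phi> w * basis_vec \<mu> w)"
  proof (rule intertwine[OF i, where S = "K 0"])
    show "demazure_lusztig i (\<Sum>w\<in>W. h w) = (\<Sum>w\<in>W. demazure_lusztig i (h w))" for h
      by (rule demazure_lusztig_sum[OF i])
    show "demazure_lusztig i (h * f) = act (s i) h * demazure_lusztig i f + cc v i * (h - act (s i) h) * f"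
      if "h \<in> K 0" for h f using that by (rule demazure_lusztig_mult[OF i])
  qed (rule basis_vec_step[OF i _ small] \<phi>; assumption?)+
  then show "cc v i * (\<Sum>w\<in>W. \<phi> w * basis_vec \<mu> w) + zz v i * sigma i (\<Sum>w\<in>W. \<phi> w * basis_vec \<mu> w) =
      (\<Sum>w\<in>W. left_op v i \<phi> w * basis_vec \<mu> w)"
    unfolding demazure_lusztig_eq[OF i] .
qed

section \<open>Words in the metaplectic reflections\<close>

definition sigma_word :: "nat list \<Rightarrow> 'a ratfun \<Rightarrow> 'a ratfun" where
  "sigma_word js f = foldr sigma js f"

lemma sigma_word_simps: "sigma_word [] f = f" "sigma_word (i # js) f = sigma i (sigma_word js f)"
  "sigma_word (as @ bs) f = sigma_word as (sigma_word bs f)"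
  by (simp_all add: sigma_word_def)

lemma sigma_word_add: "set js \<subseteq> {1..r} \<Longrightarrow> sigma_word js (f + h) = sigma_word js f + sigma_word js h"
  by (induction js) (simp_all add: sigma_word_simps sigma_spec(1))

lemma sigma_word_basis:
  assumes small: "small \<mu>" and \<phi>: "\<And>w. \<phi> w \<in> K 0" and js: "set js \<subseteq> {1..r}"
  shows "(\<forall>w. foldr hat js \<phi> w \<in> K 0) \<and>
    sigma_word js (\<Sum>w\<in>W. \<phi> w * basis_vec \<mu> w) = (\<Sum>w\<in>W. foldr hat js \<phi> w * basis_vec \<mu> w)"
  using js
proof (induction js)
  case Nil
  then show ?case using \<phi> by (simp add: sigma_word_simps)
next
  case (Cons i js)
  then have i: "i \<in> {1..r}" and K: "foldr hat js \<phi> w \<in> K 0" for w by simp_all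
  have IH: "sigma_word js (\<Sum>w\<in>W. \<phi> w * basis_vec \<mu> w) = (\<Sum>w\<in>W. foldr hat js \<phi> w * basis_vec \<mu> w)"
    using Cons by simp
  show ?case
    unfolding sigma_word_simps IH sigma_basis[OF i small K] using hat_K_0[OF i K] by simp
qed

text \<open>A homogeneous function is a degree 0 multiple of one \<open>basis_vec \<mu> w\<close>,
  the \<open>Lambda0\<close> part of its degree being absorbed into the scalar. On such multiples
  the word acts through the \<open>hat\<close> operators, where the relation is known.\<close>

lemma sigma_word_id:
  assumes js: "set js \<subseteq> {1..r}" "word_prod js = id"
  shows "sigma_word js f = f"
proof (induction f rule: homogeneous_induct)
  case (homogeneous \<tau> f)
  obtain \<mu> w \<kappa> where d: "small \<mu>" "w \<in> W" "\<kappa> \<in> Lambda0" "\<tau> = dot w \<mu> + \<kappa>" by (rule exists_small)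
  define h where "h = f * X (- \<tau>) * X \<kappa> * const (1 / kappa_prod \<mu> w)"
  define \<phi> where "\<phi> u = (if u = w then h else 0)" for u
  have f0: "f * X (- \<tau>) \<in> K 0" using K_mult[OF homogeneous K_X[of "- \<tau>"]] by simp
  have "h \<in> K 0" unfolding h_def by (rule K_0_mult[OF K_0_mult[OF f0 X_K_0[OF d(3)]] K_const])
  then have \<phi>: "\<phi> u \<in> K 0" for u by (simp add: \<phi>_def K_zero)
  have "X (- \<tau>) * X \<kappa> * X (dot w \<mu>) = 1" unfolding X_add[symmetric] d(4) by simp
  moreover have "const (1 / kappa_prod \<mu> w) * const (kappa_prod \<mu> w) = (1 :: 'a ratfun)"
    using kappa_prod_neq_0[of \<mu> w] by (simp flip: const_mult)
  ultimately have "f = f * (X (- \<tau>) * X \<kappa> * X (dot w \<mu>)) * (const (1 / kappa_prod \<mu> w) * const (kappa_prod \<mu> w))"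
    by (simp only: mult_1_right)
  also have "\<dots> = h * basis_vec \<mu> w" unfolding h_def basis_vec_def by (simp only: ac_simps)
  also have "\<dots> = (\<Sum>u\<in>{w}. \<phi> u * basis_vec \<mu> u)" by (simp add: \<phi>_def)
  also have "\<dots> = (\<Sum>u\<in>W. \<phi> u * basis_vec \<mu> u)"
    using finite_W d(2) by (intro sum.mono_neutral_left) (auto simp: \<phi>_def)
  finally have f: "f = \<dots>" .
  have "foldr hat js \<phi> = \<phi>" using d(2) by (intro hat_word[OF js]) (auto simp: \<phi>_def)
  then have "sigma_word js (\<Sum>u\<in>W. \<phi> u * basis_vec \<mu> u) = (\<Sum>u\<in>W. \<phi> u * basis_vec \<mu> u)"
    using sigma_word_basis[OF d(1) \<phi> js(1)] by simp
  then show ?case unfolding f[symmetric] .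
next
  case (add f h)
  then show ?case by (simp add: sigma_word_add[OF js(1)])
qed

lemma sigma_word_cong:
  assumes "set as \<subseteq> {1..r}" "set bs \<subseteq> {1..r}" "word_prod as = word_prod bs"
  shows "sigma_word as f = sigma_word bs f"
proof -
  have r: "word_prod (rev bs @ as) = id"
    using word_rev[OF assms(2)] by (simp add: fun_eq_iff word_prod_append assms(3))
  have "word_prod (bs @ rev bs) = id"
    using word_rev[of "rev bs"] assms(2) by (simp add: fun_eq_iff word_prod_append)
  then have "sigma_word as f = sigma_word (bs @ rev bs) (sigma_word as f)"
    using assms by (intro sigma_word_id[symmetric]) simp_all
  also have "\<dots> = sigma_word bs (sigma_word (rev bs @ as) f)" by (simp only: sigma_word_simps)
  also have "sigma_word (rev bs @ as) f = f" using assms by (intro sigma_word_id r) simp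
  finally show ?thesis .
qed

definition weyl_act :: "('a \<Rightarrow> 'a) \<Rightarrow> 'a ratfun \<Rightarrow> 'a ratfun" where
  "weyl_act w = sigma_word (SOME js. is_word js w)"

lemma weyl_act_word: "set js \<subseteq> {1..r} \<Longrightarrow> weyl_act (word_prod js) f = sigma_word js f"
proof -
  assume js: "set js \<subseteq> {1..r}"
  then have "is_word js (word_prod js)" by (simp add: is_word_def)
  then have "is_word (SOME bs. is_word bs (word_prod js)) (word_prod js)" by (rule someI)
  then show ?thesis unfolding weyl_act_def using js by (intro sigma_word_cong) (simp_all add: is_word_def)
qed

lemma weyl_act_id: "weyl_act id f = f"
  using weyl_act_word[of "[]" f] by (simp add: sigma_word_simps id_def)

lemma weyl_act_s: "i \<in> {1..r} \<Longrightarrow> w \<in> W \<Longrightarrow> weyl_act (s i \<circ> w) f = sigma i (weyl_act w f)"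
proof -
  assume i: "i \<in> {1..r}" and "w \<in> W"
  then obtain js where js: "set js \<subseteq> {1..r}" "w = word_prod js" using W_word[of w] unfolding is_word_def by metis
  show ?thesis
    using weyl_act_word[of "i # js" f] weyl_act_word[OF js(1), of f] i js(1)
    unfolding js(2) word_prod_simps sigma_word_simps by simp
qed

text \<open>The word is the one chosen inside \<open>along\<close>. It stays existential, since the
  comparison of coefficients works for any reduced word.\<close>

lemma along_expand:
  assumes F: "\<And>i f. i \<in> {1..r} \<Longrightarrow> F i f = c i * f + z i * sigma i f"
    and cz: "\<And>i. i \<in> {1..r} \<Longrightarrow> c i \<in> K 0 \<and> z i \<in> K 0" and w: "w \<in> W"
  shows "\<exists>js. reduced_word js w \<and> (\<forall>f. along F w f = (\<Sum>u\<in>W. coef c z js u * weyl_act u f))"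
proof -
  define js where "js = (SOME js. reduced_word js w)"
  have red: "reduced_word js w" unfolding js_def using ex_reduced_word[OF w] by (rule someI_ex)
  then have js: "set js \<subseteq> {1..r}" by (simp add: reduced_word_iff)
  have "along F w f = (\<Sum>u\<in>W. coef c z js u * weyl_act u f)" for f
  proof -
    have "foldr (\<lambda>i G. F i \<circ> G) bs id f = foldr F bs f" for bs by (induction bs) simp_all
    then have "along F w f = foldr F js f" unfolding along_def js_def .
    also have "\<dots> = foldr (\<lambda>i f. c i * f + z i * sigma i f) js f"
      using js F by (intro foldr_cong) auto
    also have "\<dots> = (\<Sum>u\<in>W. coef c z js u * weyl_act u f)"
    proof (rule expand_word[where S = "K 0", THEN conjunct2])
      show "weyl_act id f = f" for f by (rule weyl_act_id)
      show "weyl_act (s i \<circ> w) f = sigma i (weyl_act w f)" if "i \<in> {1..r}" "w \<in> W" for i w f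
        using that by (rule weyl_act_s)
      show "sigma i (\<Sum>w\<in>W. h w) = (\<Sum>w\<in>W. sigma i (h w))" if "i \<in> {1..r}" for i h
        using that by (rule sigma_sum)
      show "sigma i (h * f) = act (s i) h * sigma i f" if "i \<in> {1..r}" "h \<in> K 0" for i h f
        using that by (rule sigma_mult)
      show "act (s i) h \<in> K 0" if "i \<in> {1..r}" "h \<in> K 0" for i h using that by (rule K_0_act)
    qed (assumption | rule K_zero K_0_1 K_add K_0_mult cz js)+
    finally show ?thesis .
  qed
  with red show ?thesis by blast
qed

text \<open>Both sides are expanded in the \<open>weyl_act u\<close>; equality of the coefficients
  is \<open>Delta_coef_longest\<close>, a statement about the permutation action alone.\<close>

lemma Delta_Demazure:
  assumes w0: "longest w0"
  shows "Delta * Demazure w0 f = (\<Sum>w\<in>W. Demazure_Lusztig w f)"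
proof -
  have "\<exists>js. reduced_word js w0 \<and> (\<forall>f. Demazure w0 f = (\<Sum>u\<in>W. coef dc dz js u * weyl_act u f))"
    unfolding Demazure_def
  proof (rule along_expand[of demazure dc dz w0])
    show "demazure i f = dc i * f + dz i * sigma i f" if "i \<in> {1..r}" for i f using that by (rule demazure_eq)
    show "dc i \<in> K 0 \<and> dz i \<in> K 0" if "i \<in> {1..r}" for i using coeffs_K_0(3,4)[OF that] by simp
    show "w0 \<in> W" using w0 by (simp add: longest_def)
  qed
  then obtain js where js: "reduced_word js w0"
    and D: "\<And>f. Demazure w0 f = (\<Sum>u\<in>W. coef dc dz js u * weyl_act u f)" by blast
  have T: "Demazure_Lusztig w f = (\<Sum>u\<in>W. T_coef v w u * weyl_act u f)" if w: "w \<in> W" for w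
  proof -
    have "\<exists>bs. reduced_word bs w \<and> (\<forall>f. Demazure_Lusztig w f = (\<Sum>u\<in>W. coef (cc v) (zz v) bs u * weyl_act u f))"
      unfolding Demazure_Lusztig_def
    proof (rule along_expand[of demazure_lusztig "cc v" "zz v" w])
      show "demazure_lusztig i f = cc v i * f + zz v i * sigma i f" if "i \<in> {1..r}" for i f
        using that by (rule demazure_lusztig_eq)
      show "cc v i \<in> K 0 \<and> zz v i \<in> K 0" if "i \<in> {1..r}" for i using coeffs_K_0(1,2)[OF that] by simp
      show "w \<in> W" by (rule w)
    qed
    then obtain bs where bs: "reduced_word bs w"
      and T: "\<And>f. Demazure_Lusztig w f = (\<Sum>u\<in>W. coef (cc v) (zz v) bs u * weyl_act u f)" by blast
    show ?thesis unfolding T T_coef_word[OF bs] ..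
  qed
  have Delta: "Delta = Delta_q v" by (simp add: Delta_def Delta_q_def rt_def)
  have "Delta * Demazure w0 f = (\<Sum>u\<in>W. Delta_q v * coef dc dz js u * weyl_act u f)"
    unfolding D Delta sum_distrib_left by (simp only: mult.assoc)
  also have "\<dots> = (\<Sum>u\<in>W. \<Sum>w\<in>W. T_coef v w u * weyl_act u f)"
    using Delta_coef_longest[OF js w0, of _ v] by (intro sum.cong) (simp_all add: sum_distrib_right)
  also have "\<dots> = (\<Sum>w\<in>W. \<Sum>u\<in>W. T_coef v w u * weyl_act u f)" by (rule sum.swap)
  also have "\<dots> = (\<Sum>w\<in>W. Demazure_Lusztig w f)" using T by (intro sum.cong) simp_all
  finally show ?thesis .
qed

end

theorem theorem4:
  fixes \<Phi> :: "'l::zlattice set"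
    and coroot :: "'l \<Rightarrow> 'l \<Rightarrow> int"
    and r :: nat
    and \<alpha> :: "nat \<Rightarrow> 'l"
    and Q :: "'l \<Rightarrow> int"
    and n :: nat
    and v :: complex
    and g :: "int \<Rightarrow> complex"
    and w0 :: "'l \<Rightarrow> 'l"
  assumes "metaplectic \<Phi> coroot r \<alpha> Q n v g"
    and "metaplectic_data.longest \<Phi> coroot r \<alpha> w0"
  shows "(\<lambda>f. metaplectic_data.Delta \<Phi> r \<alpha> Q n v * metaplectic_data.Demazure coroot r \<alpha> Q n v g w0 f) =
    (\<lambda>f. \<Sum>w\<in>metaplectic_data.W \<Phi> coroot. metaplectic_data.Demazure_Lusztig coroot r \<alpha> Q n v g w f)"
proof -
  interpret metaplectic \<Phi> coroot r \<alpha> Q n v g by (rule assms(1))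
  show ?thesis using Delta_Demazure[OF assms(2)] by (simp add: fun_eq_iff)
qed

end
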